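(* Let $J\subseteq I$ and let $\mathsf{v}$ be a $J$-parameter system. Let $M_{J,\mathsf v}$ be a (free) module over the ring $\mathsf R[\zeta_J]$ with basis $\{\mathbf m_u\mid u\in W^J\}$, and for $u\in W^J$, $i\in\{0\}\cup I$ and $\sigma\in\Sigma$ define $$\mathbf m_u\cdot T_i=\begin{cases}\zeta_J^{\mathrm{wt}(us_i)}\mathbf m_{\theta^J(us_i)}&\text{if } u\to us_i\text{ is positive and }us_i\in\mathbb W^J\\ \zeta_J^{\mathrm{wt}(us_i)}\mathbf m_{\theta^J(us_i)}+(\mathsf q_i-\mathsf q_i^{-1})\mathbf m_u&\text{if }u\to us_i\text{ is negative and }us_i\in\mathbb W^J\\ \mathsf v_{u\alpha_i}\mathsf v_{2u\alpha_i}\mathbf m_u&\text{if }us_i\notin\mathbb W^J\ (\text{in which case } u\alpha_i\in\Phi_J+\mathbb Z\delta)\end{cases}$$ $$\mathbf m_u\cdot T_\sigma=\zeta_J^{\mathrm{wt}(u\sigma)}\mathbf m_{\theta^J(u\sigma)}.$$ This extends to a right action of the extended affine Hecke algebra $\widetilde{\mathcal H}$ on $M_{J,\mathsf v}$.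
   Context: Root system and groups. $\Phi$ is an irreducible, not necessarily reduced, crystallographic root system of rank $n$ in an $n$-dimensional Euclidean space $(V,\langle\cdot,\cdot\rangle)$, with simple roots $\alpha_i$, $i\in I=\{1,\dots,n\}$ (Bourbaki labelling), positive roots $\Phi^+$, highest root $\varphi$, and $\alpha^\vee=2\alpha/\langle\alpha,\alpha\rangle$. If $\Phi$ is not reduced it is of type $BC_n$: $V=\mathbb R^n$, $\alpha_j=e_j-e_{j+1}$ ($j<n$), $\alpha_n=e_n$, $\Phi^+=\{e_i\pm e_j\ (i<j),\ e_k,\ 2e_k\}$. Let $\omega_i\in V$ satisfy $\langle\omega_i,\alpha_j\rangle=\delta_{ij}$, $P=\bigoplus_i\mathbb Z\omega_i$, $Q=\mathbb Z\Phi^\vee\subseteq P$. For $\alpha\in\Phi$, $k\in\mathbb Z$: $H_{\alpha,k}=\{x\in V:\langle x,\alpha\rangle=k\}$, $s_{\alpha,k}(x)=x-(\langle x,\alpha\rangle-k)\alpha^\vee$, $s_\alpha=s_{\alpha,0}$, $s_i=s_{\alpha_i}$, $s_0=s_{\varphi,1}$. $W_0=\langle s_1,\dots,s_n\rangle$; $W=Q\rtimes W_0$ is the affine Weyl group, a Coxeter group with generators $s_0,\dots,s_n$ and length $\ell$; $\widetilde W=P\rtimes W_0$, where $\lambda\in P$ acts as the translation $t_\lambda$. Each $w\in\widetilde W$ is uniquely $w=t_{\mathrm{wt}(w)}\theta(w)$ with $\mathrm{wt}(w)\in P$, $\theta(w)\in W_0$. $A_0=\{x\in V:0\le\langle x,\alpha\rangle\le1\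 \forall\alpha\in\Phi^+\}$; $\Sigma$ is the stabiliser of $A_0$ in $\widetilde W$; $\widetilde W=W\rtimes\Sigma$, $\ell(w\sigma)=\ell(w)$, and $\sigma s_i\sigma^{-1}=s_{\sigma(i)}$ for $\sigma\in\Sigma$. The crossing $w\to ws_i$ is positive (resp. negative) if $ws_iA_0$ lies in $\{\langle x,\alpha\rangle\ge k\}$ (resp. $\{\langle x,\alpha\rangle\le k\}$), where $H_{\alpha,k}$ with $\alpha\in\Phi^+$ is the hyperplane separating $wA_0$ and $ws_iA_0$. Affine roots are formal expressions $\alpha+k\delta$ ($\alpha\in\Phi$, $k\in\mathbb Z$), with $\alpha_0=-\varphi+\delta$ and $u(\alpha+k\delta)=u\alpha+k\delta$ for $u\in W_0$. Objects attached to $J\subseteq I$. $W_J=\langle s_j:j\in J\rangle$; $W^J$ is the set of minimal length representatives of the cosets $W_Jw$, $w\in W_0$; $\Phi_J$ is the set of roots in the span of $\{\alpha_j\}_{j\in J}$, $\Phi_J^+=\Phi_J\cap\Phi^+$; $Q_J=\sum_{\alpha\in\Phi_J}\mathbb Z\alpha^\vee$. For $w\in\widetilde W$ write $\theta(w)=\theta_J(w)\theta^J(w)$ with $\theta_J(w)\in W_J$, $\theta^J(w)\in W^J$. $\mathcal A_J=\{x\in V:0\le\langle x,\alpha\rangle\le1\ \forall\alpha\in\Phi_J^+\}$ and $\mathbb W^J=\{w\in\widetilde W:wA_0\subseteq\mathcal A_J\}$. Hecke algebra. $\mathsf q_0,\dots,\mathsf q_n$ are commuting invertible indeterminates with $\mathsf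 q_i=\mathsf q_j$ whenever $s_i,s_j$ are conjugate in $\widetilde W$ (in particular $\mathsf q_0=\mathsf q_1$ if $\Phi=A_1$, $\mathsf q_0=\mathsf q_n$ if $\Phi=C_n$, and $\mathsf q_{\sigma(i)}=\mathsf q_i$ for $\sigma\in\Sigma$), $\mathsf R=\mathbb Z[\mathsf q_0^{\pm1},\dots,\mathsf q_n^{\pm1}]$. $\widetilde{\mathcal H}$ is the $\mathsf R$-algebra with basis $\{T_w:w\in\widetilde W\}$ and $T_wT_v=T_{wv}$ if $\ell(wv)=\ell(w)+\ell(v)$, $T_wT_{s_i}=T_{ws_i}+(\mathsf q_i-\mathsf q_i^{-1})T_w$ if $\ell(ws_i)=\ell(w)-1$; $T_i=T_{s_i}$. A $J$-parameter system is a family $\mathsf v=(\mathsf v_\alpha)_{\alpha\in\Phi_J}$ of invertible elements of $\mathsf R$ with (1) $\mathsf v_\alpha=\mathsf v_\beta$ if $\beta\in W_J\alpha$; (2) $\mathsf v_{\alpha_j}\in\{\mathsf q_j,-\mathsf q_j^{-1}\}$ for $j\in J$ with $2\alpha_j\notin\Phi_J$; (3) if $\Phi_J$ is not reduced, $\mathsf v_{2\alpha_n}\in\{\mathsf q_0,-\mathsf q_0^{-1}\}$ and $\mathsf v_{\alpha_n}\mathsf v_{2\alpha_n}\in\{\mathsf q_n,-\mathsf q_n^{-1}\}$. Set $\mathsf v_{\alpha+k\delta}=\mathsf v_\alpha$ for $\alpha\in\Phi_J$, $k\in\mathbb Z$, and $\mathsf v_\beta=1$ for $\beta\notin\Phi_J+\mathbb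 Z\delta$. Ring $\mathsf R[\zeta_J]$. With commuting invertible indeterminates $\zeta_i$ ($i\in I$) and $\zeta^\lambda=\prod_i\zeta_i^{a_i}$ for $\lambda=\sum_ia_i\omega_i\in P$, $\mathsf R[\zeta_J]$ is the quotient of $\mathsf R[\zeta_i^{\pm1}:i\in I]$ by the ideal generated by $\zeta^\gamma-1$, $\gamma\in Q_J$, and $\zeta_J^\lambda$ is the image of $\zeta^\lambda$. *)

theory Defs
  imports
    "HOL-Analysis.Analysis"
    "HOL-Algebra.QuotRing"
    "HOL-Algebra.Module"
    "HOL-Library.Poly_Mapping"
begin

section \<open>Root systems\<close>

text \<open>
  The Euclidean space \<open>V\<close> is the type \<open>'a\<close>, of dimension \<open>n = DIM('a)\<close>, and \<open>I = {1..n}\<close>.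
  The simple roots are a family \<open>\<alpha> :: nat \<Rightarrow> 'a\<close> of which only the values on \<open>I\<close> matter.
\<close>

definition coroot :: "'a::euclidean_space \<Rightarrow> 'a" where
  "coroot a = (2 / (a \<bullet> a)) *\<^sub>R a"

definition refl :: "'a::euclidean_space \<Rightarrow> int \<Rightarrow> 'a \<Rightarrow> 'a" where
  "refl a k x = x - (x \<bullet> a - of_int k) *\<^sub>R coroot a"

definition root_system :: "'a::euclidean_space set \<Rightarrow> bool" where
  "root_system \<Phi> \<longleftrightarrow>
     finite \<Phi> \<and> 0 \<notin> \<Phi> \<and> span \<Phi> = UNIV \<and>
     (\<forall>a\<in>\<Phi>. \<forall>b\<in>\<Phi>. refl a 0 b \<in> \<Phi>) \<and>
     (\<forall>a\<in>\<Phi>. \<forall>b\<in>\<Phi>. b \<bullet> coroot a \<in> \<int>)"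

definition irreducible_roots :: "'a::euclidean_space set \<Rightarrow> bool" where
  "irreducible_roots \<Phi> \<longleftrightarrow>
     \<Phi> \<noteq> {} \<and>
     \<not> (\<exists>A B. A \<noteq> {} \<and> B \<noteq> {} \<and> A \<union> B = \<Phi> \<and> A \<inter> B = {} \<and> (\<forall>a\<in>A. \<forall>b\<in>B. a \<bullet> b = 0))"

definition reduced_roots :: "'a::euclidean_space set \<Rightarrow> bool" where
  "reduced_roots \<Phi> \<longleftrightarrow> (\<forall>a\<in>\<Phi>. \<forall>c::real. c *\<^sub>R a \<in> \<Phi> \<longrightarrow> c = 1 \<or> c = -1)"

definition nonneg_comb :: "(nat \<Rightarrow> 'a::euclidean_space) \<Rightarrow> 'a \<Rightarrow> bool" where
  "nonneg_comb \<alpha> x \<longleftrightarrow> (\<exists>c :: nat \<Rightarrow> nat. x = (\<Sum>i = 1..DIM('a). of_nat (c i) *\<^sub>R \<alpha> i))"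

definition simple_system :: "'a::euclidean_space set \<Rightarrow> (nat \<Rightarrow> 'a) \<Rightarrow> bool" where
  "simple_system \<Phi> \<alpha> \<longleftrightarrow>
     \<alpha> ` {1..DIM('a)} \<subseteq> \<Phi> \<and> inj_on \<alpha> {1..DIM('a)} \<and> independent (\<alpha> ` {1..DIM('a)}) \<and>
     (\<forall>b\<in>\<Phi>. nonneg_comb \<alpha> b \<or> nonneg_comb \<alpha> (- b))"

text \<open>\<open>\<Phi>\<close> and \<open>\<alpha>\<close> are in the standard \<open>BC\<^sub>n\<close> form with respect to some orthonormal basis.\<close>

definition standard_BC :: "'a::euclidean_space set \<Rightarrow> (nat \<Rightarrow> 'a) \<Rightarrow> bool" where
  "standard_BC \<Phi> \<alpha> \<longleftrightarrow> (\<exists>e :: nat \<Rightarrow> 'a.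
     (\<forall>i\<in>{1..DIM('a)}. \<forall>j\<in>{1..DIM('a)}. e i \<bullet> e j = (if i = j then 1 else 0)) \<and>
     (\<forall>j\<in>{1..<DIM('a)}. \<alpha> j = e j - e (j + 1)) \<and>
     \<alpha> DIM('a) = e DIM('a) \<and>
     (let P = {e i - e j | i j. 1 \<le> i \<and> i < j \<and> j \<le> DIM('a)} \<union>
              {e i + e j | i j. 1 \<le> i \<and> i < j \<and> j \<le> DIM('a)} \<union>
              {e k | k. 1 \<le> k \<and> k \<le> DIM('a)} \<union>
              {2 *\<^sub>R e k | k. 1 \<le> k \<and> k \<le> DIM('a)}
      in \<Phi> = P \<union> uminus ` P))"

text \<open>
  For reduced \<open>\<Phi>\<close> any numbering of the simple roots is allowed: everything below is equivariant
  under renumbering, so Bourbaki's numbering is just one instance.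
  In the non-reduced case the index \<open>n\<close> is distinguished, and \<open>standard_BC\<close> fixes it.
\<close>

definition root_setting :: "'a::euclidean_space set \<Rightarrow> (nat \<Rightarrow> 'a) \<Rightarrow> bool" where
  "root_setting \<Phi> \<alpha> \<longleftrightarrow>
     root_system \<Phi> \<and> irreducible_roots \<Phi> \<and> simple_system \<Phi> \<alpha> \<and>
     (\<not> reduced_roots \<Phi> \<longrightarrow> standard_BC \<Phi> \<alpha>)"

definition pos_roots :: "'a::euclidean_space set \<Rightarrow> (nat \<Rightarrow> 'a) \<Rightarrow> 'a set" where
  "pos_roots \<Phi> \<alpha> = {b \<in> \<Phi>. nonneg_comb \<alpha> b}"

definition highest_root :: "'a::euclidean_space set \<Rightarrow> (nat \<Rightarrow> 'a) \<Rightarrow> 'a" where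
  "highest_root \<Phi> \<alpha> = (THE p. p \<in> \<Phi> \<and> (\<forall>b\<in>\<Phi>. nonneg_comb \<alpha> (p - b)))"

definition fund_coweight :: "(nat \<Rightarrow> 'a::euclidean_space) \<Rightarrow> nat \<Rightarrow> 'a" where
  "fund_coweight \<alpha> i = (THE x. \<forall>j\<in>{1..DIM('a)}. x \<bullet> \<alpha> j = (if i = j then 1 else 0))"

definition coweight_lattice :: "(nat \<Rightarrow> 'a::euclidean_space) \<Rightarrow> 'a set" where
  "coweight_lattice \<alpha> =
     {(\<Sum>i = 1..DIM('a). of_int (c i) *\<^sub>R fund_coweight \<alpha> i) | c :: nat \<Rightarrow> int. True}"


section \<open>The extended affine Weyl group\<close>

text \<open>Group elements are represented by the affine maps of \<open>V\<close> through which they act.\<close>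

definition gen_refl :: "'a::euclidean_space set \<Rightarrow> (nat \<Rightarrow> 'a) \<Rightarrow> nat \<Rightarrow> 'a \<Rightarrow> 'a" where
  "gen_refl \<Phi> \<alpha> i = (if i = 0 then refl (highest_root \<Phi> \<alpha>) 1 else refl (\<alpha> i) 0)"

definition word_map :: "'a::euclidean_space set \<Rightarrow> (nat \<Rightarrow> 'a) \<Rightarrow> nat list \<Rightarrow> 'a \<Rightarrow> 'a" where
  "word_map \<Phi> \<alpha> is = foldr (\<lambda>i f. gen_refl \<Phi> \<alpha> i \<circ> f) is id"

text \<open>The generators are involutions, so the words in them already form a group.\<close>

definition parabolic :: "'a::euclidean_space set \<Rightarrow> (nat \<Rightarrow> 'a) \<Rightarrow> nat set \<Rightarrow> ('a \<Rightarrow> 'a) set" where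
  "parabolic \<Phi> \<alpha> J = {word_map \<Phi> \<alpha> is | is. set is \<subseteq> J}"

definition weyl :: "'a::euclidean_space set \<Rightarrow> (nat \<Rightarrow> 'a) \<Rightarrow> ('a \<Rightarrow> 'a) set" where
  "weyl \<Phi> \<alpha> = parabolic \<Phi> \<alpha> {1..DIM('a)}"

definition transl :: "'a::euclidean_space \<Rightarrow> 'a \<Rightarrow> 'a" where
  "transl l x = l + x"

definition ext_weyl :: "'a::euclidean_space set \<Rightarrow> (nat \<Rightarrow> 'a) \<Rightarrow> ('a \<Rightarrow> 'a) set" where
  "ext_weyl \<Phi> \<alpha> = {transl l \<circ> u | l u. l \<in> coweight_lattice \<alpha> \<and> u \<in> weyl \<Phi> \<alpha>}"

definition wt :: "'a::euclidean_space set \<Rightarrow> (nat \<Rightarrow> 'a) \<Rightarrow> ('a \<Rightarrow> 'a) \<Rightarrow> 'a" where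
  "wt \<Phi> \<alpha> w = (THE l. l \<in> coweight_lattice \<alpha> \<and> (\<exists>u\<in>weyl \<Phi> \<alpha>. w = transl l \<circ> u))"

definition lin_part :: "'a::euclidean_space set \<Rightarrow> (nat \<Rightarrow> 'a) \<Rightarrow> ('a \<Rightarrow> 'a) \<Rightarrow> 'a \<Rightarrow> 'a" where
  "lin_part \<Phi> \<alpha> w = (THE u. u \<in> weyl \<Phi> \<alpha> \<and> (\<exists>l\<in>coweight_lattice \<alpha>. w = transl l \<circ> u))"

definition fund_alcove :: "'a::euclidean_space set \<Rightarrow> (nat \<Rightarrow> 'a) \<Rightarrow> 'a set" where
  "fund_alcove \<Phi> \<alpha> = {x. \<forall>a\<in>pos_roots \<Phi> \<alpha>. 0 \<le> x \<bullet> a \<and> x \<bullet> a \<le> 1}"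

definition alcove_stab :: "'a::euclidean_space set \<Rightarrow> (nat \<Rightarrow> 'a) \<Rightarrow> ('a \<Rightarrow> 'a) set" where
  "alcove_stab \<Phi> \<alpha> = {w \<in> ext_weyl \<Phi> \<alpha>. w ` fund_alcove \<Phi> \<alpha> = fund_alcove \<Phi> \<alpha>}"

text \<open>The Coxeter length on the affine Weyl group, extended by \<open>\<ell>(w\<sigma>) = \<ell>(w)\<close>.\<close>

definition len :: "'a::euclidean_space set \<Rightarrow> (nat \<Rightarrow> 'a) \<Rightarrow> ('a \<Rightarrow> 'a) \<Rightarrow> nat" where
  "len \<Phi> \<alpha> w = (LEAST k. \<exists>is \<sigma>. set is \<subseteq> {0..DIM('a)} \<and> length is = k \<and>
                  \<sigma> \<in> alcove_stab \<Phi> \<alpha> \<and> w = word_map \<Phi> \<alpha> is \<circ> \<sigma>)"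

definition separates :: "'a::euclidean_space \<Rightarrow> int \<Rightarrow> 'a set \<Rightarrow> 'a set \<Rightarrow> bool" where
  "separates a k A B \<longleftrightarrow>
     ((\<forall>x\<in>A. x \<bullet> a \<le> of_int k) \<and> (\<forall>x\<in>B. of_int k \<le> x \<bullet> a)) \<or>
     ((\<forall>x\<in>A. of_int k \<le> x \<bullet> a) \<and> (\<forall>x\<in>B. x \<bullet> a \<le> of_int k))"

text \<open>
  For non-reduced \<open>\<Phi>\<close> the separating wall may be both \<open>H\<^bsub>a,k\<^esub>\<close> and \<open>H\<^bsub>2a,2k\<^esub>\<close>;
  the two descriptions determine the same sides.
\<close>

definition pos_crossing ::
  "'a::euclidean_space set \<Rightarrow> (nat \<Rightarrow> 'a) \<Rightarrow> ('a \<Rightarrow> 'a) \<Rightarrow> nat \<Rightarrow> bool" where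
  "pos_crossing \<Phi> \<alpha> w i \<longleftrightarrow>
     (let A = w ` fund_alcove \<Phi> \<alpha>; B = (w \<circ> gen_refl \<Phi> \<alpha> i) ` fund_alcove \<Phi> \<alpha>
      in \<exists>a\<in>pos_roots \<Phi> \<alpha>. \<exists>k. separates a k A B \<and> (\<forall>x\<in>B. of_int k \<le> x \<bullet> a))"

definition neg_crossing ::
  "'a::euclidean_space set \<Rightarrow> (nat \<Rightarrow> 'a) \<Rightarrow> ('a \<Rightarrow> 'a) \<Rightarrow> nat \<Rightarrow> bool" where
  "neg_crossing \<Phi> \<alpha> w i \<longleftrightarrow>
     (let A = w ` fund_alcove \<Phi> \<alpha>; B = (w \<circ> gen_refl \<Phi> \<alpha> i) ` fund_alcove \<Phi> \<alpha>
      in \<exists>a\<in>pos_roots \<Phi> \<alpha>. \<exists>k. separates a k A B \<and> (\<forall>x\<in>B. x \<bullet> a \<le> of_int k))"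

text \<open>The affine root \<open>a + k\<delta>\<close> is the pair \<open>(a, k)\<close>.\<close>

definition simple_aff_root ::
  "'a::euclidean_space set \<Rightarrow> (nat \<Rightarrow> 'a) \<Rightarrow> nat \<Rightarrow> 'a \<times> int" where
  "simple_aff_root \<Phi> \<alpha> i = (if i = 0 then (- highest_root \<Phi> \<alpha>, 1) else (\<alpha> i, 0))"

definition act_aff_root :: "('a::euclidean_space \<Rightarrow> 'a) \<Rightarrow> 'a \<times> int \<Rightarrow> 'a \<times> int" where
  "act_aff_root u b = (u (fst b), snd b)"

definition double_aff_root :: "'a::euclidean_space \<times> int \<Rightarrow> 'a \<times> int" where
  "double_aff_root b = (2 *\<^sub>R fst b, 2 * snd b)"


section \<open>Objects attached to a set of simple roots\<close>

definition roots_J :: "'a::euclidean_space set \<Rightarrow> (nat \<Rightarrow> 'a) \<Rightarrow> nat set \<Rightarrow> 'a set" where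
  "roots_J \<Phi> \<alpha> J = \<Phi> \<inter> span (\<alpha> ` J)"

definition coroot_lattice_J :: "'a::euclidean_space set \<Rightarrow> (nat \<Rightarrow> 'a) \<Rightarrow> nat set \<Rightarrow> 'a set" where
  "coroot_lattice_J \<Phi> \<alpha> J =
     {(\<Sum>a\<in>roots_J \<Phi> \<alpha> J. of_int (c a) *\<^sub>R coroot a) | c :: 'a \<Rightarrow> int. True}"

definition min_reps :: "'a::euclidean_space set \<Rightarrow> (nat \<Rightarrow> 'a) \<Rightarrow> nat set \<Rightarrow> ('a \<Rightarrow> 'a) set" where
  "min_reps \<Phi> \<alpha> J =
     {u \<in> weyl \<Phi> \<alpha>. \<forall>v\<in>parabolic \<Phi> \<alpha> J. len \<Phi> \<alpha> u \<le> len \<Phi> \<alpha> (v \<circ> u)}"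

definition theta_up_J ::
  "'a::euclidean_space set \<Rightarrow> (nat \<Rightarrow> 'a) \<Rightarrow> nat set \<Rightarrow> ('a \<Rightarrow> 'a) \<Rightarrow> 'a \<Rightarrow> 'a" where
  "theta_up_J \<Phi> \<alpha> J w =
     (THE u. u \<in> min_reps \<Phi> \<alpha> J \<and> (\<exists>v\<in>parabolic \<Phi> \<alpha> J. lin_part \<Phi> \<alpha> w = v \<circ> u))"

definition alcove_J :: "'a::euclidean_space set \<Rightarrow> (nat \<Rightarrow> 'a) \<Rightarrow> nat set \<Rightarrow> 'a set" where
  "alcove_J \<Phi> \<alpha> J =
     {x. \<forall>a \<in> roots_J \<Phi> \<alpha> J \<inter> pos_roots \<Phi> \<alpha>. 0 \<le> x \<bullet> a \<and> x \<bullet> a \<le> 1}"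

definition ext_weyl_J :: "'a::euclidean_space set \<Rightarrow> (nat \<Rightarrow> 'a) \<Rightarrow> nat set \<Rightarrow> ('a \<Rightarrow> 'a) set" where
  "ext_weyl_J \<Phi> \<alpha> J = {w \<in> ext_weyl \<Phi> \<alpha>. w ` fund_alcove \<Phi> \<alpha> \<subseteq> alcove_J \<Phi> \<alpha> J}"


section \<open>Coefficient rings\<close>

text \<open>
  \<open>laurent_ring X C\<close> is the ring of Laurent polynomials in the variables \<open>X\<close> with coefficients
  in the subring \<open>C\<close>. A monomial is its exponent vector \<open>'x \<Rightarrow>\<^sub>0 int\<close>, and multiplication of
  polynomial mappings is convolution.
\<close>

definition laurent_ring ::
  "'x set \<Rightarrow> 'c::comm_ring_1 set \<Rightarrow> (('x \<Rightarrow>\<^sub>0 int) \<Rightarrow>\<^sub>0 'c) ring" where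
  "laurent_ring X C =
     \<lparr>carrier = {f. \<forall>\<mu> \<in> Poly_Mapping.keys f. Poly_Mapping.keys \<mu> \<subseteq> X \<and> Poly_Mapping.lookup f \<mu> \<in> C},
      monoid.mult = (*), one = 1, zero = 0, add = (+)\<rparr>"

text \<open>
  The parameter \<open>q\<^sub>i\<close> is the variable named by the set of all \<open>j\<close> for which \<open>s\<^sub>j\<close> is conjugate to
  \<open>s\<^sub>i\<close> in the extended affine Weyl group; this makes parameters of conjugate reflections equal.
\<close>

type_synonym qpoly = "(nat set \<Rightarrow>\<^sub>0 int) \<Rightarrow>\<^sub>0 int"

definition conj_class :: "'a::euclidean_space set \<Rightarrow> (nat \<Rightarrow> 'a) \<Rightarrow> nat \<Rightarrow> nat set" where
  "conj_class \<Phi> \<alpha> i = {j \<in> {0..DIM('a)}.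
     \<exists>g \<in> ext_weyl \<Phi> \<alpha>. g \<circ> gen_refl \<Phi> \<alpha> i = gen_refl \<Phi> \<alpha> j \<circ> g}"

definition Rq :: "'a::euclidean_space set \<Rightarrow> (nat \<Rightarrow> 'a) \<Rightarrow> qpoly ring" where
  "Rq \<Phi> \<alpha> = laurent_ring (conj_class \<Phi> \<alpha> ` {0..DIM('a)}) UNIV"

definition qpar :: "'a::euclidean_space set \<Rightarrow> (nat \<Rightarrow> 'a) \<Rightarrow> nat \<Rightarrow> qpoly" where
  "qpar \<Phi> \<alpha> i = Poly_Mapping.single (Poly_Mapping.single (conj_class \<Phi> \<alpha> i) 1) 1"

text \<open>The element \<open>q\<^sub>i - q\<^sub>i\<^sup>-\<^sup>1\<close>.\<close>

definition qdiff :: "'a::euclidean_space set \<Rightarrow> (nat \<Rightarrow> 'a) \<Rightarrow> nat \<Rightarrow> qpoly" where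
  "qdiff \<Phi> \<alpha> i =
     qpar \<Phi> \<alpha> i \<ominus>\<^bsub>Rq \<Phi> \<alpha>\<^esub> inv\<^bsub>Rq \<Phi> \<alpha>\<^esub> (qpar \<Phi> \<alpha> i)"

text \<open>The pair of elements \<open>q\<^sub>i\<close>, \<open>-q\<^sub>i\<^sup>-\<^sup>1\<close>.\<close>

definition qvals :: "'a::euclidean_space set \<Rightarrow> (nat \<Rightarrow> 'a) \<Rightarrow> nat \<Rightarrow> qpoly set" where
  "qvals \<Phi> \<alpha> i =
     {qpar \<Phi> \<alpha> i, \<ominus>\<^bsub>Rq \<Phi> \<alpha>\<^esub> (inv\<^bsub>Rq \<Phi> \<alpha>\<^esub> (qpar \<Phi> \<alpha> i))}"

text \<open>A family indexed by \<open>\<Phi>\<^sub>J\<close> is a total function whose values outside \<open>\<Phi>\<^sub>J\<close> are never used.\<close>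

definition parameter_system ::
  "'a::euclidean_space set \<Rightarrow> (nat \<Rightarrow> 'a) \<Rightarrow> nat set \<Rightarrow> ('a \<Rightarrow> qpoly) \<Rightarrow> bool" where
  "parameter_system \<Phi> \<alpha> J v \<longleftrightarrow>
     (\<forall>a\<in>roots_J \<Phi> \<alpha> J. v a \<in> Units (Rq \<Phi> \<alpha>)) \<and>
     (\<forall>a\<in>roots_J \<Phi> \<alpha> J. \<forall>w\<in>parabolic \<Phi> \<alpha> J. v (w a) = v a) \<and>
     (\<forall>j\<in>J. 2 *\<^sub>R \<alpha> j \<notin> roots_J \<Phi> \<alpha> J \<longrightarrow> v (\<alpha> j) \<in> qvals \<Phi> \<alpha> j) \<and>
     (\<not> reduced_roots (roots_J \<Phi> \<alpha> J) \<longrightarrow>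
        v (2 *\<^sub>R \<alpha> DIM('a)) \<in> qvals \<Phi> \<alpha> 0 \<and>
        v (\<alpha> DIM('a)) \<otimes>\<^bsub>Rq \<Phi> \<alpha>\<^esub> v (2 *\<^sub>R \<alpha> DIM('a)) \<in> qvals \<Phi> \<alpha> DIM('a))"

definition vaff ::
  "'a::euclidean_space set \<Rightarrow> (nat \<Rightarrow> 'a) \<Rightarrow> nat set \<Rightarrow> ('a \<Rightarrow> qpoly) \<Rightarrow> 'a \<times> int \<Rightarrow> qpoly" where
  "vaff \<Phi> \<alpha> J v b = (if fst b \<in> roots_J \<Phi> \<alpha> J then v (fst b) else \<one>\<^bsub>Rq \<Phi> \<alpha>\<^esub>)"

type_synonym zpoly = "(nat \<Rightarrow>\<^sub>0 int) \<Rightarrow>\<^sub>0 qpoly"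

definition Rzeta :: "'a::euclidean_space set \<Rightarrow> (nat \<Rightarrow> 'a) \<Rightarrow> zpoly ring" where
  "Rzeta \<Phi> \<alpha> = laurent_ring {1..DIM('a)} (carrier (Rq \<Phi> \<alpha>))"

definition coweight_coords :: "(nat \<Rightarrow> 'a::euclidean_space) \<Rightarrow> 'a \<Rightarrow> (nat \<Rightarrow>\<^sub>0 int)" where
  "coweight_coords \<alpha> l = (THE \<mu>. Poly_Mapping.keys \<mu> \<subseteq> {1..DIM('a)} \<and>
     l = (\<Sum>i = 1..DIM('a). of_int (Poly_Mapping.lookup \<mu> i) *\<^sub>R fund_coweight \<alpha> i))"

definition zeta :: "(nat \<Rightarrow> 'a::euclidean_space) \<Rightarrow> 'a \<Rightarrow> zpoly" where
  "zeta \<alpha> l = Poly_Mapping.single (coweight_coords \<alpha> l) 1"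

definition zeta_ideal ::
  "'a::euclidean_space set \<Rightarrow> (nat \<Rightarrow> 'a) \<Rightarrow> nat set \<Rightarrow> zpoly set" where
  "zeta_ideal \<Phi> \<alpha> J = genideal (Rzeta \<Phi> \<alpha>)
     {zeta \<alpha> g \<ominus>\<^bsub>Rzeta \<Phi> \<alpha>\<^esub> \<one>\<^bsub>Rzeta \<Phi> \<alpha>\<^esub> | g. g \<in> coroot_lattice_J \<Phi> \<alpha> J}"

definition RzetaJ ::
  "'a::euclidean_space set \<Rightarrow> (nat \<Rightarrow> 'a) \<Rightarrow> nat set \<Rightarrow> zpoly set ring" where
  "RzetaJ \<Phi> \<alpha> J = Rzeta \<Phi> \<alpha> Quot zeta_ideal \<Phi> \<alpha> J"

definition zetaJ ::
  "'a::euclidean_space set \<Rightarrow> (nat \<Rightarrow> 'a) \<Rightarrow> nat set \<Rightarrow> 'a \<Rightarrow> zpoly set" where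
  "zetaJ \<Phi> \<alpha> J l = zeta_ideal \<Phi> \<alpha> J +>\<^bsub>Rzeta \<Phi> \<alpha>\<^esub> zeta \<alpha> l"

text \<open>The structure map from the coefficients, as constant Laurent polynomials, to the quotient.\<close>

definition scalJ ::
  "'a::euclidean_space set \<Rightarrow> (nat \<Rightarrow> 'a) \<Rightarrow> nat set \<Rightarrow> qpoly \<Rightarrow> zpoly set" where
  "scalJ \<Phi> \<alpha> J r = zeta_ideal \<Phi> \<alpha> J +>\<^bsub>Rzeta \<Phi> \<alpha>\<^esub> Poly_Mapping.single 0 r"


section \<open>The extended affine Hecke algebra and right actions\<close>

definition module_basis ::
  "('r, 'x) ring_scheme \<Rightarrow> ('r, 'm, 'y) module_scheme \<Rightarrow> 'i set \<Rightarrow> ('i \<Rightarrow> 'm) \<Rightarrow> bool" where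
  "module_basis R M B b \<longleftrightarrow>
     Module.module R M \<and> b \<in> B \<rightarrow> carrier M \<and>
     (\<forall>x\<in>carrier M. \<exists>!c. c \<in> B \<rightarrow>\<^sub>E carrier R \<and> finite {i \<in> B. c i \<noteq> \<zero>\<^bsub>R\<^esub>} \<and>
        x = (\<Oplus>\<^bsub>M\<^esub>i\<in>{i \<in> B. c i \<noteq> \<zero>\<^bsub>R\<^esub>}. c i \<odot>\<^bsub>M\<^esub> b i))"

text \<open>Associative unital algebras; the library's \<open>algebra\<close> locale is restricted to commutative ones.\<close>

definition assoc_algebra :: "('r, 'x) ring_scheme \<Rightarrow> ('r, 'h, 'y) module_scheme \<Rightarrow> bool" where
  "assoc_algebra R H \<longleftrightarrow>
     Module.module R H \<and> ring H \<and>
     (\<forall>r\<in>carrier R. \<forall>x\<in>carrier H. \<forall>y\<in>carrier H.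
        (r \<odot>\<^bsub>H\<^esub> x) \<otimes>\<^bsub>H\<^esub> y = r \<odot>\<^bsub>H\<^esub> (x \<otimes>\<^bsub>H\<^esub> y) \<and>
        x \<otimes>\<^bsub>H\<^esub> (r \<odot>\<^bsub>H\<^esub> y) = r \<odot>\<^bsub>H\<^esub> (x \<otimes>\<^bsub>H\<^esub> y))"

text \<open>
  The basis and the relations determine all products, so \<open>H\<close> with its basis \<open>T\<close> is unique up
  to a unique isomorphism.
\<close>

definition ext_hecke_algebra ::
  "'a::euclidean_space set \<Rightarrow> (nat \<Rightarrow> 'a) \<Rightarrow> (qpoly, 'h) module \<Rightarrow> (('a \<Rightarrow> 'a) \<Rightarrow> 'h) \<Rightarrow> bool" where
  "ext_hecke_algebra \<Phi> \<alpha> H T \<longleftrightarrow>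
     assoc_algebra (Rq \<Phi> \<alpha>) H \<and>
     module_basis (Rq \<Phi> \<alpha>) H (ext_weyl \<Phi> \<alpha>) T \<and>
     (\<forall>w\<in>ext_weyl \<Phi> \<alpha>. \<forall>v\<in>ext_weyl \<Phi> \<alpha>.
        len \<Phi> \<alpha> (w \<circ> v) = len \<Phi> \<alpha> w + len \<Phi> \<alpha> v \<longrightarrow> T w \<otimes>\<^bsub>H\<^esub> T v = T (w \<circ> v)) \<and>
     (\<forall>w\<in>ext_weyl \<Phi> \<alpha>. \<forall>i\<in>{0..DIM('a)}.
        len \<Phi> \<alpha> (w \<circ> gen_refl \<Phi> \<alpha> i) + 1 = len \<Phi> \<alpha> w \<longrightarrow>
        T w \<otimes>\<^bsub>H\<^esub> T (gen_refl \<Phi> \<alpha> i) =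
          T (w \<circ> gen_refl \<Phi> \<alpha> i) \<oplus>\<^bsub>H\<^esub> qdiff \<Phi> \<alpha> i \<odot>\<^bsub>H\<^esub> T w)"

text \<open>
  A right action of the \<open>R\<close>-algebra \<open>H\<close> on the \<open>S\<close>-module \<open>M\<close> by \<open>S\<close>-linear maps, where \<open>S\<close> is an
  \<open>R\<close>-algebra via \<open>\<iota>\<close>.
\<close>

definition right_action ::
  "('r, 'x) ring_scheme \<Rightarrow> ('s, 'y) ring_scheme \<Rightarrow> ('r \<Rightarrow> 's) \<Rightarrow>
   ('r, 'h, 'z) module_scheme \<Rightarrow> ('s, 'm, 'w) module_scheme \<Rightarrow> ('m \<Rightarrow> 'h \<Rightarrow> 'm) \<Rightarrow> bool" where
  "right_action R S \<iota> H M act \<longleftrightarrow>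
     (\<forall>x\<in>carrier M. \<forall>h\<in>carrier H. act x h \<in> carrier M) \<and>
     (\<forall>x\<in>carrier M. \<forall>y\<in>carrier M. \<forall>h\<in>carrier H.
        act (x \<oplus>\<^bsub>M\<^esub> y) h = act x h \<oplus>\<^bsub>M\<^esub> act y h) \<and>
     (\<forall>s\<in>carrier S. \<forall>x\<in>carrier M. \<forall>h\<in>carrier H.
        act (s \<odot>\<^bsub>M\<^esub> x) h = s \<odot>\<^bsub>M\<^esub> act x h) \<and>
     (\<forall>x\<in>carrier M. \<forall>h\<in>carrier H. \<forall>k\<in>carrier H.
        act x (h \<oplus>\<^bsub>H\<^esub> k) = act x h \<oplus>\<^bsub>M\<^esub> act x k) \<and>
     (\<forall>r\<in>carrier R. \<forall>x\<in>carrier M. \<forall>h\<in>carrier H.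
        act x (r \<odot>\<^bsub>H\<^esub> h) = \<iota> r \<odot>\<^bsub>M\<^esub> act x h) \<and>
     (\<forall>x\<in>carrier M. act x \<one>\<^bsub>H\<^esub> = x) \<and>
     (\<forall>x\<in>carrier M. \<forall>h\<in>carrier H. \<forall>k\<in>carrier H.
        act x (h \<otimes>\<^bsub>H\<^esub> k) = act (act x h) k)"

end

theory Submission
  imports Defs
begin

text \<open>
  The formulas define operators on the basis vectors \<open>m u\<close> only. The key is to attach a vector to every element
  \<open>w\<close> of the extended affine Weyl group,

    \<open>vec w = a w \<cdot> \<zeta>\<^sub>J (wt w) \<cdot> m (\<theta>\<^sup>J w)\<close>, with \<open>a w = \<Prod>\<^sub>\<beta> v\<^sub>\<beta> ^ k\<^sub>\<beta>(w)\<close> over the positive roots \<open>\<beta>\<close> of \<open>\<Phi>\<^sub>J\<close>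

  (\<open>fold_coeff w\<close> below), where \<open>w A0\<close> lies in the strip \<open>k\<^sub>\<beta>(w) \<le> \<langle>x, \<beta>\<rangle> \<le> k\<^sub>\<beta>(w) + 1\<close>. For \<open>u\<close> in \<open>W\<^sup>J\<close> all these strip numbers
  vanish and \<open>vec u = m u\<close>. Crossing a wall whose direction is outside \<open>\<Phi>\<^sub>J\<close> does not change \<open>a\<close>. Crossing a wall
  whose direction \<open>b\<close> is in \<open>\<Phi>\<^sub>J\<close> stays in the same coset of the affine Weyl group of \<open>\<Phi>\<^sub>J\<close> and multiplies \<open>a\<close> by
  \<open>\<nu>\<close> or \<open>\<nu>\<^sup>-\<^sup>1\<close>, where \<open>\<nu> = v\<^sub>b v\<^sub>2\<^sub>b\<close> is \<open>q\<^sub>i\<close> or \<open>- q\<^sub>i\<^sup>-\<^sup>1\<close>, so that \<open>\<nu> - \<nu>\<^sup>-\<^sup>1 = q\<^sub>i - q\<^sub>i\<^sup>-\<^sup>1\<close>. Thus the three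
  cases of the formula for \<open>T\<^sub>i\<close> merge into one rule for all \<open>w\<close> (lemma \<open>End_gen_vec\<close>):
  \<open>vec w \<cdot> T\<^sub>i\<close> is \<open>vec (w s\<^sub>i)\<close> for a positive crossing and \<open>vec (w s\<^sub>i) + (q\<^sub>i - q\<^sub>i\<^sup>-\<^sup>1) vec w\<close> for a negative one.

  In the Hecke algebra itself \<open>T\<^sub>w T\<^sub>i\<close> obeys the same rule as long as \<open>w A0\<close> lies deep inside the dominant chamber,
  because there positive crossings lengthen and negative crossings shorten (lemma \<open>len_dominant_crossing\<close>, by counting
  separating hyperplanes). So the linear map \<open>proj\<close> that sends \<open>T\<^sub>w\<close> to \<open>vec w\<close> turns right multiplication, applied
  to combinations of deep \<open>T\<^sub>w\<close>, into the operators on the module. A translation changes \<open>vec\<close> by a unit of the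
  coefficient ring only, so the deep vectors still determine a linear operator (lemma \<open>compat_unique\<close>): every \<open>h\<close> in
  the Hecke algebra has exactly one operator \<open>\<tau>\<close> with \<open>proj (x h) = \<tau> (proj x)\<close> for all sufficiently deep \<open>x\<close>.
  This relation between \<open>h\<close> and \<open>\<tau>\<close> is compatible with sums, multiples and products, so it is an action.
\<close>

section \<open>Linear maps out of free modules\<close>

text \<open>
  Linearity along a ring homomorphism: the Hecke algebra and the module have different scalars.
\<close>

definition linear_along ::
  "('r, 'x) ring_scheme \<Rightarrow> ('r \<Rightarrow> 's) \<Rightarrow> ('r, 'm, 'y) module_scheme \<Rightarrow> ('s, 'n, 'z) module_scheme \<Rightarrow>
   ('m \<Rightarrow> 'n) \<Rightarrow> bool" where
  "linear_along R \<iota> M N L \<longleftrightarrow>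
     L \<in> carrier M \<rightarrow> carrier N \<and>
     (\<forall>x\<in>carrier M. \<forall>y\<in>carrier M. L (x \<oplus>\<^bsub>M\<^esub> y) = L x \<oplus>\<^bsub>N\<^esub> L y) \<and>
     (\<forall>r\<in>carrier R. \<forall>x\<in>carrier M. L (r \<odot>\<^bsub>M\<^esub> x) = \<iota> r \<odot>\<^bsub>N\<^esub> L x)"

inductive_set rspan :: "('r, 'x) ring_scheme \<Rightarrow> ('r, 'm, 'y) module_scheme \<Rightarrow> ('i \<Rightarrow> 'm) \<Rightarrow> 'i set \<Rightarrow> 'm set"
  for R M b A where
    zero: "\<zero>\<^bsub>M\<^esub> \<in> rspan R M b A"
  | add: "x \<in> rspan R M b A \<Longrightarrow> y \<in> rspan R M b A \<Longrightarrow> x \<oplus>\<^bsub>M\<^esub> y \<in> rspan R M b A"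
  | gen: "r \<in> carrier R \<Longrightarrow> i \<in> A \<Longrightarrow> r \<odot>\<^bsub>M\<^esub> b i \<in> rspan R M b A"

locale free_module =
  fixes R :: "('r, 'x) ring_scheme" and M :: "('r, 'm, 'y) module_scheme" and B :: "'i set" and b :: "'i \<Rightarrow> 'm"
  assumes basis: "module_basis R M B b"

sublocale free_module \<subseteq> module R M
  using basis by (simp add: module_basis_def)

context free_module
begin

lemma basis_closed: "i \<in> B \<Longrightarrow> b i \<in> carrier M"
  using basis by (auto simp: module_basis_def)

definition rep :: "('i \<Rightarrow> 'r) \<Rightarrow> 'm \<Rightarrow> bool" where
  "rep c x \<longleftrightarrow> c \<in> B \<rightarrow>\<^sub>E carrier R \<and> finite {i \<in> B. c i \<noteq> \<zero>\<^bsub>R\<^esub>} \<and>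
     x = (\<Oplus>\<^bsub>M\<^esub>i\<in>{i \<in> B. c i \<noteq> \<zero>\<^bsub>R\<^esub>}. c i \<odot>\<^bsub>M\<^esub> b i)"

definition coef :: "'m \<Rightarrow> 'i \<Rightarrow> 'r" where "coef x = (THE c. rep c x)"

lemma rep_ex1: "x \<in> carrier M \<Longrightarrow> \<exists>!c. rep c x"
  using basis unfolding module_basis_def rep_def by blast

lemma rep_coef: "x \<in> carrier M \<Longrightarrow> rep (coef x) x"
  unfolding coef_def by (rule theI'[OF rep_ex1])

lemma rep_closed: "rep c x \<Longrightarrow> x \<in> carrier M"
proof -
  assume r: "rep c x"
  then have "(\<lambda>i. c i \<odot>\<^bsub>M\<^esub> b i) \<in> {i \<in> B. c i \<noteq> \<zero>\<^bsub>R\<^esub>} \<rightarrow> carrier M"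
    unfolding rep_def using basis_closed smult_closed by (auto dest: PiE_mem)
  then show "x \<in> carrier M" using r M.finsum_closed unfolding rep_def by metis
qed

lemma coef_eq: "rep c x \<Longrightarrow> coef x = c"
proof -
  assume r: "rep c x"
  show "coef x = c" using rep_ex1[OF rep_closed[OF r]] rep_coef[OF rep_closed[OF r]] r by metis
qed

lemma rspan_closed: assumes "A \<subseteq> B" "x \<in> rspan R M b A" shows "x \<in> carrier M"
  using assms(2) by induction (use assms(1) basis_closed in auto)

lemma finsum_in_rspan:
  assumes "finite F" "F \<subseteq> A" "A \<subseteq> B" "\<And>i. i \<in> F \<Longrightarrow> c i \<in> carrier R"
  shows "(\<Oplus>\<^bsub>M\<^esub>i\<in>F. c i \<odot>\<^bsub>M\<^esub> b i) \<in> rspan R M b A"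
  using assms
proof (induction F)
  case empty then show ?case by (simp add: rspan.zero)
next
  case (insert i F)
  have "(\<Oplus>\<^bsub>M\<^esub>i\<in>insert i F. c i \<odot>\<^bsub>M\<^esub> b i) = c i \<odot>\<^bsub>M\<^esub> b i \<oplus>\<^bsub>M\<^esub> (\<Oplus>\<^bsub>M\<^esub>i\<in>F. c i \<odot>\<^bsub>M\<^esub> b i)"
  proof (rule M.finsum_insert)
    have "c j \<odot>\<^bsub>M\<^esub> b j \<in> carrier M" if "j \<in> insert i F" for j
      using that insert.prems basis_closed by (intro smult_closed) blast+
    then show "(\<lambda>i. c i \<odot>\<^bsub>M\<^esub> b i) \<in> F \<rightarrow> carrier M" "c i \<odot>\<^bsub>M\<^esub> b i \<in> carrier M" by blast+
  qed (use insert.hyps in auto)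
  moreover have "c i \<odot>\<^bsub>M\<^esub> b i \<in> rspan R M b A" using insert.prems by (intro rspan.gen) blast+
  moreover have "(\<Oplus>\<^bsub>M\<^esub>i\<in>F. c i \<odot>\<^bsub>M\<^esub> b i) \<in> rspan R M b A" using insert by blast
  ultimately show ?case by (simp only: rspan.add)
qed

lemma rspan_full: assumes "x \<in> carrier M" shows "x \<in> rspan R M b B"
proof -
  have r: "rep (coef x) x" using rep_coef assms .
  then have "x = (\<Oplus>\<^bsub>M\<^esub>i\<in>{i \<in> B. coef x i \<noteq> \<zero>\<^bsub>R\<^esub>}. coef x i \<odot>\<^bsub>M\<^esub> b i)" by (simp only: rep_def)
  also have "\<dots> \<in> rspan R M b B"
    using r by (intro finsum_in_rspan) (auto simp: rep_def PiE_iff)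
  finally show ?thesis .
qed

lemma rspan_smult:
  assumes "A \<subseteq> B" "r \<in> carrier R" "x \<in> rspan R M b A" shows "r \<odot>\<^bsub>M\<^esub> x \<in> rspan R M b A"
  using assms(3)
proof induction
  case zero then show ?case using assms by (simp add: rspan.zero)
next
  case (add x y)
  then show ?case using assms rspan_closed[OF assms(1)] by (simp add: smult_r_distr rspan.add)
next
  case (gen s i)
  then have "r \<odot>\<^bsub>M\<^esub> (s \<odot>\<^bsub>M\<^esub> b i) = (r \<otimes>\<^bsub>R\<^esub> s) \<odot>\<^bsub>M\<^esub> b i"
    using assms basis_closed by (intro smult_assoc1[symmetric]) auto
  then show ?case using gen assms rspan.gen[of "r \<otimes>\<^bsub>R\<^esub> s" R i A M b] by simp
qed

lemma rspan_basis: "i \<in> A \<Longrightarrow> A \<subseteq> B \<Longrightarrow> b i \<in> rspan R M b A"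
  using rspan.gen[of "\<one>\<^bsub>R\<^esub>" R i A M b] basis_closed by (auto simp: subset_iff)

text \<open>
  Coefficients that vanish may be added to the support, so that two vectors can share one index set.
\<close>

lemma rep_sum:
  assumes "rep c x" "finite F" "F \<subseteq> B" "{i \<in> B. c i \<noteq> \<zero>\<^bsub>R\<^esub>} \<subseteq> F"
    and N: "Module.module S N" and i: "\<iota> \<in> carrier R \<rightarrow> carrier S" "\<iota> \<zero>\<^bsub>R\<^esub> = \<zero>\<^bsub>S\<^esub>"
    and f: "f \<in> B \<rightarrow> carrier N"
  shows "(\<Oplus>\<^bsub>N\<^esub>i\<in>{i \<in> B. c i \<noteq> \<zero>\<^bsub>R\<^esub>}. \<iota> (c i) \<odot>\<^bsub>N\<^esub> f i) = (\<Oplus>\<^bsub>N\<^esub>i\<in>F. \<iota> (c i) \<odot>\<^bsub>N\<^esub> f i)"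
proof -
  interpret N: module S N by (rule N)
  show ?thesis
  proof (rule N.M.add.finprod_mono_neutral_cong_left)
    show "(\<lambda>i. \<iota> (c i) \<odot>\<^bsub>N\<^esub> f i) \<in> F \<rightarrow> carrier N"
      using assms by (auto simp: rep_def PiE_iff Pi_iff subset_iff intro!: N.smult_closed)
  qed (use assms in \<open>auto simp: Pi_iff subset_iff intro!: N.smult_l_null\<close>)
qed

lemma rep_of_sum:
  assumes "finite F" "F \<subseteq> B" "\<And>i. i \<in> F \<Longrightarrow> c i \<in> carrier R"
  shows "rep (\<lambda>i. if i \<in> B then (if i \<in> F then c i else \<zero>\<^bsub>R\<^esub>) else undefined) (\<Oplus>\<^bsub>M\<^esub>i\<in>F. c i \<odot>\<^bsub>M\<^esub> b i)"
proof -
  define d where "d i = (if i \<in> B then (if i \<in> F then c i else \<zero>\<^bsub>R\<^esub>) else undefined)" for i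
  have sub: "{i \<in> B. d i \<noteq> \<zero>\<^bsub>R\<^esub>} \<subseteq> F" by (auto simp: d_def)
  have "(\<Oplus>\<^bsub>M\<^esub>i\<in>{i \<in> B. d i \<noteq> \<zero>\<^bsub>R\<^esub>}. d i \<odot>\<^bsub>M\<^esub> b i) = (\<Oplus>\<^bsub>M\<^esub>i\<in>F. c i \<odot>\<^bsub>M\<^esub> b i)"
    by (rule M.add.finprod_mono_neutral_cong_left)
      (use assms sub basis_closed in \<open>auto simp: d_def subset_iff intro!: smult_l_null\<close>)
  moreover have "finite {i \<in> B. d i \<noteq> \<zero>\<^bsub>R\<^esub>}" using sub assms(1) finite_subset by blast
  moreover have "d \<in> B \<rightarrow>\<^sub>E carrier R" using assms by (auto simp: d_def PiE_iff extensional_def)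
  ultimately have "rep d (\<Oplus>\<^bsub>M\<^esub>i\<in>F. c i \<odot>\<^bsub>M\<^esub> b i)" by (simp add: rep_def)
  then show ?thesis unfolding d_def .
qed

text \<open>
  A basis carries unique coefficients, so a map on the basis extends; additivity and homogeneity are checked
  on a common finite support.
\<close>

lemma linear_extension:
  assumes N: "Module.module S N" and i: "\<iota> \<in> ring_hom R S" and f: "f \<in> B \<rightarrow> carrier N"
  shows "\<exists>L. linear_along R \<iota> M N L \<and> (\<forall>i\<in>B. L (b i) = f i)"
proof -
  interpret N: module S N by (rule N)
  have i0: "\<iota> \<zero>\<^bsub>R\<^esub> = \<zero>\<^bsub>S\<^esub>"
    using ring_hom_zero[OF i R.ring_axioms N.R.ring_axioms] .
  have ic: "\<iota> \<in> carrier R \<rightarrow> carrier S" using ring_hom_closed[OF i] by blast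
  define L where "L x = (\<Oplus>\<^bsub>N\<^esub>i\<in>{i \<in> B. coef x i \<noteq> \<zero>\<^bsub>R\<^esub>}. \<iota> (coef x i) \<odot>\<^bsub>N\<^esub> f i)" for x
  have L_sum: "L (\<Oplus>\<^bsub>M\<^esub>i\<in>F. c i \<odot>\<^bsub>M\<^esub> b i) = (\<Oplus>\<^bsub>N\<^esub>i\<in>F. \<iota> (c i) \<odot>\<^bsub>N\<^esub> f i)"
    if F: "finite F" "F \<subseteq> B" and c: "\<And>i. i \<in> F \<Longrightarrow> c i \<in> carrier R" for F c
  proof -
    let ?d = "\<lambda>i. if i \<in> B then (if i \<in> F then c i else \<zero>\<^bsub>R\<^esub>) else undefined"
    let ?x = "\<Oplus>\<^bsub>M\<^esub>i\<in>F. c i \<odot>\<^bsub>M\<^esub> b i"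
    have r: "rep ?d ?x" by (rule rep_of_sum[OF F c])
    have "L ?x = (\<Oplus>\<^bsub>N\<^esub>i\<in>{i \<in> B. ?d i \<noteq> \<zero>\<^bsub>R\<^esub>}. \<iota> (?d i) \<odot>\<^bsub>N\<^esub> f i)"
      unfolding L_def coef_eq[OF r] by (rule HOL.refl)
    also have "\<dots> = (\<Oplus>\<^bsub>N\<^esub>i\<in>F. \<iota> (?d i) \<odot>\<^bsub>N\<^esub> f i)"
      by (rule rep_sum[OF r F _ N ic i0 f]) auto
    also have "\<dots> = (\<Oplus>\<^bsub>N\<^esub>i\<in>F. \<iota> (c i) \<odot>\<^bsub>N\<^esub> f i)"
      by (rule N.M.finsum_cong') (use F c f ic in \<open>auto simp: Pi_iff subset_iff intro!: N.smult_closed\<close>)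
    finally show ?thesis .
  qed
  \<comment> \<open>Every finite index set that contains the support may serve for the expansion.\<close>
  have expand: "\<exists>F c. finite F \<and> F \<subseteq> B \<and> (\<forall>i\<in>B. c i \<in> carrier R) \<and> (\<forall>i\<in>B - F. c i = \<zero>\<^bsub>R\<^esub>) \<and>
      (\<forall>G. finite G \<longrightarrow> F \<subseteq> G \<longrightarrow> G \<subseteq> B \<longrightarrow> x = (\<Oplus>\<^bsub>M\<^esub>i\<in>G. c i \<odot>\<^bsub>M\<^esub> b i))" if x: "x \<in> carrier M" for x
  proof (intro exI conjI allI impI)
    have r: "rep (coef x) x" using rep_coef x .
    show "finite {i \<in> B. coef x i \<noteq> \<zero>\<^bsub>R\<^esub>}" "\<forall>i\<in>B. coef x i \<in> carrier R" using r by (auto simp: rep_def PiE_iff)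
    fix G assume G: "finite G" "{i \<in> B. coef x i \<noteq> \<zero>\<^bsub>R\<^esub>} \<subseteq> G" "G \<subseteq> B"
    have "x = (\<Oplus>\<^bsub>M\<^esub>i\<in>{i \<in> B. coef x i \<noteq> \<zero>\<^bsub>R\<^esub>}. (\<lambda>r. r) (coef x i) \<odot>\<^bsub>M\<^esub> b i)" using r by (simp add: rep_def)
    also have "\<dots> = (\<Oplus>\<^bsub>M\<^esub>i\<in>G. (\<lambda>r. r) (coef x i) \<odot>\<^bsub>M\<^esub> b i)"
      by (rule rep_sum[OF r G(1) G(3) G(2) module_axioms]) (auto simp: basis_closed)
    finally show "x = (\<Oplus>\<^bsub>M\<^esub>i\<in>G. coef x i \<odot>\<^bsub>M\<^esub> b i)" by simp
  qed auto
  have cl: "(\<lambda>i. \<iota> (c i) \<odot>\<^bsub>N\<^esub> f i) \<in> F \<rightarrow> carrier N" if "F \<subseteq> B" "\<forall>i\<in>B. c i \<in> carrier R" for F c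
    using that f ic by (auto simp: Pi_iff subset_iff intro!: N.smult_closed)
  have clM: "(\<lambda>i. c i \<odot>\<^bsub>M\<^esub> b i) \<in> F \<rightarrow> carrier M" if "F \<subseteq> B" "\<forall>i\<in>B. c i \<in> carrier R" for F c
    using that basis_closed by (auto simp: Pi_iff subset_iff intro!: smult_closed)
  have L_closed: "L x \<in> carrier N" if x: "x \<in> carrier M" for x
  proof -
    obtain F c where F: "finite F" "F \<subseteq> B" "\<forall>i\<in>B. c i \<in> carrier R" "x = (\<Oplus>\<^bsub>M\<^esub>i\<in>F. c i \<odot>\<^bsub>M\<^esub> b i)"
      using expand[OF x] by blast
    then have "L x = (\<Oplus>\<^bsub>N\<^esub>i\<in>F. \<iota> (c i) \<odot>\<^bsub>N\<^esub> f i)" using L_sum[of F c] by blast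
    then show ?thesis using N.M.finsum_closed[OF cl[OF F(2,3)]] by simp
  qed
  have L_add: "L (x \<oplus>\<^bsub>M\<^esub> y) = L x \<oplus>\<^bsub>N\<^esub> L y" if x: "x \<in> carrier M" and y: "y \<in> carrier M" for x y
  proof -
    obtain F c where F: "finite F" "F \<subseteq> B" and c: "\<forall>i\<in>B. c i \<in> carrier R"
      and xe: "\<And>G. finite G \<Longrightarrow> F \<subseteq> G \<Longrightarrow> G \<subseteq> B \<Longrightarrow> x = (\<Oplus>\<^bsub>M\<^esub>i\<in>G. c i \<odot>\<^bsub>M\<^esub> b i)"
      using expand[OF x] by blast
    obtain F' d where F': "finite F'" "F' \<subseteq> B" and d: "\<forall>i\<in>B. d i \<in> carrier R"
      and ye: "\<And>G. finite G \<Longrightarrow> F' \<subseteq> G \<Longrightarrow> G \<subseteq> B \<Longrightarrow> y = (\<Oplus>\<^bsub>M\<^esub>i\<in>G. d i \<odot>\<^bsub>M\<^esub> b i)"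
      using expand[OF y] by blast
    define G where "G = F \<union> F'"
    have G: "finite G" "G \<subseteq> B" using F F' by (auto simp: G_def)
    have x': "x = (\<Oplus>\<^bsub>M\<^esub>i\<in>G. c i \<odot>\<^bsub>M\<^esub> b i)" and y': "y = (\<Oplus>\<^bsub>M\<^esub>i\<in>G. d i \<odot>\<^bsub>M\<^esub> b i)"
      using xe[OF G(1) _ G(2)] ye[OF G(1) _ G(2)] by (auto simp: G_def)
    have "x \<oplus>\<^bsub>M\<^esub> y = (\<Oplus>\<^bsub>M\<^esub>i\<in>G. c i \<odot>\<^bsub>M\<^esub> b i \<oplus>\<^bsub>M\<^esub> d i \<odot>\<^bsub>M\<^esub> b i)"
      unfolding x' y' using clM[OF G(2) c] clM[OF G(2) d] by (rule M.finsum_addf[symmetric])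
    also have "\<dots> = (\<Oplus>\<^bsub>M\<^esub>i\<in>G. (c i \<oplus>\<^bsub>R\<^esub> d i) \<odot>\<^bsub>M\<^esub> b i)"
      using G c d basis_closed by (intro M.finsum_cong') (auto simp: smult_l_distr Pi_iff subset_iff)
    finally have "L (x \<oplus>\<^bsub>M\<^esub> y) = (\<Oplus>\<^bsub>N\<^esub>i\<in>G. \<iota> (c i \<oplus>\<^bsub>R\<^esub> d i) \<odot>\<^bsub>N\<^esub> f i)"
      using L_sum[OF G, of "\<lambda>i. c i \<oplus>\<^bsub>R\<^esub> d i"] c d G by (auto simp: subset_iff)
    also have "\<dots> = (\<Oplus>\<^bsub>N\<^esub>i\<in>G. \<iota> (c i) \<odot>\<^bsub>N\<^esub> f i \<oplus>\<^bsub>N\<^esub> \<iota> (d i) \<odot>\<^bsub>N\<^esub> f i)"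
      using G c d f ic ring_hom_add[OF i]
      by (intro N.M.finsum_cong') (auto simp: N.smult_l_distr Pi_iff subset_iff)
    also have "\<dots> = (\<Oplus>\<^bsub>N\<^esub>i\<in>G. \<iota> (c i) \<odot>\<^bsub>N\<^esub> f i) \<oplus>\<^bsub>N\<^esub> (\<Oplus>\<^bsub>N\<^esub>i\<in>G. \<iota> (d i) \<odot>\<^bsub>N\<^esub> f i)"
      using cl[OF G(2) c] cl[OF G(2) d] by (rule N.M.finsum_addf)
    also have "\<dots> = L x \<oplus>\<^bsub>N\<^esub> L y"
      unfolding x' y' using L_sum[OF G, of c] L_sum[OF G, of d] c d G by (auto simp: subset_iff)
    finally show ?thesis .
  qed
  have L_smult: "L (r \<odot>\<^bsub>M\<^esub> x) = \<iota> r \<odot>\<^bsub>N\<^esub> L x" if r: "r \<in> carrier R" and x: "x \<in> carrier M" for r x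
  proof -
    obtain G c where G: "finite G" "G \<subseteq> B" and c: "\<forall>i\<in>B. c i \<in> carrier R"
      and xe: "x = (\<Oplus>\<^bsub>M\<^esub>i\<in>G. c i \<odot>\<^bsub>M\<^esub> b i)"
      using expand[OF x] by blast
    have "r \<odot>\<^bsub>M\<^esub> x = (\<Oplus>\<^bsub>M\<^esub>i\<in>G. r \<odot>\<^bsub>M\<^esub> (c i \<odot>\<^bsub>M\<^esub> b i))"
      unfolding xe using finsum_smult_ldistr[OF G(1) r clM[OF G(2) c]] .
    also have "\<dots> = (\<Oplus>\<^bsub>M\<^esub>i\<in>G. (r \<otimes>\<^bsub>R\<^esub> c i) \<odot>\<^bsub>M\<^esub> b i)"
      using G c r basis_closed by (intro M.finsum_cong') (auto simp: smult_assoc1 Pi_iff subset_iff)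
    finally have "L (r \<odot>\<^bsub>M\<^esub> x) = (\<Oplus>\<^bsub>N\<^esub>i\<in>G. \<iota> (r \<otimes>\<^bsub>R\<^esub> c i) \<odot>\<^bsub>N\<^esub> f i)"
      using L_sum[OF G, of "\<lambda>i. r \<otimes>\<^bsub>R\<^esub> c i"] c r G by (auto simp: subset_iff)
    also have "\<dots> = (\<Oplus>\<^bsub>N\<^esub>i\<in>G. \<iota> r \<odot>\<^bsub>N\<^esub> (\<iota> (c i) \<odot>\<^bsub>N\<^esub> f i))"
      using G c f ic r ring_hom_mult[OF i]
      by (intro N.M.finsum_cong') (auto simp: N.smult_assoc1 Pi_iff subset_iff)
    also have "\<dots> = \<iota> r \<odot>\<^bsub>N\<^esub> (\<Oplus>\<^bsub>N\<^esub>i\<in>G. \<iota> (c i) \<odot>\<^bsub>N\<^esub> f i)"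
      by (rule N.finsum_smult_ldistr[OF G(1) ring_hom_closed[OF i r] cl[OF G(2) c], symmetric])
    also have "\<dots> = \<iota> r \<odot>\<^bsub>N\<^esub> L x"
      unfolding xe using L_sum[OF G, of c] c G by (auto simp: subset_iff)
    finally show ?thesis .
  qed
  have "L (b k) = f k" if k: "k \<in> B" for k
  proof -
    have bk: "b k \<in> carrier M" and fk: "f k \<in> carrier N" using basis_closed f k by auto
    have "(\<Oplus>\<^bsub>M\<^esub>i\<in>{k}. \<one>\<^bsub>R\<^esub> \<odot>\<^bsub>M\<^esub> b i) = b k" using bk by (simp add: M.finsum_insert)
    moreover have "(\<Oplus>\<^bsub>N\<^esub>i\<in>{k}. \<iota> \<one>\<^bsub>R\<^esub> \<odot>\<^bsub>N\<^esub> f i) = f k"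
      using fk ring_hom_one[OF i] by (simp add: N.M.finsum_insert)
    ultimately show ?thesis using L_sum[of "{k}" "\<lambda>_. \<one>\<^bsub>R\<^esub>"] k by simp
  qed
  then show ?thesis using L_closed L_add L_smult unfolding linear_along_def by blast
qed

lemma linear_determined:
  assumes N: "Module.module S N" and L: "linear_along R \<iota> M N L" "linear_along R \<iota> M N L'"
    and eq: "\<And>i. i \<in> B \<Longrightarrow> L (b i) = L' (b i)" and x: "x \<in> carrier M"
  shows "L x = L' x"
proof -
  interpret N: module S N by (rule N)
  have z: "K \<zero>\<^bsub>M\<^esub> = \<zero>\<^bsub>N\<^esub>" if "linear_along R \<iota> M N K" for K
  proof -
    have "K \<zero>\<^bsub>M\<^esub> = K \<zero>\<^bsub>M\<^esub> \<oplus>\<^bsub>N\<^esub> K \<zero>\<^bsub>M\<^esub>" "K \<zero>\<^bsub>M\<^esub> \<in> carrier N"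
      using that M.zero_closed M.l_zero unfolding linear_along_def by (metis, blast)
    then show ?thesis by (metis N.M.add.r_cancel_one')
  qed
  have "x \<in> rspan R M b B" using rspan_full x .
  then show ?thesis
  proof induction
    case zero then show ?case by (simp only: z[OF L(1)] z[OF L(2)])
  next
    case (add x y)
    then show ?case using L rspan_closed[of B] unfolding linear_along_def by auto
  next
    case (gen r i)
    then show ?case using L eq basis_closed unfolding linear_along_def by auto
  qed
qed

end

section \<open>Laurent polynomial rings\<close>

text \<open>The coefficients form a subring of the ring that is given by their type.\<close>

locale laurent =
  fixes X :: "'x set" and C :: "'c::comm_ring_1 set"
  assumes C: "0 \<in> C" "1 \<in> C" "\<And>a b. a \<in> C \<Longrightarrow> b \<in> C \<Longrightarrow> a + b \<in> C"
    "\<And>a b. a \<in> C \<Longrightarrow> b \<in> C \<Longrightarrow> a * b \<in> C" "\<And>a. a \<in> C \<Longrightarrow> - a \<in> C"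
begin

abbreviation L :: "(('x \<Rightarrow>\<^sub>0 int) \<Rightarrow>\<^sub>0 'c) ring" where "L \<equiv> laurent_ring X C"

lemma L_simps [simp]: "\<one>\<^bsub>L\<^esub> = 1" "\<zero>\<^bsub>L\<^esub> = 0" "x \<oplus>\<^bsub>L\<^esub> y = x + y" "x \<otimes>\<^bsub>L\<^esub> y = x * y"
  by (simp_all add: laurent_ring_def)

lemma mem_L: "f \<in> carrier L \<longleftrightarrow>
    (\<forall>\<mu>. Poly_Mapping.lookup f \<mu> \<in> C) \<and> (\<forall>\<mu>\<in>Poly_Mapping.keys f. Poly_Mapping.keys \<mu> \<subseteq> X)"
  using C(1) by (auto simp: laurent_ring_def in_keys_iff)

lemma single_mem: "Poly_Mapping.keys \<mu> \<subseteq> X \<Longrightarrow> c \<in> C \<Longrightarrow> Poly_Mapping.single \<mu> c \<in> carrier L"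
  using C(1) by (auto simp: mem_L lookup_single when_def split: if_splits)

lemma zero_mem: "0 \<in> carrier L" and one_mem: "1 \<in> carrier L"
  using C by (auto simp: mem_L lookup_one when_def)

lemma add_mem: assumes "f \<in> carrier L" "g \<in> carrier L" shows "f + g \<in> carrier L"
  unfolding mem_L
proof (intro conjI)
  show "\<forall>\<mu>\<in>Poly_Mapping.keys (f + g). Poly_Mapping.keys \<mu> \<subseteq> X"
    using assms Poly_Mapping.keys_add[of f g] unfolding mem_L by blast
qed (use assms C in \<open>auto simp: mem_L lookup_add\<close>)

lemma uminus_mem: assumes "f \<in> carrier L" shows "- f \<in> carrier L"
  using assms C by (auto simp: mem_L)

lemma sum_C: "(\<And>i. i \<in> A \<Longrightarrow> g i \<in> C) \<Longrightarrow> sum g A \<in> C"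
  by (induction A rule: infinite_finite_induct) (auto intro: C)

text \<open>
  Every coefficient of a product is a finite sum of products of coefficients.
\<close>

lemma mult_mem: assumes f: "f \<in> carrier L" and g: "g \<in> carrier L" shows "f * g \<in> carrier L"
  unfolding mem_L
proof (intro conjI allI ballI)
  fix \<mu>
  have "Poly_Mapping.lookup (f * g) \<mu> =
      (\<Sum>l | Poly_Mapping.lookup f l \<noteq> 0 \<and> True. Poly_Mapping.lookup f l * Poly_Mapping.lookup g (\<mu> - l))"
  proof -
    have *: "(\<Sum>q. Poly_Mapping.lookup g q when \<mu> = l + q) = Poly_Mapping.lookup g (\<mu> - l)" for l
    proof -
      have "(\<lambda>q. Poly_Mapping.lookup g q when \<mu> = l + q) = (\<lambda>q. Poly_Mapping.lookup g q when q = \<mu> - l)"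
        by (auto simp: fun_eq_iff when_def algebra_simps)
      then have "(\<Sum>q. Poly_Mapping.lookup g q when \<mu> = l + q) = (\<Sum>q. Poly_Mapping.lookup g q when q = \<mu> - l)"
        by (rule arg_cong)
      then show ?thesis by (simp only: Sum_any_when_equal)
    qed
    show ?thesis unfolding lookup_mult *
      by (subst Sum_any.expand_superset[of "{l. Poly_Mapping.lookup f l \<noteq> 0 \<and> True}"]) (auto intro: sum.cong)
  qed
  then show "Poly_Mapping.lookup (f * g) \<mu> \<in> C"
    using f g by (auto simp: mem_L intro!: sum_C C)
next
  fix \<mu> assume "\<mu> \<in> Poly_Mapping.keys (f * g)"
  then obtain a b where ab: "\<mu> = a + b" "a \<in> Poly_Mapping.keys f" "b \<in> Poly_Mapping.keys g"
    using Poly_Mapping.keys_mult[of f g] by blast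
  then show "Poly_Mapping.keys \<mu> \<subseteq> X"
    using f g Poly_Mapping.keys_add[of a b] unfolding mem_L by blast
qed

lemma L_cring: "cring L"
proof (rule cringI)
  show "abelian_group L"
    by (rule abelian_groupI)
      (auto simp: add_mem zero_mem algebra_simps intro!: bexI[of _ "- x" for x] uminus_mem)
  show "comm_monoid L"
    by (rule comm_monoidI) (auto simp: mult_mem one_mem algebra_simps)
qed (simp add: algebra_simps)

lemma L_minus: "f \<in> carrier L \<Longrightarrow> \<ominus>\<^bsub>L\<^esub> f = - f"
  using abelian_group.minus_equality[of L "- f" f] L_cring uminus_mem
  by (simp add: cring_def ring_def)

lemma L_diff: "f \<in> carrier L \<Longrightarrow> g \<in> carrier L \<Longrightarrow> f \<ominus>\<^bsub>L\<^esub> g = f - g"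
  by (simp add: a_minus_def L_minus)

lemma L_inv: assumes "f \<in> carrier L" "g \<in> carrier L" "f * g = 1" shows "inv\<^bsub>L\<^esub> f = g"
proof -
  interpret L: cring L by (rule L_cring)
  show ?thesis using assms by (intro L.comm_inv_char) auto
qed

end

section \<open>Based root systems\<close>

lemma sum_pos_witness:
  fixes f :: "'b \<Rightarrow> real"
  assumes "finite A" "\<forall>i\<in>A. 0 \<le> f i" "\<exists>i\<in>A. f i \<noteq> 0"
  shows "0 < sum f A"
  using assms by (metis antisym_conv1 sum_nonneg sum_nonneg_eq_0_iff)

abbreviation ginv :: "('b \<Rightarrow> 'b) \<Rightarrow> 'b \<Rightarrow> 'b" where "ginv \<equiv> inv_into UNIV"

text \<open>
  The index set \<open>I\<close> is a parameter so that it can be treated as an abstract finite set.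
\<close>

locale based_roots =
  fixes \<Phi> :: "'a::euclidean_space set" and \<alpha> :: "nat \<Rightarrow> 'a"
    and I :: "nat set"
  assumes setting: "root_setting \<Phi> \<alpha>" and I_eq: "I = {1..DIM('a)}"
begin

lemma finite_I [simp]: "finite I" by (simp add: I_eq)

lemma index0_iff: "i \<in> {0..DIM('a)} \<longleftrightarrow> i = 0 \<or> i \<in> I" and zero_notin_I [simp]: "0 \<notin> I"
  by (auto simp: I_eq)


lemma finite_roots: "finite \<Phi>" and zero_not_root: "0 \<notin> \<Phi>"
  and refl_root: "a \<in> \<Phi> \<Longrightarrow> b \<in> \<Phi> \<Longrightarrow> refl a 0 b \<in> \<Phi>"
  and root_coroot_int: "a \<in> \<Phi> \<Longrightarrow> b \<in> \<Phi> \<Longrightarrow> b \<bullet> coroot a \<in> \<int>"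
  using setting by (auto simp: root_setting_def root_system_def)

lemma simple_root: "i \<in> I \<Longrightarrow> \<alpha> i \<in> \<Phi>" and simple_inj: "inj_on \<alpha> I"
  and simple_indep: "independent (\<alpha> ` I)"
  and root_coherent: "b \<in> \<Phi> \<Longrightarrow> nonneg_comb \<alpha> b \<or> nonneg_comb \<alpha> (- b)"
  using setting unfolding I_eq root_setting_def simple_system_def by blast+

lemma root_norm_pos: "a \<in> \<Phi> \<Longrightarrow> 0 < a \<bullet> a"
  using zero_not_root by auto

lemma dot_coroot: "x \<bullet> coroot a = 2 * (x \<bullet> a) / (a \<bullet> a)"
  by (simp add: coroot_def)

lemma refl0: "refl a 0 x = x - (x \<bullet> coroot a) *\<^sub>R a"
  by (simp add: refl_def coroot_def)

lemma refl_linear: "linear (refl a 0)"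
  by (rule linearI) (simp_all add: refl0 algebra_simps)

lemma refl_refl: assumes "a \<in> \<Phi>" shows "refl a k (refl a k x) = x"
proof -
  have "coroot a \<bullet> a = 2" using root_norm_pos[OF assms] by (simp add: coroot_def)
  then show ?thesis by (simp add: refl_def algebra_simps)
qed

lemma refl_dot: assumes "a \<in> \<Phi>" shows "refl a 0 x \<bullet> refl a 0 y = x \<bullet> y"
proof -
  have "a \<bullet> a \<noteq> 0" using root_norm_pos[OF assms] by simp
  then show ?thesis by (simp add: refl0 dot_coroot algebra_simps inner_commute)
qed

lemma refl_self: "a \<in> \<Phi> \<Longrightarrow> refl a 0 a = - a"
  using root_norm_pos[of a] by (simp add: refl0 dot_coroot algebra_simps scaleR_2)

lemma neg_root: "a \<in> \<Phi> \<Longrightarrow> - a \<in> \<Phi>"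
  using refl_root[of a a] refl_self[of a] by simp

lemma neg_root_iff: "- a \<in> \<Phi> \<longleftrightarrow> a \<in> \<Phi>"
  using neg_root[of a] neg_root[of "- a"] by auto

subsection \<open>Coordinates and height\<close>

abbreviation om :: "nat \<Rightarrow> 'a" where "om \<equiv> fund_coweight \<alpha>"

lemma span_simple: "span (\<alpha> ` I) = UNIV"
proof -
  have "card (\<alpha> ` I) = DIM('a)" using card_image[OF simple_inj] by (simp add: I_eq)
  then show ?thesis using simple_indep
    by (metis dim_eq_card_independent dim_eq_full)
qed

lemma orthogonal_simple_zero: assumes "\<And>j. j \<in> I \<Longrightarrow> x \<bullet> \<alpha> j = 0" shows "x = 0"
proof -
  have "x \<in> span (\<alpha> ` I)" using span_simple by simp
  moreover have "span (\<alpha> ` I) \<subseteq> {y. x \<bullet> y = 0}"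
    by (rule span_minimal) (use assms in \<open>auto simp: subspace_hyperplane\<close>)
  ultimately show ?thesis by auto
qed

text \<open>
  The functional that is dual to \<open>\<alpha> i\<close> in the basis of simple roots is represented by a vector, which is unique because
  the simple roots span.
\<close>

lemma om_dot: assumes "i \<in> I" "j \<in> I" shows "om i \<bullet> \<alpha> j = (if i = j then 1 else 0)"
proof -
  obtain f :: "'a \<Rightarrow> real" where f: "linear f" "\<And>x. x \<in> \<alpha> ` I \<Longrightarrow> f x = (if \<alpha> i = x then 1 else 0)"
    using linear_independent_extend[OF simple_indep, of "\<lambda>x. if \<alpha> i = x then 1 else 0"] by blast
  define z where "z = adjoint f 1"
  have z: "z \<bullet> y = f y" for y
    using adjoint_works[OF f(1), of y 1] by (simp add: z_def inner_commute)
  have P: "\<forall>j\<in>I. z \<bullet> \<alpha> j = (if i = j then 1 else 0)"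
    using f(2) inj_on_eq_iff[OF simple_inj assms(1)] by (auto simp: z)
  have "\<exists>!x. \<forall>j\<in>I. x \<bullet> \<alpha> j = (if i = j then 1 else 0)"
  proof (rule ex1I[where a = z], rule P)
    fix x assume "\<forall>j\<in>I. x \<bullet> \<alpha> j = (if i = j then 1 else 0)"
    then have "x - z = 0" using P by (intro orthogonal_simple_zero) (simp add: inner_diff_left)
    then show "x = z" by simp
  qed
  from theI'[OF this] show ?thesis using assms(2) unfolding fund_coweight_def I_eq[symmetric] by blast
qed

lemma simple_expansion: "x = (\<Sum>i\<in>I. (om i \<bullet> x) *\<^sub>R \<alpha> i)"
proof -
  define f where "f x = (\<Sum>i\<in>I. (om i \<bullet> x) *\<^sub>R \<alpha> i)" for x
  have "linear f"
    by (rule linearI) (simp_all add: f_def inner_right_distrib scaleR_left_distrib sum.distrib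
        scaleR_sum_right)
  moreover have "y = f y" if "y \<in> \<alpha> ` I" for y
  proof -
    obtain j where j: "j \<in> I" "y = \<alpha> j" using \<open>y \<in> _\<close> by blast
    have "f y = (\<Sum>i\<in>I. if i = j then \<alpha> i else 0)"
      unfolding f_def by (rule sum.cong) (auto simp: j(2) om_dot[OF _ j(1)])
    then show ?thesis using j by simp
  qed
  ultimately have "x = f x"
    using linear_eq_on_span[OF linear_id, of f "\<alpha> ` I" x] span_simple by auto
  then show ?thesis by (simp add: f_def)
qed

lemma om_sum: assumes "j \<in> I" shows "om j \<bullet> (\<Sum>i\<in>I. c i *\<^sub>R \<alpha> i) = c j"
proof -
  have "om j \<bullet> (\<Sum>i\<in>I. c i *\<^sub>R \<alpha> i) = (\<Sum>i\<in>I. if i = j then c i else 0)"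
    unfolding inner_sum_right by (rule sum.cong) (auto simp: om_dot assms)
  then show ?thesis using assms by simp
qed

lemma nonneg_comb_iff: "nonneg_comb \<alpha> x \<longleftrightarrow> (\<forall>i\<in>I. om i \<bullet> x \<in> \<nat>)"
proof
  assume "nonneg_comb \<alpha> x"
  then show "\<forall>i\<in>I. om i \<bullet> x \<in> \<nat>"
    unfolding nonneg_comb_def I_eq[symmetric] using om_sum by force
next
  assume a: "\<forall>i\<in>I. om i \<bullet> x \<in> \<nat>"
  then have "\<forall>i\<in>I. \<exists>c. om i \<bullet> x = real c" by (auto elim: Nats_cases)
  then obtain c where c: "\<forall>i\<in>I. om i \<bullet> x = real (c i)" by metis
  have "x = (\<Sum>i\<in>I. real (c i) *\<^sub>R \<alpha> i)"
    by (subst simple_expansion) (rule sum.cong, use c in auto)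
  then show "nonneg_comb \<alpha> x" unfolding nonneg_comb_def I_eq[symmetric] by blast
qed

definition rho :: 'a where "rho = (\<Sum>i\<in>I. om i)"

lemma rho_dot: "rho \<bullet> x = (\<Sum>i\<in>I. om i \<bullet> x)"
  by (simp add: rho_def inner_sum_left)

lemma rho_simple: "j \<in> I \<Longrightarrow> rho \<bullet> \<alpha> j = 1"
  by (simp add: rho_dot om_dot)

lemma coords_eq: assumes "\<And>i. i \<in> I \<Longrightarrow> om i \<bullet> x = om i \<bullet> y" shows "x = y"
  using simple_expansion[of x] simple_expansion[of y] assms by (metis (mono_tags, lifting) sum.cong)

text \<open>
  The pairing with \<open>rho\<close> is the height, whose sign decides whether a root is positive.
\<close>

definition pos :: "'a set" where "pos = {b \<in> \<Phi>. 0 < rho \<bullet> b}"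

lemma root_coord_int: assumes "b \<in> \<Phi>" "i \<in> I" shows "om i \<bullet> b \<in> \<int>"
  using root_coherent[OF assms(1)] assms(2) unfolding nonneg_comb_iff
  by (metis Nats_subset_Ints inner_minus_right Ints_minus minus_minus subsetD)

text \<open>
  The coordinates of a root have the same sign, and they are not all zero.
\<close>

lemma root_coords_sign:
  assumes "b \<in> \<Phi>"
  shows "(\<forall>i\<in>I. 0 \<le> om i \<bullet> b) \<and> 0 < rho \<bullet> b \<or> (\<forall>i\<in>I. om i \<bullet> b \<le> 0) \<and> rho \<bullet> b < 0"
proof -
  have nz: "\<exists>i\<in>I. om i \<bullet> b \<noteq> 0"
    using assms zero_not_root coords_eq[of b 0] by auto
  consider "\<forall>i\<in>I. om i \<bullet> b \<in> \<nat>" | "\<forall>i\<in>I. - (om i \<bullet> b) \<in> \<nat>"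
    using root_coherent[OF assms] unfolding nonneg_comb_iff by auto
  then show ?thesis
  proof cases
    case 1
    then have "\<forall>i\<in>I. 0 \<le> om i \<bullet> b" by (auto elim!: Nats_cases)
    moreover from this nz have "0 < rho \<bullet> b" unfolding rho_dot
      by (rule sum_pos_witness[OF finite_I])
    ultimately show ?thesis by blast
  next
    case 2
    then have n: "\<forall>i\<in>I. 0 \<le> - (om i \<bullet> b)" by (metis Nats_cases of_nat_0_le_iff)
    moreover from n nz have "0 < (\<Sum>i\<in>I. - (om i \<bullet> b))"
      by (intro sum_pos_witness) auto
    ultimately show ?thesis by (auto simp: rho_dot sum_negf)
  qed
qed

lemma pos_coord: "b \<in> pos \<Longrightarrow> i \<in> I \<Longrightarrow> 0 \<le> om i \<bullet> b"
  using root_coords_sign[of b] by (auto simp: pos_def)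

lemma pos_root: "b \<in> pos \<Longrightarrow> b \<in> \<Phi>" by (simp add: pos_def)

lemma root_rho_nz: "b \<in> \<Phi> \<Longrightarrow> rho \<bullet> b \<noteq> 0" using root_coords_sign[of b] by auto

lemma pos_or_neg: "b \<in> \<Phi> \<Longrightarrow> b \<in> pos \<or> - b \<in> pos"
  using root_rho_nz[of b] neg_root[of b] by (auto simp: pos_def)

lemma pos_not_neg: "b \<in> pos \<Longrightarrow> - b \<notin> pos"
  by (auto simp: pos_def)

lemma pos_coord_witness: "b \<in> \<Phi> \<Longrightarrow> i \<in> I \<Longrightarrow> 0 < om i \<bullet> b \<Longrightarrow> b \<in> pos"
  using root_coords_sign[of b] by (auto simp: pos_def)

lemma pos_roots_eq: "pos_roots \<Phi> \<alpha> = pos"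
proof -
  have "nonneg_comb \<alpha> b \<longleftrightarrow> 0 < rho \<bullet> b" if "b \<in> \<Phi>" for b
  proof
    assume "nonneg_comb \<alpha> b"
    then have "\<forall>i\<in>I. 0 \<le> om i \<bullet> b" unfolding nonneg_comb_iff by (auto elim!: Nats_cases)
    then have "0 \<le> rho \<bullet> b" by (simp add: rho_dot sum_nonneg)
    then show "0 < rho \<bullet> b" using root_rho_nz[OF that] by simp
  next
    assume r: "0 < rho \<bullet> b"
    show "nonneg_comb \<alpha> b" unfolding nonneg_comb_iff
    proof
      fix i assume i: "i \<in> I"
      have "0 \<le> om i \<bullet> b" using r that i by (intro pos_coord) (auto simp: pos_def)
      then show "om i \<bullet> b \<in> \<nat>" using root_coord_int[OF that i]
        by (simp add: Nats_altdef2)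
    qed
  qed
  then show ?thesis by (auto simp: pos_roots_def pos_def)
qed

lemma simple_pos: "i \<in> I \<Longrightarrow> \<alpha> i \<in> pos"
  by (simp add: pos_def simple_root rho_simple)

lemma rho_int: "b \<in> \<Phi> \<Longrightarrow> rho \<bullet> b \<in> \<int>"
  unfolding rho_dot by (intro Ints_sum root_coord_int) auto

lemma rho_pos_ge_1: assumes "b \<in> pos" shows "1 \<le> rho \<bullet> b"
proof -
  obtain k where k: "rho \<bullet> b = of_int k" using rho_int[of b] assms by (auto simp: pos_def elim: Ints_cases)
  then show ?thesis using assms by (simp add: pos_def)
qed

lemma om_refl_simple:
  assumes "i \<in> I" "j \<in> I" shows "om i \<bullet> refl (\<alpha> j) 0 x = om i \<bullet> x - (if i = j then x \<bullet> coroot (\<alpha> j) else 0)"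
  using om_dot[OF assms] by (simp add: refl0 inner_diff_right)

text \<open>
  A root proportional to a simple root is \<open>c\<close> times it with \<open>c\<close> a positive integer, and
  \<open>2 / c\<close> is an integer too.
\<close>

lemma multiple_of_simple:
  assumes "b \<in> pos" "j \<in> I" "\<And>i. i \<in> I \<Longrightarrow> i \<noteq> j \<Longrightarrow> om i \<bullet> b = 0"
  shows "b = \<alpha> j \<or> b = 2 *\<^sub>R \<alpha> j"
proof -
  define c where "c = om j \<bullet> b"
  have b: "b = c *\<^sub>R \<alpha> j"
  proof (rule coords_eq)
    fix i assume "i \<in> I"
    then show "om i \<bullet> b = om i \<bullet> (c *\<^sub>R \<alpha> j)" using assms om_dot[of i j] by (auto simp: c_def)
  qed
  have bR: "b \<in> \<Phi>" using assms(1) by (simp add: pos_def)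
  have aR: "\<alpha> j \<in> \<Phi>" using simple_root assms(2) by blast
  have "0 < rho \<bullet> b" using assms(1) by (simp add: pos_def)
  then have c0: "0 < c" using rho_simple[OF assms(2)] by (simp add: b)
  obtain m where m: "c = of_int m"
    using root_coord_int[OF bR assms(2)] by (auto simp: c_def elim: Ints_cases)
  have "\<alpha> j \<bullet> coroot b = 2 / c"
    using root_norm_pos[OF aR] c0 by (simp add: dot_coroot b field_simps)
  moreover have "\<alpha> j \<bullet> coroot b \<in> \<int>" using root_coroot_int[OF bR aR] .
  ultimately obtain k where k: "2 / c = of_int k" by (auto elim: Ints_cases)
  have "2 = real_of_int (k * m)" using k c0 by (simp add: m field_simps)
  then have "k * m = 2" by linarith
  moreover have "0 < m" using c0 m by simp
  ultimately have "m dvd 2" "0 < m" by (metis dvd_triv_right)+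
  then have "m \<le> 2" "0 < m" using zdvd_imp_le by auto
  then have "m = 1 \<or> m = 2" by linarith
  then show ?thesis using m b by auto
qed

text \<open>
  The reflection changes only the coordinate at \<open>j\<close>; another coordinate of \<open>b\<close> is positive, and stays so.
\<close>

lemma refl_simple_pos:
  assumes "b \<in> pos" "j \<in> I" "b \<noteq> \<alpha> j" "b \<noteq> 2 *\<^sub>R \<alpha> j"
  shows "refl (\<alpha> j) 0 b \<in> pos"
proof -
  obtain i where i: "i \<in> I" "i \<noteq> j" "om i \<bullet> b \<noteq> 0"
    using multiple_of_simple assms by blast
  then have "0 < om i \<bullet> b" using pos_coord[OF assms(1) i(1)] by simp
  then have "0 < om i \<bullet> refl (\<alpha> j) 0 b" using om_refl_simple[OF i(1) assms(2)] i by simp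
  moreover have "refl (\<alpha> j) 0 b \<in> \<Phi>"
    using refl_root simple_root assms by (simp add: pos_def)
  ultimately show ?thesis using pos_coord_witness i by blast
qed

lemma dot_expansion: "x \<bullet> y = (\<Sum>i\<in>I. (om i \<bullet> x) * (\<alpha> i \<bullet> y))"
  by (subst simple_expansion[of x]) (simp add: inner_sum_left)

text \<open>
  Since \<open>\<langle>b, b\<rangle> > 0\<close>, a positive root \<open>b\<close> pairs positively with a simple root in its support; reflecting in this
  simple root lowers the height.
\<close>

lemma pos_root_induct [consumes 1, case_names multiple reflect]:
  assumes "b \<in> pos"
    and mult: "\<And>b i. b \<in> pos \<Longrightarrow> i \<in> I \<Longrightarrow> 0 < om i \<bullet> b \<Longrightarrow> b = \<alpha> i \<or> b = 2 *\<^sub>R \<alpha> i \<Longrightarrow> P b"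
    and step: "\<And>b i. b \<in> pos \<Longrightarrow> i \<in> I \<Longrightarrow> 0 < om i \<bullet> b \<Longrightarrow> 0 < b \<bullet> \<alpha> i \<Longrightarrow>
                 refl (\<alpha> i) 0 b \<in> pos \<Longrightarrow> P (refl (\<alpha> i) 0 b) \<Longrightarrow> P b"
  shows "P b"
  using assms(1)
proof (induction "nat \<lfloor>rho \<bullet> b\<rfloor>" arbitrary: b rule: less_induct)
  case less
  have bR: "b \<in> \<Phi>" using less.prems by (simp add: pos_def)
  have "0 < (\<Sum>i\<in>I. (om i \<bullet> b) * (\<alpha> i \<bullet> b))"
    using root_norm_pos[OF bR] dot_expansion[of b b] by simp
  then obtain i where i: "i \<in> I" "0 < (om i \<bullet> b) * (\<alpha> i \<bullet> b)"
    by (meson linorder_not_less sum_nonpos)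
  then have p: "0 < om i \<bullet> b" "0 < b \<bullet> \<alpha> i"
    using pos_coord[OF less.prems i(1)] by (auto simp: zero_less_mult_iff inner_commute)
  show ?case
  proof (cases "b = \<alpha> i \<or> b = 2 *\<^sub>R \<alpha> i")
    case True then show ?thesis using mult less.prems i p by blast
  next
    case False
    let ?c = "refl (\<alpha> i) 0 b"
    have c: "?c \<in> pos" using refl_simple_pos less.prems i(1) False by blast
    have aR: "\<alpha> i \<in> \<Phi>" using simple_root i by blast
    have "0 < b \<bullet> coroot (\<alpha> i)" using p root_norm_pos[OF aR] by (simp add: dot_coroot)
    then have "rho \<bullet> ?c < rho \<bullet> b" using rho_simple[OF i(1)] by (simp add: refl0 inner_diff_right)
    moreover obtain k l where "rho \<bullet> ?c = of_int k" "rho \<bullet> b = of_int l"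
      using rho_int bR c by (metis Ints_cases pos_root)
    moreover have "0 < rho \<bullet> ?c" using c by (simp add: pos_def)
    ultimately have "nat \<lfloor>rho \<bullet> ?c\<rfloor> < nat \<lfloor>rho \<bullet> b\<rfloor>" by simp
    then have "P ?c" using less.hyps c by blast
    then show ?thesis using step less.prems i p c by blast
  qed
qed

subsection \<open>The highest root\<close>

text \<open>
  For roots, whose coordinates are integers, this is the order in which \<open>y - x\<close> is a nonnegative combination of simple roots.
\<close>

definition dom_le :: "'a \<Rightarrow> 'a \<Rightarrow> bool" where
  "dom_le x y \<longleftrightarrow> (\<forall>i\<in>I. om i \<bullet> x \<le> om i \<bullet> y)"

definition maximal :: "'a \<Rightarrow> bool" where
  "maximal m \<longleftrightarrow> m \<in> \<Phi> \<and> (\<forall>c\<in>\<Phi>. dom_le m c \<longrightarrow> c = m)"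

lemma dom_le_antisym: "dom_le x y \<Longrightarrow> dom_le y x \<Longrightarrow> x = y"
  by (rule coords_eq) (auto simp: dom_le_def intro: antisym)

lemma maximal_above: assumes "b \<in> \<Phi>" shows "\<exists>m. maximal m \<and> dom_le b m"
proof -
  let ?S = "{c \<in> \<Phi>. dom_le b c}"
  have "finite ?S" "?S \<noteq> {}" using finite_roots assms by (auto simp: dom_le_def)
  then obtain m where m: "m \<in> ?S" "\<And>c. c \<in> ?S \<Longrightarrow> rho \<bullet> c \<le> rho \<bullet> m"
    using ex_is_arg_min_if_finite[of ?S "\<lambda>c. - (rho \<bullet> c)"]
    by (auto simp: is_arg_min_linorder)
  have "c = m" if c: "c \<in> \<Phi>" "dom_le m c" for c
  proof (rule coords_eq)
    have "dom_le b c" using c m(1) by (fastforce simp: dom_le_def)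
    then have "rho \<bullet> c \<le> rho \<bullet> m" using m(2) c by blast
    then have "(\<Sum>i\<in>I. om i \<bullet> c - om i \<bullet> m) \<le> 0" by (simp add: rho_dot sum_subtractf)
    moreover have nn: "\<And>i. i \<in> I \<Longrightarrow> 0 \<le> om i \<bullet> c - om i \<bullet> m" using c by (simp add: dom_le_def)
    ultimately have "\<forall>i\<in>I. om i \<bullet> c - om i \<bullet> m = 0"
      using sum_pos_witness[of I "\<lambda>i. om i \<bullet> c - om i \<bullet> m"] by fastforce
    then show "\<And>i. i \<in> I \<Longrightarrow> om i \<bullet> c = om i \<bullet> m" by simp
  qed
  then show ?thesis using m(1) by (auto simp: maximal_def)
qed

text \<open>
  Otherwise the reflection in \<open>\<alpha> i\<close> would increase \<open>m\<close>.
\<close>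

lemma maximal_dominant: assumes "maximal m" "i \<in> I" shows "0 \<le> m \<bullet> \<alpha> i"
proof (rule ccontr)
  assume "\<not> ?thesis"
  then have n: "m \<bullet> coroot (\<alpha> i) < 0" using root_norm_pos[OF simple_root[OF assms(2)]]
    by (simp add: dot_coroot divide_neg_pos)
  have "dom_le m (refl (\<alpha> i) 0 m)" using n om_refl_simple assms(2) by (auto simp: dom_le_def)
  moreover have "refl (\<alpha> i) 0 m \<in> \<Phi>"
    using refl_root simple_root assms by (simp add: maximal_def)
  ultimately have "refl (\<alpha> i) 0 m = m" using assms(1) by (auto simp: maximal_def)
  then have "m \<bullet> coroot (\<alpha> i) = 0 \<or> \<alpha> i = 0" by (simp add: refl0)
  then show False using n zero_not_root simple_root[OF assms(2)] by auto
qed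

lemma maximal_pos: assumes "maximal m" shows "m \<in> pos"
proof (rule ccontr)
  assume "m \<notin> pos"
  then have n: "- m \<in> pos" using assms pos_or_neg by (auto simp: maximal_def)
  have "dom_le m (- m)" using pos_coord[OF n] by (fastforce simp: dom_le_def)
  then have "- m = m" using assms n by (auto simp: maximal_def pos_def)
  then show False using n \<open>m \<notin> pos\<close> by simp
qed

text \<open>
  The reflection of \<open>\<alpha> i\<close> in \<open>\<alpha> j\<close> is a positive root, and its coordinate at \<open>j\<close> is minus the Cartan integer.
\<close>

lemma simple_obtuse: assumes "i \<in> I" "j \<in> I" "i \<noteq> j" shows "\<alpha> i \<bullet> \<alpha> j \<le> 0"
proof -
  have "\<alpha> i \<noteq> \<alpha> j" using assms inj_on_eq_iff[OF simple_inj assms(1,2)] by blast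
  moreover have "\<alpha> i \<noteq> 2 *\<^sub>R \<alpha> j"
  proof
    assume e: "\<alpha> i = 2 *\<^sub>R \<alpha> j"
    have "om i \<bullet> \<alpha> i = 1" "om i \<bullet> \<alpha> j = 0" using om_dot assms by auto
    with e show False by simp
  qed
  ultimately have "refl (\<alpha> j) 0 (\<alpha> i) \<in> pos" using refl_simple_pos simple_pos assms by blast
  then have "0 \<le> om j \<bullet> refl (\<alpha> j) 0 (\<alpha> i)" using pos_coord assms by blast
  then have "\<alpha> i \<bullet> coroot (\<alpha> j) \<le> 0" using om_refl_simple[of j j] om_dot assms by auto
  then show ?thesis using root_norm_pos[OF simple_root[OF assms(2)]]
    by (simp add: dot_coroot divide_le_0_iff)
qed

text \<open>
  The simple roots in the support of a maximal root are orthogonal to the others: the pairing of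
  the root with a simple root outside its support is both nonnegative and a sum of nonpositive terms.
  By irreducibility there are no others.
\<close>

lemma maximal_full_support:
  assumes "maximal m" "i \<in> I" shows "0 < om i \<bullet> m"
proof (rule ccontr)
  assume "\<not> 0 < om i \<bullet> m"
  define K where "K = {j \<in> I. 0 < om j \<bullet> m}"
  have mp: "m \<in> pos" using maximal_pos assms by blast
  have iK: "i \<in> I - K" using \<open>\<not> _\<close> assms by (auto simp: K_def)
  have z: "om j \<bullet> m = 0" if "j \<in> I - K" for j
    using that pos_coord[OF mp, of j] by (auto simp: K_def)
  have orth: "\<alpha> j \<bullet> \<alpha> k = 0" if j: "j \<in> K" and k: "k \<in> I - K" for j k
  proof -
    have t: "(om l \<bullet> m) * (\<alpha> l \<bullet> \<alpha> k) \<le> 0" if "l \<in> I" for l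
    proof (cases "l \<in> K")
      case True
      then have "l \<noteq> k" using k by blast
      then have "\<alpha> l \<bullet> \<alpha> k \<le> 0" using simple_obtuse that k by blast
      then show ?thesis using pos_coord[OF mp that] by (rule mult_nonneg_nonpos[rotated])
    qed (use z that in auto)
    have "0 \<le> (\<Sum>l\<in>I. (om l \<bullet> m) * (\<alpha> l \<bullet> \<alpha> k))"
      using maximal_dominant[OF assms(1), of k] k dot_expansion[of m "\<alpha> k"] by simp
    then have "\<forall>l\<in>I. (om l \<bullet> m) * (\<alpha> l \<bullet> \<alpha> k) = 0"
      using t sum_pos_witness[of I "\<lambda>l. - ((om l \<bullet> m) * (\<alpha> l \<bullet> \<alpha> k))"]
      by (fastforce simp: sum_negf)
    then show ?thesis using j by (auto simp: K_def)
  qed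
  define A where "A = {b \<in> \<Phi>. \<forall>i\<in>I - K. om i \<bullet> b = 0}"
  define B where "B = {b \<in> \<Phi>. \<forall>i\<in>K. om i \<bullet> b = 0}"
  have dotA: "b \<bullet> \<alpha> k = 0" if "b \<in> A" "k \<in> I - K" for b k
    unfolding dot_expansion[of b] using that orth by (intro sum.neutral) (auto simp: A_def)
  have dotB: "b \<bullet> \<alpha> k = 0" if "b \<in> B" "k \<in> K" for b k
    unfolding dot_expansion[of b] using that orth by (intro sum.neutral) (fastforce simp: B_def inner_commute)
  \<comment> \<open>No root mixes the two orthogonal sets of simple roots: the reflected root is not mixed, and a reflection that moves it is in a simple root of its own set.\<close>
  have cover: "b \<in> A \<union> B" if "b \<in> pos" for b
    using that
  proof (induction rule: pos_root_induct)
    case (multiple b i)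
    then have bR: "b \<in> \<Phi>" by (simp add: pos_def)
    have "om j \<bullet> b = 0" if "j \<in> I" "j \<noteq> i" for j
      using multiple(2,4) that om_dot[of j i] by auto
    then show ?case using bR multiple(2) by (cases "i \<in> K") (auto simp: A_def B_def K_def)
  next
    case (reflect b i)
    let ?c = "refl (\<alpha> i) 0 b"
    have bR: "b \<in> \<Phi>" using reflect by (simp add: pos_def)
    have aR: "\<alpha> i \<in> \<Phi>" using simple_root reflect by blast
    have "?c \<bullet> \<alpha> i = ?c \<bullet> refl (\<alpha> i) 0 (- \<alpha> i)"
      using refl_self[OF aR] linear_neg[OF refl_linear, of "\<alpha> i" "\<alpha> i"] by simp
    then have ca: "?c \<bullet> \<alpha> i \<noteq> 0" using refl_dot[OF aR, of b "- \<alpha> i"] reflect(4) by simp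
    have om: "om j \<bullet> b = om j \<bullet> ?c" if "j \<in> I" "j \<noteq> i" for j
      using om_refl_simple[OF that(1) reflect(2), of b] that by simp
    show ?case
    proof (cases "?c \<in> A")
      case True
      then have "i \<in> K" using dotA ca reflect(2) by blast
      then have "om j \<bullet> b = 0" if "j \<in> I - K" for j
        using that True om[of j] by (cases "j = i") (auto simp: A_def)
      then show ?thesis using bR by (auto simp: A_def)
    next
      case False
      then have B: "?c \<in> B" using reflect by blast
      then have "i \<notin> K" using dotB ca by blast
      then have "om j \<bullet> b = 0" if "j \<in> K" for j
        using that B om[of j] by (cases "j = i") (auto simp: B_def K_def)
      then show ?thesis using bR by (auto simp: B_def)
    qed
  qed
  have "b \<in> A \<union> B" if "b \<in> \<Phi>" for b
    using pos_or_neg[OF that] cover[of b] cover[of "- b"] that by (auto simp: A_def B_def)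
  then have "A \<union> B = \<Phi>" by (auto simp: A_def B_def)
  moreover have "\<alpha> i \<in> B" using iK simple_root om_dot by (auto simp: B_def K_def)
  moreover have "m \<in> A" using z mp by (auto simp: A_def pos_def)
  moreover have "A \<inter> B = {}"
  proof -
    have "b = 0" if "b \<in> A" "b \<in> B" for b
      using that by (intro coords_eq) (auto simp: A_def B_def)
    then show ?thesis using zero_not_root by (fastforce simp: A_def)
  qed
  moreover have "a \<bullet> b = 0" if "a \<in> A" "b \<in> B" for a b
    unfolding dot_expansion[of a]
  proof (rule sum.neutral, rule ballI)
    fix k assume "k \<in> I"
    then show "om k \<bullet> a * (\<alpha> k \<bullet> b) = 0"
      using that dotB[of b k] by (cases "k \<in> K") (auto simp: A_def inner_commute)
  qed
  ultimately show False
    using setting unfolding root_setting_def irreducible_roots_def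
    by (metis empty_iff)
qed

text \<open>
  Two maximal roots pair positively, since one is dominant and the other has full support. If one of the two Cartan
  integers were 1, the difference would be a root and the two roots would be comparable. If both are at least 2, the
  roots coincide by the following estimate of the length of their difference.
\<close>

lemma maximal_unique: assumes "maximal m" "maximal m'" shows "m = m'"
proof -
  have R: "m \<in> \<Phi>" "m' \<in> \<Phi>" using assms by (auto simp: maximal_def)
  have "0 < m \<bullet> m" using root_norm_pos R by blast
  then have "\<exists>i\<in>I. 0 < \<alpha> i \<bullet> m"
  proof (rule contrapos_pp)
    assume "\<not> ?thesis"
    then have "(\<Sum>i\<in>I. (om i \<bullet> m) * (\<alpha> i \<bullet> m)) \<le> 0"
      using pos_coord[OF maximal_pos[OF assms(1)]]
      by (intro sum_nonpos) (auto intro!: mult_nonneg_nonpos simp: not_less)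
    then show "\<not> 0 < m \<bullet> m" using dot_expansion[of m m] by simp
  qed
  then obtain i where i: "i \<in> I" "0 < \<alpha> i \<bullet> m" by blast
  have "0 < (\<Sum>i\<in>I. (om i \<bullet> m') * (\<alpha> i \<bullet> m))"
  proof (rule sum_pos2[of I i])
    show "0 < om i \<bullet> m' * (\<alpha> i \<bullet> m)" using i maximal_full_support[OF assms(2)] by simp
    show "0 \<le> om j \<bullet> m' * (\<alpha> j \<bullet> m)" if "j \<in> I" for j
      using that maximal_full_support[OF assms(2) that] maximal_dominant[OF assms(1) that]
      by (simp add: inner_commute)
  qed (use i in auto)
  then have dp: "0 < m \<bullet> m'" using dot_expansion[of m' m] by (simp add: inner_commute)
  have no_diff: False if "maximal x" "maximal y" "x \<bullet> coroot y = 1" for x y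
  proof -
    have "refl y 0 x \<in> \<Phi>" using that refl_root by (simp add: maximal_def)
    then have d: "x - y \<in> \<Phi>" using that(3) by (simp add: refl0)
    then have "dom_le y x \<or> dom_le x y" using root_coords_sign[OF d] by (auto simp: dom_le_def inner_diff_right)
    then have "x = y" using that(1,2) by (auto simp: maximal_def)
    then show False using d zero_not_root by simp
  qed
  obtain x y where xy: "m \<bullet> coroot m' = of_int x" "m' \<bullet> coroot m = of_int y"
    using root_coroot_int R by (metis Ints_cases)
  have n: "0 < m \<bullet> m" "0 < m' \<bullet> m'" using root_norm_pos R by blast+
  have "0 < real_of_int x" "0 < real_of_int y" unfolding xy[symmetric]
    using dp n by (auto simp: dot_coroot inner_commute)
  then have "0 < x" "0 < y" by auto
  moreover have "x \<noteq> 1" "y \<noteq> 1" using no_diff xy assms by auto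
  ultimately have "2 \<le> x" "2 \<le> y" by linarith+
  then have "2 \<le> real_of_int x" "2 \<le> real_of_int y" by linarith+
  then have "m' \<bullet> m' \<le> m \<bullet> m'" "m \<bullet> m \<le> m \<bullet> m'"
    unfolding xy[symmetric] using n by (auto simp: dot_coroot field_simps inner_commute)
  then have "(m - m') \<bullet> (m - m') \<le> 0" by (simp add: algebra_simps inner_commute)
  then show ?thesis by (metis eq_iff_diff_eq_0 inner_eq_zero_iff inner_ge_zero nle_le)
qed

definition phi :: 'a where "phi = highest_root \<Phi> \<alpha>"

lemma phi_char: "phi \<in> \<Phi> \<and> (\<forall>b\<in>\<Phi>. nonneg_comb \<alpha> (phi - b))"
proof -
  have "\<Phi> \<noteq> {}" using setting by (auto simp: root_setting_def irreducible_roots_def)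
  then obtain m where m: "maximal m" using maximal_above by blast
  have mR: "m \<in> \<Phi>" using m by (simp add: maximal_def)
  have top: "dom_le b m" if "b \<in> \<Phi>" for b using maximal_above[OF that] maximal_unique[OF m] by blast
  have "nonneg_comb \<alpha> (m - b)" if b: "b \<in> \<Phi>" for b
    unfolding nonneg_comb_iff
  proof
    fix i assume i: "i \<in> I"
    have "om i \<bullet> (m - b) \<in> \<int>" using root_coord_int i mR b by (simp add: inner_diff_right)
    moreover have "0 \<le> om i \<bullet> (m - b)" using top[OF b] i by (simp add: dom_le_def inner_diff_right)
    ultimately show "om i \<bullet> (m - b) \<in> \<nat>"
      by (simp add: Nats_altdef2)
  qed
  then have ex: "m \<in> \<Phi> \<and> (\<forall>b\<in>\<Phi>. nonneg_comb \<alpha> (m - b))" using mR by blast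
  have "\<exists>!p. p \<in> \<Phi> \<and> (\<forall>b\<in>\<Phi>. nonneg_comb \<alpha> (p - b))"
  proof (rule ex1I[where a = m], rule ex)
    fix p assume p: "p \<in> \<Phi> \<and> (\<forall>b\<in>\<Phi>. nonneg_comb \<alpha> (p - b))"
    then have "\<forall>i\<in>I. om i \<bullet> (p - m) \<in> \<nat>" using mR nonneg_comb_iff by blast
    then have "\<forall>i\<in>I. 0 \<le> om i \<bullet> (p - m)" by (metis Nats_cases of_nat_0_le_iff)
    then have "dom_le m p" by (simp add: dom_le_def inner_diff_right)
    then show "p = m" using top p dom_le_antisym by blast
  qed
  from theI'[OF this] show ?thesis unfolding phi_def highest_root_def .
qed

lemma phi_root: "phi \<in> \<Phi>" using phi_char by blast

lemma phi_top: assumes "b \<in> \<Phi>" "i \<in> I" shows "om i \<bullet> b \<le> om i \<bullet> phi"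
proof -
  have "om i \<bullet> (phi - b) \<in> \<nat>" using phi_char assms nonneg_comb_iff by blast
  then show ?thesis by (auto simp: inner_diff_right elim!: Nats_cases)
qed

lemma phi_top_rho: "b \<in> \<Phi> \<Longrightarrow> rho \<bullet> b \<le> rho \<bullet> phi"
  unfolding rho_dot by (intro sum_mono phi_top) auto

lemma phi_pos: "phi \<in> pos"
  using phi_top_rho[of "- phi"] neg_root[OF phi_root] root_rho_nz[OF phi_root] phi_root
  by (auto simp: pos_def)

text \<open>
  A pairing that is negative, or at least 2 with \<open>b \<noteq> phi\<close>, would give a root that is not below \<open>phi\<close> by reflecting \<open>b\<close>
  in \<open>phi\<close> (and changing the sign).
\<close>

lemma phi_pairing:
  assumes "b \<in> pos"
  shows "b \<bullet> coroot phi = 0 \<or> b \<bullet> coroot phi = 1 \<or> b = phi"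
proof -
  have bR: "b \<in> \<Phi>" using assms by (simp add: pos_def)
  obtain c where c: "b \<bullet> coroot phi = of_int c" using root_coroot_int[OF phi_root bR] by (auto elim: Ints_cases)
  have r: "b - of_int c *\<^sub>R phi \<in> \<Phi>" using refl_root[OF phi_root bR] by (simp add: refl0 c)
  have pp: "0 < rho \<bullet> phi" "0 < rho \<bullet> b" using phi_pos assms by (auto simp: pos_def)
  have c0: "0 \<le> c"
  proof (rule ccontr)
    assume "\<not> 0 \<le> c"
    then have "1 \<le> - real_of_int c" by simp
    then have "1 * (rho \<bullet> phi) \<le> - real_of_int c * (rho \<bullet> phi)" using pp by (intro mult_right_mono) auto
    then show False using phi_top_rho[OF r] pp by (simp add: inner_diff_right)
  qed
  have "b = phi" if c2: "2 \<le> c"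
  proof (rule coords_eq)
    fix i assume i: "i \<in> I"
    have "of_int c * (om i \<bullet> phi) - om i \<bullet> b \<le> om i \<bullet> phi"
      using phi_top[OF neg_root[OF r] i] by (simp add: inner_diff_right)
    moreover have "2 * (om i \<bullet> phi) \<le> of_int c * (om i \<bullet> phi)"
      using c2 pos_coord[OF phi_pos i] by (intro mult_right_mono) auto
    moreover have "om i \<bullet> b \<le> om i \<bullet> phi" using phi_top[OF bR i] .
    ultimately show "om i \<bullet> b = om i \<bullet> phi" by linarith
  qed
  then show ?thesis using c c0 by (cases "c = 0 \<or> c = 1") auto
qed

lemma double_phi: "2 *\<^sub>R phi \<notin> \<Phi>"
  using phi_top_rho[of "2 *\<^sub>R phi"] phi_pos by (auto simp: pos_def)


section \<open>The extended affine Weyl group\<close>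

abbreviation s :: "nat \<Rightarrow> 'a \<Rightarrow> 'a" where "s \<equiv> gen_refl \<Phi> \<alpha>"
abbreviation wmap :: "nat list \<Rightarrow> 'a \<Rightarrow> 'a" where "wmap \<equiv> word_map \<Phi> \<alpha>"
abbreviation WJ :: "nat set \<Rightarrow> ('a \<Rightarrow> 'a) set" where "WJ \<equiv> parabolic \<Phi> \<alpha>"
abbreviation W0 :: "('a \<Rightarrow> 'a) set" where "W0 \<equiv> weyl \<Phi> \<alpha>"
abbreviation P :: "'a set" where "P \<equiv> coweight_lattice \<alpha>"
abbreviation EW :: "('a \<Rightarrow> 'a) set" where "EW \<equiv> ext_weyl \<Phi> \<alpha>"
abbreviation RJ :: "nat set \<Rightarrow> 'a set" where "RJ \<equiv> roots_J \<Phi> \<alpha>"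
abbreviation A0 :: "'a set" where "A0 \<equiv> fund_alcove \<Phi> \<alpha>"
abbreviation Stab :: "('a \<Rightarrow> 'a) set" where "Stab \<equiv> alcove_stab \<Phi> \<alpha>"
abbreviation lin :: "('a \<Rightarrow> 'a) \<Rightarrow> 'a \<Rightarrow> 'a" where "lin \<equiv> lin_part \<Phi> \<alpha>"
abbreviation wgt :: "('a \<Rightarrow> 'a) \<Rightarrow> 'a" where "wgt \<equiv> wt \<Phi> \<alpha>"
abbreviation aroot :: "nat \<Rightarrow> 'a" where "aroot i \<equiv> fst (simple_aff_root \<Phi> \<alpha> i)"

lemma weyl_I: "W0 = WJ I" by (simp add: weyl_def I_eq)

subsection \<open>Words and parabolic subgroups\<close>

lemma wmap_Nil [simp]: "wmap [] = id" and wmap_Cons [simp]: "wmap (i # is) = s i \<circ> wmap is"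
  by (simp_all add: word_map_def)

lemma wmap_append: "wmap (is @ js) = wmap is \<circ> wmap js"
  by (induction "is") auto

lemma s_simple: "i \<in> I \<Longrightarrow> s i = refl (\<alpha> i) 0"
  using zero_notin_I by (auto simp: gen_refl_def)

lemma s_zero: "s 0 = refl phi 1"
  by (simp add: gen_refl_def phi_def)

lemma aroot_simple: "i \<in> I \<Longrightarrow> aroot i = \<alpha> i" and aroot_zero: "aroot 0 = - phi"
  using zero_notin_I by (auto simp: simple_aff_root_def phi_def)

lemma aroot_root: "i \<in> {0..DIM('a)} \<Longrightarrow> aroot i \<in> \<Phi>"
  unfolding index0_iff using simple_root neg_root phi_root by (auto simp: aroot_zero aroot_simple)

lemma s_invol: "i \<in> {0..DIM('a)} \<Longrightarrow> s i \<circ> s i = id"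
  unfolding index0_iff using refl_refl[OF phi_root] refl_refl[OF simple_root]
  by (auto simp: fun_eq_iff s_zero s_simple)

lemma parabolic_id: "id \<in> WJ J"
  unfolding parabolic_def by (metis (mono_tags, lifting) empty_set empty_subsetI mem_Collect_eq wmap_Nil)

lemma parabolic_comp: "u \<in> WJ J \<Longrightarrow> u' \<in> WJ J \<Longrightarrow> u \<circ> u' \<in> WJ J"
  unfolding parabolic_def mem_Collect_eq
  by (metis set_append wmap_append Un_least)

lemma parabolic_gen: "j \<in> J \<Longrightarrow> s j \<in> WJ J"
  unfolding parabolic_def mem_Collect_eq by (rule exI[of _ "[j]"]) simp

lemma parabolic_mono: "J \<subseteq> J' \<Longrightarrow> WJ J \<subseteq> WJ J'"
  unfolding parabolic_def by blast

lemma parabolic_weyl: "J \<subseteq> I \<Longrightarrow> u \<in> WJ J \<Longrightarrow> u \<in> W0"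
  unfolding weyl_I using parabolic_mono by blast

lemma parabolic_induct [consumes 1, case_names id gen]:
  assumes "u \<in> WJ J" "Q id" "\<And>j u. j \<in> J \<Longrightarrow> u \<in> WJ J \<Longrightarrow> Q u \<Longrightarrow> Q (s j \<circ> u)"
  shows "Q u"
proof -
  obtain "is" where "is": "set is \<subseteq> J" "u = wmap is" using assms(1) by (auto simp: parabolic_def)
  have "Q (wmap is)" using "is"(1)
  proof (induction "is")
    case (Cons i "is")
    then have "wmap is \<in> WJ J" by (auto simp: parabolic_def)
    then show ?case unfolding wmap_Cons by (intro assms(3)) (use Cons in auto)
  qed (use assms in simp)
  then show ?thesis using "is" by simp
qed

lemma parabolic_inverse:
  assumes "J \<subseteq> I" "u \<in> WJ J" shows "\<exists>u'\<in>WJ J. u' \<circ> u = id \<and> u \<circ> u' = id"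
  using assms(2)
proof (induction rule: parabolic_induct)
  case id then show ?case using parabolic_id by (intro bexI[of _ id]) auto
next
  case (gen j u)
  then obtain u' where u': "u' \<in> WJ J" "u' \<circ> u = id" "u \<circ> u' = id" by blast
  have j: "s j \<circ> s j = id" using gen(1) assms(1) by (intro s_invol) (auto simp: I_eq)
  have "u' \<circ> s j \<circ> (s j \<circ> u) = u' \<circ> (s j \<circ> s j) \<circ> u" by (simp add: comp_assoc)
  then have "u' \<circ> s j \<circ> (s j \<circ> u) = id" using u' j by simp
  moreover have "s j \<circ> u \<circ> (u' \<circ> s j) = s j \<circ> (u \<circ> u') \<circ> s j" by (simp add: comp_assoc)
  then have "s j \<circ> u \<circ> (u' \<circ> s j) = id" using u' j by simp
  moreover have "u' \<circ> s j \<in> WJ J" using parabolic_comp u' parabolic_gen gen by blast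
  ultimately show ?case by blast
qed

lemma parabolic_inv:
  assumes "J \<subseteq> I" "u \<in> WJ J" shows "ginv u \<in> WJ J" "bij u"
  using parabolic_inverse[OF assms] inv_unique_comp[of u] o_bij[of _ u] by metis+

lemma weyl_inv: "u \<in> W0 \<Longrightarrow> ginv u \<in> W0" and weyl_bij: "u \<in> W0 \<Longrightarrow> bij u"
  using parabolic_inv[of I u] by (auto simp: weyl_I)

lemma weyl_id: "id \<in> W0" and weyl_comp: "u \<in> W0 \<Longrightarrow> u' \<in> W0 \<Longrightarrow> u \<circ> u' \<in> W0"
  by (simp_all add: weyl_I parabolic_id parabolic_comp)

lemma weyl_isometry:
  assumes "u \<in> W0"
  shows weyl_linear: "linear u" and weyl_dot: "u x \<bullet> u y = x \<bullet> y" and weyl_root: "b \<in> \<Phi> \<Longrightarrow> u b \<in> \<Phi>"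
proof -
  have "linear u \<and> (\<forall>x y. u x \<bullet> u y = x \<bullet> y) \<and> (\<forall>b\<in>\<Phi>. u b \<in> \<Phi>)"
    using assms unfolding weyl_I
  proof (induction rule: parabolic_induct)
    case (gen j u)
    have "\<alpha> j \<in> \<Phi>" using gen simple_root by blast
    moreover have "linear (refl (\<alpha> j) 0 \<circ> u)" using gen refl_linear linear_compose by blast
    ultimately show ?case using gen refl_dot refl_root by (simp add: s_simple o_def)
  qed (auto simp: linear_id[unfolded id_def])
  then show "linear u" "u x \<bullet> u y = x \<bullet> y" "b \<in> \<Phi> \<Longrightarrow> u b \<in> \<Phi>" by blast+
qed

lemma weyl_inv_apply: "u \<in> W0 \<Longrightarrow> u (ginv u x) = x" "u \<in> W0 \<Longrightarrow> ginv u (u x) = x"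
  using weyl_bij by (auto simp: bij_is_surj surj_f_inv_f bij_is_inj)

lemma weyl_adjoint: "u \<in> W0 \<Longrightarrow> u x \<bullet> y = x \<bullet> ginv u y"
  using weyl_dot[of u x "ginv u y"] by (simp add: weyl_inv_apply)

lemma weyl_neg: "u \<in> W0 \<Longrightarrow> u (- x) = - u x" and weyl_scale: "u \<in> W0 \<Longrightarrow> u (c *\<^sub>R x) = c *\<^sub>R u x"
  and weyl_add: "u \<in> W0 \<Longrightarrow> u (x + y) = u x + u y" and weyl_diff: "u \<in> W0 \<Longrightarrow> u (x - y) = u x - u y"
  and weyl_zero: "u \<in> W0 \<Longrightarrow> u 0 = 0"
  using weyl_linear[of u] by (simp_all add: linear_neg linear_scale linear_add linear_diff linear_0)

lemma weyl_refl_conj: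
  assumes "u \<in> W0" shows "u (refl a k x) = refl (u a) k (u x)"
proof -
  have "u (coroot a) = coroot (u a)"
    by (simp add: coroot_def weyl_scale[OF assms] weyl_dot[OF assms])
  then show ?thesis
    by (simp add: refl_def weyl_diff[OF assms] weyl_scale[OF assms] weyl_dot[OF assms])
qed

lemma weyl_root_iff: "u \<in> W0 \<Longrightarrow> u b \<in> \<Phi> \<longleftrightarrow> b \<in> \<Phi>"
  using weyl_root[of u b] weyl_root[OF weyl_inv, of u "u b"] by (auto simp: weyl_inv_apply)

lemma inv_weyl_comp: "u \<in> W0 \<Longrightarrow> u' \<in> W0 \<Longrightarrow> ginv (u \<circ> u') x = ginv u' (ginv u x)"
  using weyl_bij by (simp add: o_inv_distrib)

subsection \<open>The coweight lattice\<close>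

lemma coweight_expansion: "x = (\<Sum>i\<in>I. (x \<bullet> \<alpha> i) *\<^sub>R om i)"
proof -
  have "x - (\<Sum>i\<in>I. (x \<bullet> \<alpha> i) *\<^sub>R om i) = 0"
  proof (rule orthogonal_simple_zero)
    fix j assume j: "j \<in> I"
    have "(\<Sum>i\<in>I. (x \<bullet> \<alpha> i) *\<^sub>R om i) \<bullet> \<alpha> j = (\<Sum>i\<in>I. if i = j then x \<bullet> \<alpha> i else 0)"
      unfolding inner_sum_left by (rule sum.cong) (auto simp: om_dot[OF _ j])
    then show "(x - (\<Sum>i\<in>I. (x \<bullet> \<alpha> i) *\<^sub>R om i)) \<bullet> \<alpha> j = 0" using j by (simp add: inner_diff_left)
  qed
  then show ?thesis by simp
qed

lemma coweight_comb_dot: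
  assumes "j \<in> I" shows "(\<Sum>i\<in>I. c i *\<^sub>R om i) \<bullet> \<alpha> j = c j"
proof -
  have "(\<Sum>i\<in>I. c i *\<^sub>R om i) \<bullet> \<alpha> j = (\<Sum>i\<in>I. if i = j then c i else 0)"
    unfolding inner_sum_left by (rule sum.cong) (auto simp: om_dot[OF _ assms])
  then show ?thesis using assms by simp
qed

lemma lattice_iff_simple: "x \<in> P \<longleftrightarrow> (\<forall>i\<in>I. x \<bullet> \<alpha> i \<in> \<int>)"
proof
  assume "x \<in> P"
  then obtain c :: "nat \<Rightarrow> int" where "x = (\<Sum>i\<in>I. of_int (c i) *\<^sub>R om i)"
    unfolding coweight_lattice_def I_eq[symmetric] by blast
  then show "\<forall>i\<in>I. x \<bullet> \<alpha> i \<in> \<int>" using coweight_comb_dot by simp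
next
  assume "\<forall>i\<in>I. x \<bullet> \<alpha> i \<in> \<int>"
  then have "\<forall>i\<in>I. \<exists>c. x \<bullet> \<alpha> i = real_of_int c" by (auto elim: Ints_cases)
  then obtain c where c: "\<forall>i\<in>I. x \<bullet> \<alpha> i = real_of_int (c i)" by metis
  have "x = (\<Sum>i\<in>I. of_int (c i) *\<^sub>R om i)"
    by (subst coweight_expansion) (rule sum.cong, use c in auto)
  then show "x \<in> P" unfolding coweight_lattice_def I_eq[symmetric] by blast
qed

lemma lattice_root_int: assumes "x \<in> P" "b \<in> \<Phi>" shows "x \<bullet> b \<in> \<int>"
proof -
  have "b \<bullet> x \<in> \<int>" unfolding dot_expansion[of b x]
    using assms lattice_iff_simple root_coord_int
    by (intro Ints_sum Ints_mult) (auto simp: inner_commute)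
  then show ?thesis by (simp add: inner_commute)
qed

lemma lattice_root_floor: "x \<in> P \<Longrightarrow> b \<in> \<Phi> \<Longrightarrow> of_int \<lfloor>x \<bullet> b\<rfloor> = x \<bullet> b"
  using lattice_root_int by (auto elim: Ints_cases)

lemma lattice_zero: "0 \<in> P" and lattice_add: "x \<in> P \<Longrightarrow> y \<in> P \<Longrightarrow> x + y \<in> P"
  and lattice_neg: "x \<in> P \<Longrightarrow> - x \<in> P" and lattice_scale: "x \<in> P \<Longrightarrow> of_int k *\<^sub>R x \<in> P"
  by (simp_all add: lattice_iff_simple inner_add_left)

lemma lattice_weyl: "x \<in> P \<Longrightarrow> u \<in> W0 \<Longrightarrow> u x \<in> P"
  unfolding lattice_iff_simple[of "u x"]
  by (auto simp: weyl_adjoint intro!: lattice_root_int weyl_root[OF weyl_inv] simple_root)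

lemma coroot_lattice: "b \<in> \<Phi> \<Longrightarrow> coroot b \<in> P"
  unfolding lattice_iff_simple using root_coroot_int simple_root
  by (auto simp: inner_commute[of "coroot b"])

lemma om_lattice: "i \<in> I \<Longrightarrow> om i \<in> P"
  unfolding lattice_iff_simple using om_dot by auto

lemma rho_lattice: "rho \<in> P"
  unfolding lattice_iff_simple by (simp add: rho_simple)

subsection \<open>Roots of a parabolic subsystem\<close>

lemma RJ_iff: assumes "J \<subseteq> I" shows "b \<in> RJ J \<longleftrightarrow> b \<in> \<Phi> \<and> (\<forall>i\<in>I - J. om i \<bullet> b = 0)"
proof -
  have "b \<in> span (\<alpha> ` J) \<longleftrightarrow> (\<forall>i\<in>I - J. om i \<bullet> b = 0)"
  proof
    assume b: "b \<in> span (\<alpha> ` J)"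
    have "span (\<alpha> ` J) \<subseteq> {x. \<forall>i\<in>I - J. om i \<bullet> x = 0}"
    proof (rule span_minimal)
      show "\<alpha> ` J \<subseteq> {x. \<forall>i\<in>I - J. om i \<bullet> x = 0}" using assms om_dot by fastforce
      show "subspace {x. \<forall>i\<in>I - J. om i \<bullet> x = 0}"
        by (auto simp: subspace_def inner_right_distrib)
    qed
    then show "\<forall>i\<in>I - J. om i \<bullet> b = 0" using b by blast
  next
    assume z: "\<forall>i\<in>I - J. om i \<bullet> b = 0"
    have "(\<Sum>i\<in>I. (om i \<bullet> b) *\<^sub>R \<alpha> i) \<in> span (\<alpha> ` J)"
    proof (rule span_sum)
      fix i assume "i \<in> I"
      then show "(om i \<bullet> b) *\<^sub>R \<alpha> i \<in> span (\<alpha> ` J)"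
        using z by (cases "i \<in> J") (auto intro: span_scale span_base simp: span_zero)
    qed
    then show "b \<in> span (\<alpha> ` J)" using simple_expansion[of b] by simp
  qed
  then show ?thesis by (auto simp: roots_J_def)
qed

lemma RJ_root: "b \<in> RJ J \<Longrightarrow> b \<in> \<Phi>" by (simp add: roots_J_def)

lemma RJ_scale: "b \<in> RJ J \<Longrightarrow> c *\<^sub>R b \<in> \<Phi> \<Longrightarrow> c *\<^sub>R b \<in> RJ J"
  by (simp add: roots_J_def span_scale)

lemma RJ_neg: "b \<in> RJ J \<Longrightarrow> - b \<in> RJ J"
  by (simp add: roots_J_def span_neg neg_root)

lemma RJ_simple: "J \<subseteq> I \<Longrightarrow> j \<in> J \<Longrightarrow> \<alpha> j \<in> RJ J"
  using simple_root by (auto simp: roots_J_def intro: span_base)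

lemma RJ_full: "RJ I = \<Phi>"
  using span_simple by (simp add: roots_J_def)

lemma RJ_refl_simple:
  assumes "J \<subseteq> I" "j \<in> J" "b \<in> RJ J" shows "refl (\<alpha> j) 0 b \<in> RJ J"
proof -
  have "refl (\<alpha> j) 0 b \<in> span (\<alpha> ` J)"
    unfolding refl0 using assms by (intro span_diff span_scale) (auto simp: roots_J_def intro: span_base)
  then show ?thesis using assms refl_root simple_root by (auto simp: roots_J_def)
qed

lemma parabolic_preserves_RJ: assumes "J \<subseteq> I" "u \<in> WJ J" "b \<in> RJ J" shows "u b \<in> RJ J"
  using assms(2)
proof (induction rule: parabolic_induct)
  case (gen j u)
  moreover have "s j = refl (\<alpha> j) 0" using gen(1) assms(1) by (intro s_simple) auto
  ultimately show ?case using RJ_refl_simple[OF assms(1)] by simp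
qed (use assms in simp)

lemma parabolic_RJ_iff: assumes "J \<subseteq> I" "u \<in> WJ J" shows "u b \<in> RJ J \<longleftrightarrow> b \<in> RJ J"
  using parabolic_preserves_RJ[OF assms(1), of u b] parabolic_preserves_RJ[OF assms(1), of "ginv u" "u b"]
    parabolic_inv[OF assms] weyl_inv_apply[of u] parabolic_weyl[OF assms] assms by auto

text \<open>
  Each generator of \<open>W\<^sub>J\<close> permutes the positive roots other than the multiples of its own simple root, which lie in \<open>\<Phi>\<^sub>J\<close>.
\<close>

lemma parabolic_preserves_outside_pos:
  assumes "J \<subseteq> I" "u \<in> WJ J" "b \<in> pos" "b \<notin> RJ J" shows "u b \<in> pos"
  using assms(2)
proof (induction rule: parabolic_induct)
  case (gen j u)
  have "u b \<notin> RJ J" using parabolic_RJ_iff[OF assms(1) gen(2)] assms by blast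
  then have "u b \<noteq> \<alpha> j" "u b \<noteq> 2 *\<^sub>R \<alpha> j"
    using RJ_simple[OF assms(1) gen(1)] RJ_scale[of "\<alpha> j" J 2] gen(3) by (auto simp: pos_def)
  then have "refl (\<alpha> j) 0 (u b) \<in> pos" using refl_simple_pos gen assms by blast
  then show ?case using s_simple[of j] gen assms by auto
qed (use assms in simp)

lemma parabolic_outside_pos_iff:
  assumes "J \<subseteq> I" "u \<in> WJ J" "b \<in> \<Phi>" "b \<notin> RJ J" shows "u b \<in> pos \<longleftrightarrow> b \<in> pos"
proof
  show "b \<in> pos \<Longrightarrow> u b \<in> pos" using parabolic_preserves_outside_pos assms by blast
  assume ub: "u b \<in> pos"
  show "b \<in> pos"
  proof (rule ccontr)
    assume "b \<notin> pos"
    then have "- b \<in> pos" using pos_or_neg assms by blast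
    moreover have "- b \<notin> RJ J" using RJ_neg[of "- b" J] assms by auto
    ultimately have "u (- b) \<in> pos" using parabolic_preserves_outside_pos assms by blast
    then have "- u b \<in> pos" using weyl_neg[OF parabolic_weyl[OF assms(1,2)]] by simp
    then show False using ub pos_not_neg by blast
  qed
qed

text \<open>
  Reflections in simple roots lower a positive root until it is a multiple of a simple root; they all belong to \<open>J\<close>,
  because the support of the root is in \<open>J\<close>.
\<close>

lemma RJ_conj_simple:
  assumes "J \<subseteq> I" "b \<in> RJ J"
  shows "\<exists>y\<in>WJ J. \<exists>j\<in>J. \<exists>c\<in>{1, 2}. b = y (c *\<^sub>R \<alpha> j)"
proof -
  have p: "\<exists>y\<in>WJ J. \<exists>j\<in>J. \<exists>c\<in>{1, 2}. b = y (c *\<^sub>R \<alpha> j)" if "b \<in> pos" "b \<in> RJ J" for b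
    using that
  proof (induction rule: pos_root_induct)
    case (multiple b i)
    then have "i \<in> J" using RJ_iff[OF assms(1), of b] by (cases "i \<in> J") auto
    moreover have "b = id (1 *\<^sub>R \<alpha> i) \<or> b = id (2 *\<^sub>R \<alpha> i)" using multiple by simp
    ultimately show ?case using parabolic_id by blast
  next
    case (reflect b i)
    then have i: "i \<in> J" using RJ_iff[OF assms(1), of b] by (cases "i \<in> J") auto
    have "refl (\<alpha> i) 0 b \<in> RJ J" using RJ_refl_simple assms i reflect by blast
    then obtain y j c where y: "y \<in> WJ J" "j \<in> J" "c \<in> {1, 2}" "refl (\<alpha> i) 0 b = y (c *\<^sub>R \<alpha> j)"
      using reflect by blast
    have "b = refl (\<alpha> i) 0 (y (c *\<^sub>R \<alpha> j))"
      using refl_refl[OF simple_root[OF reflect(2)], of 0 b] y(4) by simp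
    then have "b = (s i \<circ> y) (c *\<^sub>R \<alpha> j)" using s_simple[OF reflect(2)] by simp
    moreover have "s i \<circ> y \<in> WJ J" using parabolic_comp parabolic_gen i y by blast
    ultimately show ?case using y by blast
  qed
  show ?thesis
  proof (cases "b \<in> pos")
    case True then show ?thesis using p assms by blast
  next
    case False
    then have "- b \<in> pos" using pos_or_neg RJ_root assms by blast
    moreover have "- b \<in> RJ J" using RJ_neg assms by blast
    ultimately obtain y j c where y: "y \<in> WJ J" "j \<in> J" "c \<in> {1, 2}" "- b = y (c *\<^sub>R \<alpha> j)" using p by blast
    have jI: "j \<in> I" using y assms by blast
    have sW: "s j \<in> W0" using parabolic_weyl[OF assms(1)] parabolic_gen y by blast
    have "s j (c *\<^sub>R \<alpha> j) = - (c *\<^sub>R \<alpha> j)"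
      using weyl_scale[OF sW] refl_self[OF simple_root[OF jI]] s_simple[OF jI] by simp
    then have "(y \<circ> s j) (c *\<^sub>R \<alpha> j) = - y (c *\<^sub>R \<alpha> j)"
      using weyl_neg[OF parabolic_weyl[OF assms(1) y(1)]] by (simp only: comp_apply)
    then have "b = (y \<circ> s j) (c *\<^sub>R \<alpha> j)" using y(4) by (metis minus_minus)
    moreover have "y \<circ> s j \<in> WJ J" using parabolic_comp parabolic_gen y by blast
    ultimately show ?thesis using y by blast
  qed
qed

lemma refl_scale: assumes "c \<noteq> 0" shows "refl (c *\<^sub>R a) 0 = refl a 0"
  using assms by (auto simp: fun_eq_iff refl0 dot_coroot)

lemma RJ_refl_parabolic:
  assumes "J \<subseteq> I" "b \<in> RJ J" shows "refl b 0 \<in> WJ J"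
proof -
  obtain y j c where y: "y \<in> WJ J" "j \<in> J" "c \<in> {1, 2}" "b = y (c *\<^sub>R \<alpha> j)"
    using RJ_conj_simple[OF assms] by blast
  have yW: "y \<in> W0" using parabolic_weyl assms y by blast
  have jI: "j \<in> I" using y assms by blast
  have "refl b 0 = y \<circ> s j \<circ> ginv y"
  proof
    fix x
    have "refl b 0 x = refl (y (c *\<^sub>R \<alpha> j)) 0 (y (ginv y x))" using y weyl_inv_apply[OF yW] by simp
    also have "\<dots> = y (refl (c *\<^sub>R \<alpha> j) 0 (ginv y x))" using weyl_refl_conj[OF yW] by simp
    finally show "refl b 0 x = (y \<circ> s j \<circ> ginv y) x"
      using refl_scale[of c "\<alpha> j"] y(3) s_simple[OF jI] by auto
  qed
  then show ?thesis using parabolic_comp parabolic_gen parabolic_inv y assms by simp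
qed

lemma refl_weyl: "b \<in> \<Phi> \<Longrightarrow> refl b 0 \<in> W0"
  using RJ_refl_parabolic[of I b] RJ_full by (auto simp: weyl_I)

subsection \<open>Weights and linear parts\<close>

text \<open>
  The translation part is the value at 0, since the linear part fixes 0.
\<close>

lemma wt_lin:
  assumes "l \<in> P" "u \<in> W0"
  shows wt_transl: "wgt (transl l \<circ> u) = l" and lin_transl: "lin (transl l \<circ> u) = u"
proof -
  have uniq: "l' = l \<and> u' = u" if "l' \<in> P" "u' \<in> W0" "transl l \<circ> u = transl l' \<circ> u'" for l' u'
  proof -
    have "l = l'" using fun_cong[OF that(3), of 0] weyl_zero[OF assms(2)] weyl_zero[OF that(2)]
      by (simp add: transl_def)
    moreover have "u x = u' x" for x
      using fun_cong[OF that(3), of x] \<open>l = l'\<close> by (simp add: transl_def)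
    ultimately show ?thesis by auto
  qed
  show "wgt (transl l \<circ> u) = l" unfolding wt_def by (rule the_equality) (use assms uniq in blast)+
  show "lin (transl l \<circ> u) = u" unfolding lin_part_def by (rule the_equality) (use assms uniq in blast)+
qed

lemma ext_weyl_decomp:
  assumes "w \<in> EW"
  shows wt_lattice: "wgt w \<in> P" and lin_weyl: "lin w \<in> W0" and ext_decomp: "w = transl (wgt w) \<circ> lin w"
  using assms wt_lin by (auto simp: ext_weyl_def)

lemma ext_apply: "w \<in> EW \<Longrightarrow> w x = wgt w + lin w x"
  using ext_decomp[of w] by (metis comp_apply transl_def)

lemma ext_weylI: "l \<in> P \<Longrightarrow> u \<in> W0 \<Longrightarrow> transl l \<circ> u \<in> EW"
  by (auto simp: ext_weyl_def)

lemma ext_comp: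
  assumes "w \<in> EW" "w' \<in> EW"
  shows ext_comp_mem: "w \<circ> w' \<in> EW" and lin_comp: "lin (w \<circ> w') = lin w \<circ> lin w'"
    and wt_comp: "wgt (w \<circ> w') = wgt w + lin w (wgt w')"
proof -
  note d = ext_weyl_decomp[OF assms(1)] ext_weyl_decomp[OF assms(2)]
  have l: "wgt w + lin w (wgt w') \<in> P" using d lattice_add lattice_weyl by blast
  have u: "lin w \<circ> lin w' \<in> W0" using d weyl_comp by blast
  have e: "w \<circ> w' = transl (wgt w + lin w (wgt w')) \<circ> (lin w \<circ> lin w')"
    using ext_apply[OF assms(1)] ext_apply[OF assms(2)] weyl_add[OF d(2)]
    by (auto simp: fun_eq_iff transl_def)
  show "w \<circ> w' \<in> EW" unfolding e by (rule ext_weylI[OF l u])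
  show "lin (w \<circ> w') = lin w \<circ> lin w'" unfolding e by (rule lin_transl[OF l u])
  show "wgt (w \<circ> w') = wgt w + lin w (wgt w')" unfolding e by (rule wt_transl[OF l u])
qed

lemma transl_zero: "transl 0 = id" by (auto simp: transl_def)

lemma weyl_ext: assumes "u \<in> W0" shows "u \<in> EW" "lin u = u" "wgt u = 0"
  using ext_weylI[OF lattice_zero assms] wt_lin[OF lattice_zero assms] by (simp_all add: transl_zero)

lemma transl_ext: assumes "l \<in> P" shows "transl l \<in> EW" "lin (transl l) = id" "wgt (transl l) = l"
  using ext_weylI[OF assms weyl_id] wt_lin[OF assms weyl_id] by simp_all

lemma s_ext:
  assumes "i \<in> {0..DIM('a)}"
  shows "s i \<in> EW" "lin (s i) = refl (aroot i) 0" "wgt (s i) = (if i = 0 then coroot phi else 0)"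
proof -
  have "s i \<in> EW \<and> lin (s i) = refl (aroot i) 0 \<and> wgt (s i) = (if i = 0 then coroot phi else 0)"
  proof (cases "i = 0")
    case True
    have "s 0 = transl (coroot phi) \<circ> refl phi 0"
      by (auto simp: s_zero fun_eq_iff transl_def refl_def algebra_simps)
    then show ?thesis
      using wt_lin[OF coroot_lattice[OF phi_root] refl_weyl[OF phi_root]]
        ext_weylI[OF coroot_lattice[OF phi_root] refl_weyl[OF phi_root]]
        refl_scale[of "- 1" phi] True by (simp add: aroot_zero)
  next
    case False
    then have i: "i \<in> I" using assms index0_iff by auto
    then show ?thesis using weyl_ext[OF refl_weyl[OF simple_root[OF i]]] False
      by (simp add: s_simple aroot_simple)
  qed
  then show "s i \<in> EW" "lin (s i) = refl (aroot i) 0" "wgt (s i) = (if i = 0 then coroot phi else 0)"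
    by blast+
qed

lemma ext_inverse: assumes "w \<in> EW" shows "\<exists>w'\<in>EW. w' \<circ> w = id \<and> w \<circ> w' = id"
proof -
  note d = ext_weyl_decomp[OF assms]
  let ?w' = "transl (ginv (lin w) (- wgt w)) \<circ> ginv (lin w)"
  have "?w' \<in> EW" using d lattice_weyl lattice_neg weyl_inv by (intro ext_weylI) blast+
  moreover have "?w' (w x) = x" "w (?w' x) = x" for x
    using weyl_inv_apply[OF d(2)] weyl_add[OF d(2)] weyl_add[OF weyl_inv[OF d(2)]] weyl_neg[OF weyl_inv[OF d(2)]]
    by (simp_all add: ext_apply[OF assms] transl_def weyl_neg[OF d(2)] weyl_diff[OF d(2)])
  ultimately show ?thesis by (intro bexI[of _ ?w']) (auto simp: fun_eq_iff)
qed

lemma ext_bij: "w \<in> EW \<Longrightarrow> bij w" and ext_inv: "w \<in> EW \<Longrightarrow> ginv w \<in> EW"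
  using ext_inverse[of w] inv_unique_comp[of w] o_bij[of _ w] by metis+

lemma stab_ext: "\<sigma> \<in> Stab \<Longrightarrow> \<sigma> \<in> EW" and stab_image: "\<sigma> \<in> Stab \<Longrightarrow> \<sigma> ` A0 = A0"
  by (simp_all add: alcove_stab_def)


section \<open>Alcoves, wall crossings and length\<close>

text \<open>
  A point inside the fundamental alcove: a multiple of \<open>rho\<close> that is small enough to pair with the highest root to less
  than 1.
\<close>

definition p0 :: 'a where "p0 = (1 / (rho \<bullet> phi + 1)) *\<^sub>R rho"

lemma p0_pos: assumes "b \<in> pos" shows "0 < p0 \<bullet> b" "p0 \<bullet> b < 1"
proof -
  have "0 < rho \<bullet> b" "rho \<bullet> b \<le> rho \<bullet> phi"
    using assms phi_top_rho by (auto simp: pos_def)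
  then show "0 < p0 \<bullet> b" "p0 \<bullet> b < 1" by (auto simp: p0_def)
qed

text \<open>
  The alcove \<open>w A0\<close> lies in the strip between the hyperplanes at \<open>strip b w\<close> and \<open>strip b w + 1\<close> in direction \<open>b\<close>; the
  point \<open>w p0\<close> is in its interior and therefore never on a hyperplane.
\<close>

definition strip :: "'a \<Rightarrow> ('a \<Rightarrow> 'a) \<Rightarrow> int" where "strip b w = \<lfloor>w p0 \<bullet> b\<rfloor>"

lemma strip_id: assumes "b \<in> \<Phi>" shows "strip b id = (if b \<in> pos then 0 else - 1)"
proof (cases "b \<in> pos")
  case True then show ?thesis using p0_pos[OF True] by (simp add: strip_def floor_eq_iff)
next
  case False
  then have "- b \<in> pos" using pos_or_neg assms by blast
  then show ?thesis using False p0_pos[of "- b"] by (simp add: strip_def floor_eq_iff)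
qed

lemma p0_mem_A0: "p0 \<in> A0"
  using p0_pos by (auto simp: fund_alcove_def pos_roots_eq less_imp_le)

lemma A0_bounds: assumes "x \<in> A0" "b \<in> \<Phi>"
  shows "of_int (strip b id) \<le> x \<bullet> b" "x \<bullet> b \<le> of_int (strip b id) + 1"
proof -
  have p: "0 \<le> x \<bullet> c \<and> x \<bullet> c \<le> 1" if "c \<in> pos" for c
    using assms that by (auto simp: fund_alcove_def pos_roots_eq)
  show "of_int (strip b id) \<le> x \<bullet> b" "x \<bullet> b \<le> of_int (strip b id) + 1"
    using p[of b] p[of "- b"] pos_or_neg[OF assms(2)] strip_id[OF assms(2)] by auto
qed

lemma strip_id_strict: assumes "b \<in> \<Phi>"
  shows "of_int (strip b id) < p0 \<bullet> b" "p0 \<bullet> b < of_int (strip b id) + 1"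
  using p0_pos[of b] p0_pos[of "- b"] pos_or_neg[OF assms] strip_id[OF assms] by auto

lemma ext_dot:
  assumes "w \<in> EW" "b \<in> \<Phi>" shows "w x \<bullet> b = of_int \<lfloor>wgt w \<bullet> b\<rfloor> + x \<bullet> ginv (lin w) b"
proof -
  have "w x \<bullet> b = wgt w \<bullet> b + lin w x \<bullet> b"
    by (subst ext_apply[OF assms(1)]) (rule inner_add_left)
  then show ?thesis
    by (simp only: lattice_root_floor[OF wt_lattice[OF assms(1)] assms(2)]
        weyl_adjoint[OF lin_weyl[OF assms(1)]])
qed

lemma ginv_root: "w \<in> EW \<Longrightarrow> b \<in> \<Phi> \<Longrightarrow> ginv (lin w) b \<in> \<Phi>"
  using weyl_root weyl_inv lin_weyl by blast

lemma strip_comp: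
  assumes "w \<in> EW" "b \<in> \<Phi>" shows "strip b (w \<circ> v) = \<lfloor>wgt w \<bullet> b\<rfloor> + strip (ginv (lin w) b) v"
  by (simp add: strip_def ext_dot[OF assms])

lemma strip_formula:
  assumes "w \<in> EW" "b \<in> \<Phi>"
  shows "strip b w = \<lfloor>wgt w \<bullet> b\<rfloor> + (if ginv (lin w) b \<in> pos then 0 else - 1)"
  using strip_comp[OF assms, of id] strip_id[OF ginv_root[OF assms]] by simp

lemma strip_bounds:
  assumes "w \<in> EW" "b \<in> \<Phi>" "x \<in> A0" shows "of_int (strip b w) \<le> w x \<bullet> b" "w x \<bullet> b \<le> of_int (strip b w) + 1"
  using A0_bounds[OF assms(3) ginv_root[OF assms(1,2)]] strip_comp[OF assms(1,2), of id]
  by (simp_all add: ext_dot[OF assms(1,2)])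

lemma strip_strict:
  assumes "w \<in> EW" "b \<in> \<Phi>" shows "of_int (strip b w) < w p0 \<bullet> b" "w p0 \<bullet> b < of_int (strip b w) + 1"
  using strip_id_strict[OF ginv_root[OF assms]] strip_comp[OF assms, of id]
  by (simp_all add: ext_dot[OF assms])

lemma strip_neg: assumes "w \<in> EW" "b \<in> \<Phi>" shows "strip (- b) w = - strip b w - 1"
proof -
  have "of_int (strip b w) < w p0 \<bullet> b" "w p0 \<bullet> b < of_int (strip b w) + 1" using strip_strict assms by blast+
  then show ?thesis by (simp add: strip_def[of "- b"] floor_eq_iff)
qed

lemma strip_transl: assumes "l \<in> P" "b \<in> \<Phi>" shows "strip b (transl l \<circ> w) = \<lfloor>l \<bullet> b\<rfloor> + strip b w"
  using strip_comp[OF transl_ext(1)[OF assms(1)] assms(2)] transl_ext[OF assms(1)] inv_id by (simp add: id_def)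

text \<open>
  The point \<open>\<sigma> p0\<close> is again in \<open>A0\<close>, and it is on no hyperplane.
\<close>

lemma strip_stab: assumes "w \<in> EW" "\<sigma> \<in> Stab" "b \<in> \<Phi>" shows "strip b (w \<circ> \<sigma>) = strip b w"
proof -
  have "strip c \<sigma> = strip c id" if c: "c \<in> \<Phi>" for c
  proof -
    have "\<sigma> p0 \<in> A0" using stab_image[OF assms(2)] p0_mem_A0 by blast
    then have "of_int (strip c id) \<le> \<sigma> p0 \<bullet> c" "\<sigma> p0 \<bullet> c \<le> of_int (strip c id) + 1"
      using A0_bounds c by blast+
    moreover have "of_int (strip c \<sigma>) < \<sigma> p0 \<bullet> c" "\<sigma> p0 \<bullet> c < of_int (strip c \<sigma>) + 1"
      using strip_strict[OF stab_ext[OF assms(2)] c] by blast+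
    ultimately show ?thesis by linarith
  qed
  then show ?thesis using strip_comp[OF assms(1,3)] strip_comp[OF assms(1,3), of id] ginv_root[OF assms(1,3)] by simp
qed

subsection \<open>Crossing a wall\<close>

text \<open>
  A wall with direction \<open>c\<close> is also one of the hyperplanes of \<open>2 c\<close> if this is a root. The root \<open>c / 2\<close>
  is absent: if it exists, \<open>c\<close> comes from \<open>- phi\<close>, and the wall \<open>\<langle>x, phi\<rangle> = 1\<close> is in the middle of a strip of \<open>phi / 2\<close>.
\<close>

definition along :: "'a \<Rightarrow> 'a \<Rightarrow> int" where
  "along b c = (if b = c \<or> b = 2 *\<^sub>R c then 1 else 0)"

lemma pos_neq:
  assumes "b \<in> pos" "c \<in> pos"
  shows "b \<noteq> - c" "b \<noteq> 2 *\<^sub>R (- c)" "- b \<noteq> c" "- b \<noteq> 2 *\<^sub>R c"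
proof -
  have ne: "x \<noteq> y" if "rho \<bullet> x \<noteq> rho \<bullet> y" for x y using that by auto
  show "b \<noteq> - c" "b \<noteq> 2 *\<^sub>R (- c)" "- b \<noteq> c" "- b \<noteq> 2 *\<^sub>R c"
    by (rule ne, use assms in \<open>simp add: pos_def\<close>)+
qed

text \<open>
  Apart from the wall of \<open>s i\<close> itself, no hyperplane separates \<open>A0\<close> from \<open>s i A0\<close>. For \<open>i = 0\<close> a root \<open>b\<close> that pairs to 1
  with the coroot of \<open>phi\<close> is replaced by \<open>phi - b\<close>, which is again a positive root.
\<close>

lemma base_crossing_pos:
  assumes i: "i \<in> {0..DIM('a)}" and b: "b \<in> pos"
  shows "strip b (s i) = strip b id - along b (aroot i) + along (- b) (aroot i)"
proof -
  have bR: "b \<in> \<Phi>" using b by (simp add: pos_def)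
  consider "i = 0" | "i \<in> I" using i index0_iff by auto
  then show ?thesis
  proof cases
    case 1
    have e: "s i p0 \<bullet> b = p0 \<bullet> refl phi 0 b + b \<bullet> coroot phi"
      by (simp add: 1 s_zero refl_def refl0 inner_diff_left inner_diff_right inner_commute[of b] dot_coroot
          coroot_def algebra_simps add_divide_distrib diff_divide_distrib)
    have dl0: "along b (aroot i) = 0" "along (- b) (aroot i) = (if b = phi then 1 else 0)"
      using pos_neq[OF b phi_pos] double_phi bR by (auto simp: along_def 1 aroot_zero)
    consider "b \<bullet> coroot phi = 0" "b \<noteq> phi" | "b \<bullet> coroot phi = 1" "b \<noteq> phi" | "b = phi"
      using phi_pairing[OF b] by blast
    then show ?thesis
    proof cases
      case 1
      then have "s i p0 \<bullet> b = p0 \<bullet> b" using e by (simp add: refl0)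
      then show ?thesis using dl0 1 by (simp add: strip_def)
    next
      case 2
      have r: "- refl phi 0 b \<in> \<Phi>" using refl_root[OF phi_root bR] neg_root by blast
      have "0 \<le> rho \<bullet> (- refl phi 0 b)" using 2 phi_top_rho[OF bR] by (simp add: refl0 inner_diff_right)
      then have "- refl phi 0 b \<in> pos" using r root_rho_nz[OF r] by (simp add: pos_def)
      then have "0 < s i p0 \<bullet> b" "s i p0 \<bullet> b < 1"
        using p0_pos[of "- refl phi 0 b"] e 2 by auto
      then have "strip b (s i) = 0" by (simp add: strip_def floor_eq_iff)
      then show ?thesis using dl0 2 strip_id[OF bR] b by simp
    next
      case 3
      have "b \<bullet> coroot phi = 2" using root_norm_pos[OF phi_root] by (simp add: 3 dot_coroot)
      then have "s i p0 \<bullet> b = 2 - p0 \<bullet> phi" using e refl_self[OF phi_root] by (simp add: 3)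
      then have "strip b (s i) = 1" using p0_pos[OF phi_pos] by (simp add: strip_def floor_eq_iff)
      then show ?thesis using dl0 3 strip_id[OF bR] b by simp
    qed
  next
    case 2
    have aR: "\<alpha> i \<in> \<Phi>" using 2 simple_root by blast
    have r: "ginv (refl (\<alpha> i) 0) = refl (\<alpha> i) 0"
      using refl_refl[OF aR] by (intro inv_unique_comp) (auto simp: fun_eq_iff)
    have "s i p0 \<bullet> b = p0 \<bullet> refl (\<alpha> i) 0 b"
      using weyl_adjoint[OF refl_weyl[OF aR]] r by (simp add: s_simple[OF 2])
    then have Ks: "strip b (s i) = strip (refl (\<alpha> i) 0 b) id" by (simp add: strip_def)
    have dl0: "along (- b) (aroot i) = 0"
      using pos_neq[OF b simple_pos[OF 2]] by (auto simp: along_def aroot_simple[OF 2])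
    have rR: "refl (\<alpha> i) 0 b \<in> \<Phi>" using refl_root[OF aR bR] .
    show ?thesis
    proof (cases "b = \<alpha> i \<or> b = 2 *\<^sub>R \<alpha> i")
      case True
      then have "refl (\<alpha> i) 0 b = - b"
        using refl_self[OF aR] weyl_scale[OF refl_weyl[OF aR]] by auto
      then show ?thesis using Ks rR dl0 True strip_id[OF rR] strip_id[OF bR] b pos_not_neg[OF b]
        by (simp add: along_def aroot_simple[OF 2])
    next
      case False
      then have "refl (\<alpha> i) 0 b \<in> pos" using refl_simple_pos b 2 by blast
      then show ?thesis using Ks rR dl0 False strip_id[OF rR] strip_id[OF bR] b
        by (simp add: along_def aroot_simple[OF 2])
    qed
  qed
qed

lemma base_crossing:
  assumes i: "i \<in> {0..DIM('a)}" and b: "b \<in> \<Phi>"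
  shows "strip b (s i) = strip b id - along b (aroot i) + along (- b) (aroot i)"
proof (cases "b \<in> pos")
  case False
  then have "- b \<in> pos" using pos_or_neg b by blast
  then show ?thesis
    using base_crossing_pos[OF i, of "- b"] strip_neg[OF s_ext(1)[OF i] b] strip_neg[OF weyl_ext(1)[OF weyl_id] b]
    by simp
qed (use base_crossing_pos i in blast)

lemma crossing:
  assumes w: "w \<in> EW" and i: "i \<in> {0..DIM('a)}" and b: "b \<in> \<Phi>"
  shows "strip b (w \<circ> s i) = strip b w - along b (lin w (aroot i)) + along (- b) (lin w (aroot i))"
proof -
  note u = lin_weyl[OF w]
  have "along (ginv (lin w) c) (aroot i) = along c (lin w (aroot i))" for c
    using weyl_inv_apply[OF u] weyl_scale[OF u] unfolding along_def by metis
  then show ?thesis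
    using strip_comp[OF w b, of "s i"] strip_comp[OF w b, of id] base_crossing[OF i ginv_root[OF w b]]
      weyl_neg[OF weyl_inv[OF u], symmetric] by simp
qed

lemma wall_root: "w \<in> EW \<Longrightarrow> i \<in> {0..DIM('a)} \<Longrightarrow> lin w (aroot i) \<in> \<Phi>"
  using weyl_root[OF lin_weyl] aroot_root by blast

subsection \<open>Length as the number of separating hyperplanes\<close>

text \<open>
  Each hyperplane belongs to exactly one of these roots: the hyperplanes of \<open>b\<close> are among those of \<open>2 b\<close>.
\<close>

definition nonmult :: "'a set" where "nonmult = {b \<in> pos. 2 *\<^sub>R b \<notin> \<Phi>}"

definition sep_count :: "('a \<Rightarrow> 'a) \<Rightarrow> nat" where "sep_count w = (\<Sum>b\<in>nonmult. nat \<bar>strip b w\<bar>)"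

lemma finite_nonmult [simp]: "finite nonmult"
  using finite_roots by (auto simp: nonmult_def pos_def)

lemma nonmult_pos: "b \<in> nonmult \<Longrightarrow> b \<in> pos" and nonmult_root: "b \<in> nonmult \<Longrightarrow> b \<in> \<Phi>"
  by (auto simp: nonmult_def pos_def)

lemma no_quadruple: assumes "a \<in> \<Phi>" shows "4 *\<^sub>R a \<notin> \<Phi>"
proof
  assume q: "4 *\<^sub>R a \<in> \<Phi>"
  have "a \<bullet> coroot (4 *\<^sub>R a) = 1 / 2" using root_norm_pos[OF assms] by (simp add: dot_coroot)
  then have "(1 / 2 :: real) \<in> \<int>" using root_coroot_int[OF q assms] by metis
  then obtain k where "1 / 2 = real_of_int k" by (auto elim: Ints_cases)
  then have "1 = real_of_int (2 * k)" by simp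
  then have "2 * k = 1" by linarith
  then show False by presburger
qed

text \<open>
  Exactly one element of \<open>nonmult\<close> sees the wall with direction \<open>c\<close>.
\<close>

lemma wall_in_nonmult:
  assumes "c \<in> \<Phi>"
  defines "e \<equiv> (if c \<in> pos then c else - c)"
  shows "\<exists>b\<in>nonmult. (b = e \<or> b = 2 *\<^sub>R e) \<and>
     (\<forall>a\<in>nonmult. - along a c + along (- a) c = (if a = b then (if c \<in> pos then - 1 else 1) else 0))"
proof -
  have e: "e \<in> pos" using assms pos_or_neg by auto
  then have eR: "e \<in> \<Phi>" by (simp add: pos_def)
  define b where "b = (if 2 *\<^sub>R e \<in> \<Phi> then 2 *\<^sub>R e else e)"
  have b: "b \<in> nonmult" using e no_quadruple[OF eR] by (auto simp: b_def nonmult_def pos_def)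
  have "along a e = (if a = b then 1 else 0)" "along (- a) e = 0" if "a \<in> nonmult" for a
    using that pos_neq(3,4)[OF nonmult_pos[OF that] e] by (auto simp: along_def b_def nonmult_def pos_def)
  moreover have "along (- a) c = along a (- c)" "along a c = along (- a) (- c)" for a
    by (simp_all add: along_def minus_equation_iff[of a] eq_commute[of "- c"] eq_commute[of "- (2 *\<^sub>R c)"])
  ultimately have "- along a c + along (- a) c = (if a = b then (if c \<in> pos then - 1 else 1) else 0)"
    if "a \<in> nonmult" for a
    using that by (cases "c \<in> pos") (simp_all add: e_def)
  then show ?thesis using b by (intro bexI[of _ b]) (auto simp: b_def)
qed

text \<open>
  A crossing changes one of the strip numbers that are counted, by one, so the number of separating hyperplanes also changes by one.
\<close>

lemma sep_count_crossing:
  assumes w: "w \<in> EW" and i: "i \<in> {0..DIM('a)}"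
  defines "c \<equiv> lin w (aroot i)"
  shows "\<exists>b\<in>nonmult. (b = (if c \<in> pos then c else - c) \<or> b = 2 *\<^sub>R (if c \<in> pos then c else - c)) \<and>
     int (sep_count (w \<circ> s i)) = int (sep_count w) - \<bar>strip b w\<bar> + \<bar>strip b w + (if c \<in> pos then - 1 else 1)\<bar>"
proof -
  have c: "c \<in> \<Phi>" using wall_root w i by (simp add: c_def)
  obtain b where b: "b \<in> nonmult" "b = (if c \<in> pos then c else - c) \<or> b = 2 *\<^sub>R (if c \<in> pos then c else - c)"
    and d: "\<And>a. a \<in> nonmult \<Longrightarrow> - along a c + along (- a) c = (if a = b then (if c \<in> pos then - 1 else 1) else 0)"
    using wall_in_nonmult[OF c] by blast
  have strip: "strip a (w \<circ> s i) = strip a w + (if a = b then (if c \<in> pos then - 1 else 1) else 0)" if "a \<in> nonmult" for a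
    using crossing[OF w i nonmult_root[OF that]] d[OF that] by (simp add: c_def)
  have "(\<Sum>a\<in>nonmult - {b}. nat \<bar>strip a (w \<circ> s i)\<bar>) = (\<Sum>a\<in>nonmult - {b}. nat \<bar>strip a w\<bar>)"
    by (rule sum.cong) (use strip in auto)
  then have "int (sep_count (w \<circ> s i)) = int (sep_count w) - \<bar>strip b w\<bar> + \<bar>strip b w + (if c \<in> pos then - 1 else 1)\<bar>"
    using strip[OF b(1)] sum.remove[OF finite_nonmult b(1), of "\<lambda>a. nat \<bar>strip a (w \<circ> s i)\<bar>"]
      sum.remove[OF finite_nonmult b(1), of "\<lambda>a. nat \<bar>strip a w\<bar>"]
    unfolding sep_count_def by simp
  then show ?thesis using b by blast
qed

lemma sep_count_crossing_le: "w \<in> EW \<Longrightarrow> i \<in> {0..DIM('a)} \<Longrightarrow> sep_count (w \<circ> s i) \<le> sep_count w + 1"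
  using sep_count_crossing[of w i] by (fastforce split: if_splits)

lemma sep_count_id: "sep_count id = 0"
  by (simp add: sep_count_def strip_id nonmult_pos nonmult_root)

lemma sep_count_stab: "w \<in> EW \<Longrightarrow> \<sigma> \<in> Stab \<Longrightarrow> sep_count (w \<circ> \<sigma>) = sep_count w"
  by (simp add: sep_count_def strip_stab nonmult_root)

lemma sep_count_zero_strip:
  assumes "w \<in> EW" "sep_count w = 0" "b \<in> pos" shows "strip b w = 0"
proof -
  have z: "strip c w = 0" if "c \<in> nonmult" for c using assms(2) that by (simp add: sep_count_def)
  show ?thesis
  proof (cases "b \<in> nonmult")
    case False
    then have d: "2 *\<^sub>R b \<in> \<Phi>" using assms(3) by (simp add: nonmult_def)
    have bR: "b \<in> \<Phi>" using assms(3) by (simp add: pos_def)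
    have "2 *\<^sub>R b \<in> nonmult" using d no_quadruple[OF bR] assms(3) by (auto simp: nonmult_def pos_def)
    then have "0 < w p0 \<bullet> (2 *\<^sub>R b)" "w p0 \<bullet> (2 *\<^sub>R b) < 1" using z strip_strict[OF assms(1) d] by force+
    then show ?thesis by (simp add: strip_def floor_eq_iff)
  qed (use z in blast)
qed

lemma strip_zero_maps:
  assumes "w \<in> EW" "\<And>b. b \<in> pos \<Longrightarrow> strip b w = 0" shows "w ` A0 \<subseteq> A0"
proof
  fix y assume "y \<in> w ` A0"
  then obtain x where x: "x \<in> A0" "y = w x" by blast
  have "0 \<le> y \<bullet> b \<and> y \<bullet> b \<le> 1" if "b \<in> pos" for b
    using strip_bounds[OF assms(1) pos_root[OF that] x(1)] assms(2)[OF that] x(2) by simp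
  then show "y \<in> A0" by (simp add: fund_alcove_def pos_roots_eq)
qed

lemma ginv_ext:
  assumes w: "w \<in> EW" shows "wgt (ginv w) = - ginv (lin w) (wgt w)" "lin (ginv w) = ginv (lin w)"
proof -
  note u = lin_weyl[OF w]
  have iw: "ginv w \<in> EW" using ext_inv w by blast
  have "w \<circ> ginv w = id" using ext_bij[OF w] bij_is_surj surj_iff by blast
  then have "lin w \<circ> lin (ginv w) = id" "wgt w + lin w (wgt (ginv w)) = 0"
    using lin_comp[OF w iw] wt_comp[OF w iw] weyl_ext[OF weyl_id] by simp_all
  then have 1: "lin w (lin (ginv w) x) = x" and 2: "lin w (wgt (ginv w)) = - wgt w" for x
    by (auto simp: fun_eq_iff add_eq_0_iff)
  show "lin (ginv w) = ginv (lin w)" using 1 weyl_inv_apply(2)[OF u] by (metis ext)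
  show "wgt (ginv w) = - ginv (lin w) (wgt w)"
    using 2 weyl_inv_apply(2)[OF u] weyl_neg[OF weyl_inv[OF u]] by metis
qed

lemma ginv_ginv: "u \<in> W0 \<Longrightarrow> ginv (ginv u) = u"
  using weyl_bij inv_inv_eq by blast

text \<open>
  The weight of \<open>w\<^sup>-\<^sup>1\<close> is minus the weight of \<open>w\<close>, moved by the inverse linear part; the remaining terms record the signs of
  the two roots.
\<close>

lemma strip_ginv:
  assumes w: "w \<in> EW" and b: "b \<in> \<Phi>"
  shows "strip (ginv (lin w) b) (ginv w) = - strip b w + (if b \<in> pos then 0 else - 1) + (if ginv (lin w) b \<in> pos then 0 else - 1)"
proof -
  note u = lin_weyl[OF w]
  have "wgt (ginv w) \<bullet> ginv (lin w) b = - (wgt w \<bullet> b)"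
    using ginv_ext[OF w] weyl_dot[OF weyl_inv[OF u]] by simp
  also have "\<dots> = of_int (- \<lfloor>wgt w \<bullet> b\<rfloor>)"
    by (simp only: of_int_minus lattice_root_floor[OF wt_lattice[OF w] b])
  finally have "\<lfloor>wgt (ginv w) \<bullet> ginv (lin w) b\<rfloor> = - \<lfloor>wgt w \<bullet> b\<rfloor>" by (simp only: floor_of_int)
  then show ?thesis
    using strip_formula[OF ext_inv[OF w] ginv_root[OF w b]] strip_formula[OF w b]
    by (simp add: ginv_ext[OF w] ginv_ginv[OF u] weyl_inv_apply[OF u])
qed

text \<open>The hyperplanes between \<open>A0\<close> and \<open>w A0\<close> are mapped by \<open>w\<^sup>-\<^sup>1\<close> to those between \<open>w\<^sup>-\<^sup>1 A0\<close> and \<open>A0\<close>.\<close>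

lemma sep_count_inverse: assumes w: "w \<in> EW" shows "sep_count (ginv w) = sep_count w"
proof -
  note u = lin_weyl[OF w]
  define f where "f b = (if ginv (lin w) b \<in> pos then ginv (lin w) b else - ginv (lin w) b)" for b
  define g where "g b = (if lin w b \<in> pos then lin w b else - lin w b)" for b
  have dbl: "2 *\<^sub>R v b \<in> \<Phi> \<longleftrightarrow> 2 *\<^sub>R b \<in> \<Phi>" if "v \<in> W0" for v b
    using weyl_root_iff[OF that, of "2 *\<^sub>R b"] weyl_scale[OF that] by simp
  have fn: "f b \<in> nonmult" if "b \<in> nonmult" for b
  proof -
    have "f b \<in> pos" using pos_or_neg[OF ginv_root[OF w nonmult_root[OF that]]] by (auto simp: f_def)
    moreover have "2 *\<^sub>R f b \<notin> \<Phi>"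
      using that dbl[OF weyl_inv[OF u], of b] neg_root_iff[of "2 *\<^sub>R ginv (lin w) b"] by (auto simp: f_def nonmult_def)
    ultimately show ?thesis by (simp add: nonmult_def)
  qed
  have gn: "g b \<in> nonmult" if "b \<in> nonmult" for b
  proof -
    have "g b \<in> pos" using pos_or_neg[OF weyl_root[OF u nonmult_root[OF that]]] by (auto simp: g_def)
    moreover have "2 *\<^sub>R g b \<notin> \<Phi>"
      using that dbl[OF u, of b] neg_root_iff[of "2 *\<^sub>R lin w b"] by (auto simp: g_def nonmult_def)
    ultimately show ?thesis by (simp add: nonmult_def)
  qed
  have "sep_count w = (\<Sum>b\<in>nonmult. nat \<bar>strip (f b) (ginv w)\<bar>)"
    unfolding sep_count_def
  proof (rule sum.cong)
    fix b assume b: "b \<in> nonmult"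
    then have bR: "b \<in> \<Phi>" and bp: "b \<in> pos" by (auto simp: nonmult_root nonmult_pos)
    show "nat \<bar>strip b w\<bar> = nat \<bar>strip (f b) (ginv w)\<bar>"
      using strip_ginv[OF w bR] bp strip_neg[OF ext_inv[OF w] ginv_root[OF w bR]] by (auto simp: f_def)
  qed simp
  also have "\<dots> = (\<Sum>b\<in>nonmult. nat \<bar>strip b (ginv w)\<bar>)"
  proof (rule sum.reindex_bij_witness[where i = g and j = f])
    fix b assume b: "b \<in> nonmult"
    then have np: "b \<in> pos" "- b \<notin> pos" using nonmult_pos pos_not_neg by blast+
    show "g (f b) = b" using np by (auto simp: f_def g_def weyl_inv_apply[OF u] weyl_neg[OF u])
    show "f (g b) = b" using np by (auto simp: f_def g_def weyl_inv_apply[OF u] weyl_neg[OF weyl_inv[OF u]])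
  qed (use fn gn in auto)
  finally show ?thesis by (simp add: sep_count_def)
qed

lemma sep_count_zero_stab: assumes "w \<in> EW" "sep_count w = 0" shows "w \<in> Stab"
proof -
  have 1: "w ` A0 \<subseteq> A0" using strip_zero_maps sep_count_zero_strip assms by blast
  have "sep_count (ginv w) = 0" using sep_count_inverse assms by simp
  then have "ginv w ` A0 \<subseteq> A0" using strip_zero_maps sep_count_zero_strip ext_inv assms by blast
  then have "w ` (ginv w ` A0) \<subseteq> w ` A0" by blast
  moreover have "w ` (ginv w ` A0) = A0"
    using ext_bij[OF assms(1)] by (simp add: image_f_inv_f bij_is_surj)
  ultimately show ?thesis using 1 assms by (auto simp: alcove_stab_def)
qed

text \<open>
  If no crossing out of \<open>w A0\<close> brought it nearer to \<open>A0\<close>, then \<open>z = w\<^sup>-\<^sup>1 p0\<close> would be on the inner side of all walls of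
  \<open>A0\<close>. As every positive root is a sum of simple roots and below the highest root, \<open>z\<close> would be in the interior of \<open>A0\<close>,
  and no hyperplane would separate \<open>w A0\<close> from \<open>A0\<close>.
\<close>

lemma sep_count_descent:
  assumes w: "w \<in> EW" and "sep_count w \<noteq> 0"
  shows "\<exists>i\<in>{0..DIM('a)}. sep_count (w \<circ> s i) + 1 = sep_count w"
proof (rule ccontr)
  assume no: "\<not> ?thesis"
  note u = lin_weyl[OF w]
  \<comment> \<open>The nonmultipliable root of the wall is the direction or its double; both have strip numbers of the same kind.\<close>
  have wall: "if lin w (aroot i) \<in> pos then strip (lin w (aroot i)) w \<le> 0 else 0 \<le> strip (- lin w (aroot i)) w"
    if i: "i \<in> {0..DIM('a)}" for i
  proof -
    define c where "c = lin w (aroot i)"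
    define e where "e = (if c \<in> pos then c else - c)"
    have cR: "c \<in> \<Phi>" using wall_root w i by (simp add: c_def)
    then have eR: "e \<in> \<Phi>" using neg_root by (simp add: e_def)
    obtain b where b: "b \<in> nonmult" "b = e \<or> b = 2 *\<^sub>R e"
      and N: "int (sep_count (w \<circ> s i)) = int (sep_count w) - \<bar>strip b w\<bar> + \<bar>strip b w + (if c \<in> pos then - 1 else 1)\<bar>"
      using sep_count_crossing[OF w i] unfolding c_def e_def by blast
    have n: "sep_count (w \<circ> s i) + 1 \<noteq> sep_count w" using no i by blast
    have Ks: "if c \<in> pos then strip b w \<le> 0 else 0 \<le> strip b w" using N n by (auto split: if_splits)
    have eq: "of_int (strip e w) < w p0 \<bullet> e" "w p0 \<bullet> e < of_int (strip e w) + 1"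
      "of_int (strip b w) < w p0 \<bullet> b" "w p0 \<bullet> b < of_int (strip b w) + 1"
      using strip_strict[OF w eR] strip_strict[OF w nonmult_root[OF b(1)]] by auto
    have "if c \<in> pos then strip e w \<le> 0 else 0 \<le> strip e w"
    proof (cases "b = e")
      case False
      then have be: "w p0 \<bullet> b = 2 * (w p0 \<bullet> e)" using b by simp
      show ?thesis
      proof (cases "c \<in> pos")
        case True
        then have "real_of_int (strip b w) \<le> 0" using Ks by simp
        then have "real_of_int (strip e w) < 1" using eq be by linarith
        then show ?thesis using True by simp
      next
        case False
        then have "0 \<le> real_of_int (strip b w)" using Ks by simp
        then have "- 1 < real_of_int (strip e w)" using eq be by linarith
        then show ?thesis using False by simp
      qed
    qed (use Ks in \<open>auto split: if_splits\<close>)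
    then show ?thesis by (simp add: e_def c_def split: if_splits)
  qed
  define z where "z = ginv (lin w) (p0 - wgt w)"
  have zdot: "z \<bullet> a = p0 \<bullet> lin w a - wgt w \<bullet> lin w a" for a
    using weyl_adjoint[OF weyl_inv[OF u]] by (simp add: z_def ginv_ginv[OF u] inner_diff_left)
  \<comment> \<open>The inner side of the wall of \<open>s i\<close>: for \<open>i = 0\<close> the root is \<open>- phi\<close>, and the bound - 1 says that \<open>z\<close> pairs with \<open>phi\<close> to less than 1.\<close>
  have key: "(if aroot i \<in> pos then 0 else - 1) < z \<bullet> aroot i" if i: "i \<in> {0..DIM('a)}" for i
  proof -
    define c where "c = lin w (aroot i)"
    have cR: "c \<in> \<Phi>" using wall_root w i by (simp add: c_def)
    define k where "k = \<lfloor>wgt w \<bullet> c\<rfloor>"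
    have Kc: "strip c w = k + (if aroot i \<in> pos then 0 else - 1)"
      using strip_formula[OF w cR] weyl_inv_apply(2)[OF u] by (simp add: c_def k_def)
    have f: "wgt w \<bullet> c = of_int k" using lattice_root_floor[OF wt_lattice[OF w] cR] unfolding k_def by (rule sym)
    have zc: "z \<bullet> aroot i = p0 \<bullet> c - wgt w \<bullet> c" using zdot by (simp add: c_def)
    show ?thesis
    proof (cases "c \<in> pos")
      case True
      then have "strip c w \<le> 0" using wall[OF i] by (simp add: c_def)
      then have "k \<le> (if aroot i \<in> pos then 0 else 1)" using Kc by (simp split: if_splits)
      then have "wgt w \<bullet> c \<le> (if aroot i \<in> pos then 0 else 1)" unfolding f by (simp split: if_splits)
      then show ?thesis using p0_pos[OF True] zc by (simp split: if_splits)
    next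
      case False
      then have "0 \<le> strip (- c) w" using wall[OF i] by (simp add: c_def)
      then have "k \<le> (if aroot i \<in> pos then - 1 else 0)"
        using Kc strip_neg[OF w cR] by (simp split: if_splits)
      then have "wgt w \<bullet> c \<le> (if aroot i \<in> pos then - 1 else 0)" unfolding f by (simp split: if_splits)
      moreover have "- 1 < p0 \<bullet> c" using False pos_or_neg[OF cR] p0_pos[of "- c"] by auto
      ultimately show ?thesis using zc by (simp split: if_splits)
    qed
  qed
  have z_simple: "0 < z \<bullet> \<alpha> i" if "i \<in> I" for i
    using key[of i] that index0_iff simple_pos[OF that] by (simp add: aroot_simple)
  have z_phi: "z \<bullet> phi < 1"
    using key[of 0] index0_iff pos_not_neg[OF phi_pos] by (simp add: aroot_zero)
  have z_pos: "0 < z \<bullet> b \<and> z \<bullet> b < 1" if b: "b \<in> pos" for b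
  proof
    have bR: "b \<in> \<Phi>" using b by (simp add: pos_def)
    have "0 < (\<Sum>i\<in>I. (om i \<bullet> b) * (\<alpha> i \<bullet> z))"
    proof (rule sum_pos_witness)
      show "\<forall>i\<in>I. 0 \<le> (om i \<bullet> b) * (\<alpha> i \<bullet> z)"
        using pos_coord[OF b] z_simple by (simp add: inner_commute[of _ z] less_imp_le)
      have "\<exists>i\<in>I. om i \<bullet> b \<noteq> 0" using coords_eq[of b 0] bR zero_not_root by auto
      then show "\<exists>i\<in>I. (om i \<bullet> b) * (\<alpha> i \<bullet> z) \<noteq> 0"
        using z_simple by (fastforce simp: inner_commute[of _ z])
    qed simp
    then show "0 < z \<bullet> b" using dot_expansion[of b z] by (simp add: inner_commute)
    have "0 \<le> (\<Sum>i\<in>I. (om i \<bullet> (phi - b)) * (\<alpha> i \<bullet> z))"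
      using phi_top[OF bR] z_simple
      by (intro sum_nonneg mult_nonneg_nonneg) (auto simp: inner_diff_right inner_commute[of _ z] less_imp_le)
    then have "0 \<le> (phi - b) \<bullet> z" using dot_expansion[of "phi - b" z] by simp
    then show "z \<bullet> b < 1" using z_phi by (simp add: inner_diff_right inner_commute[of _ z])
  qed
  have "strip b w = 0" if b: "b \<in> pos" for b
  proof -
    have bR: "b \<in> \<Phi>" using b by (simp add: pos_def)
    define c where "c = ginv (lin w) b"
    have cR: "c \<in> \<Phi>" using ginv_root[OF w bR] by (simp add: c_def)
    have zc: "z \<bullet> c = p0 \<bullet> b - wgt w \<bullet> b" using zdot[of c] weyl_inv_apply(1)[OF u] by (simp add: c_def)
    define k where "k = \<lfloor>wgt w \<bullet> b\<rfloor>"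
    have f: "wgt w \<bullet> b = of_int k" using lattice_root_floor[OF wt_lattice[OF w] bR] unfolding k_def by (rule sym)
    have pb: "0 < p0 \<bullet> b" "p0 \<bullet> b < 1" using p0_pos[OF b] by auto
    show ?thesis
    proof (cases "c \<in> pos")
      case True
      then have "0 < z \<bullet> c" "z \<bullet> c < 1" using z_pos by auto
      then have "- 1 < real_of_int k" "real_of_int k < 1" using zc pb f by linarith+
      then have "k = 0" by linarith
      then show ?thesis using strip_formula[OF w bR] True by (simp add: c_def k_def)
    next
      case False
      then have "- c \<in> pos" using pos_or_neg cR by blast
      then have "- 1 < z \<bullet> c" "z \<bullet> c < 0" using z_pos[of "- c"] by auto
      then have "0 < real_of_int k" "real_of_int k < 2" using zc pb f by linarith+
      then have "k = 1" by linarith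
      then show ?thesis using strip_formula[OF w bR] False by (simp add: c_def k_def)
    qed
  qed
  then have "sep_count w = 0" by (simp add: sep_count_def nonmult_pos)
  then show False using assms by simp
qed

lemma word_ext: "set is \<subseteq> {0..DIM('a)} \<Longrightarrow> wmap is \<in> EW"
proof (induction "is")
  case Nil then show ?case using weyl_ext(1)[OF weyl_id] by (simp add: id_def)
next
  case (Cons i "is") then show ?case unfolding wmap_Cons by (intro ext_comp_mem s_ext) auto
qed

lemma sep_count_word: "set is \<subseteq> {0..DIM('a)} \<Longrightarrow> sep_count (wmap is) \<le> length is"
proof (induction "is" rule: rev_induct)
  case Nil then show ?case using sep_count_id by (simp add: id_def)
next
  case (snoc i "is")
  have "wmap (is @ [i]) = wmap is \<circ> s i" by (simp only: wmap_append wmap_Cons wmap_Nil comp_id)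
  moreover have "sep_count (wmap is \<circ> s i) \<le> sep_count (wmap is) + 1"
    using snoc(2) by (intro sep_count_crossing_le word_ext) auto
  moreover have "sep_count (wmap is) \<le> length is" using snoc by simp
  ultimately show ?case by (simp only: length_append list.size add_0_left)

qed

text \<open>
  Induction on the count, with a descent for the inverse so that the new letter is prepended to the word and the element
  of the stabiliser stays at its end.
\<close>

lemma word_exists:
  assumes "w \<in> EW"
  shows "\<exists>is \<sigma>. set is \<subseteq> {0..DIM('a)} \<and> length is = sep_count w \<and> \<sigma> \<in> Stab \<and> w = wmap is \<circ> \<sigma>"
  using assms
proof (induction "sep_count w" arbitrary: w)
  case 0
  then have "w \<in> Stab" using sep_count_zero_stab by simp
  then show ?case using 0 by (intro exI[of _ "[]"] exI[of _ w]) (simp only: wmap_Nil id_comp, simp)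
next
  case (Suc n)
  have iw: "ginv w \<in> EW" using ext_inv Suc by blast
  have "sep_count (ginv w) \<noteq> 0" using sep_count_inverse[OF Suc(3)] Suc(2) by simp
  then obtain i where i: "i \<in> {0..DIM('a)}" "sep_count (ginv w \<circ> s i) + 1 = sep_count (ginv w)"
    using sep_count_descent[OF iw] by blast
  have si: "s i \<in> EW" "ginv (s i) = s i" using s_ext i s_invol inv_unique_comp by blast+
  have "ginv (ginv w \<circ> s i) = s i \<circ> w"
    using o_inv_distrib[of "ginv w" "s i"] ext_bij[OF iw] ext_bij[OF si(1)] si(2)
      inv_inv_eq[OF ext_bij] Suc(3) by simp
  then have "sep_count (s i \<circ> w) = sep_count (ginv w \<circ> s i)"
    using sep_count_inverse[OF ext_comp_mem[OF iw si(1)]] by simp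
  then have n: "n = sep_count (s i \<circ> w)" using i sep_count_inverse[OF Suc(3)] Suc(2) by simp
  then obtain "is" \<sigma> where "is": "set is \<subseteq> {0..DIM('a)}" "length is = n" "\<sigma> \<in> Stab" "s i \<circ> w = wmap is \<circ> \<sigma>"
    using Suc(1)[OF n] ext_comp_mem si(1) Suc(3) by blast
  have "s i \<circ> (s i \<circ> w) = (s i \<circ> s i) \<circ> w" by (simp only: comp_assoc)
  then have "w = s i \<circ> (s i \<circ> w)" using s_invol[OF i(1)] by (simp only: id_comp)
  then have "w = wmap (i # is) \<circ> \<sigma>" by (simp only: "is"(4) wmap_Cons comp_assoc)
  then show ?case using "is" i Suc(2) by (intro exI[of _ "i # is"] exI[of _ \<sigma>]) auto
qed

text \<open>
  A letter changes the count by at most one, and descents reach the bound.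
\<close>

lemma len_eq: assumes "w \<in> EW" shows "len \<Phi> \<alpha> w = sep_count w"
  unfolding len_def
proof (rule Least_equality)
  show "\<exists>is \<sigma>. set is \<subseteq> {0..DIM('a)} \<and> length is = sep_count w \<and> \<sigma> \<in> Stab \<and> w = wmap is \<circ> \<sigma>"
    using word_exists[OF assms] .
  fix k assume "\<exists>is \<sigma>. set is \<subseteq> {0..DIM('a)} \<and> length is = k \<and> \<sigma> \<in> Stab \<and> w = wmap is \<circ> \<sigma>"
  then obtain "is" \<sigma> where "is": "set is \<subseteq> {0..DIM('a)}" "length is = k" "\<sigma> \<in> Stab" "w = wmap is \<circ> \<sigma>" by blast
  then show "sep_count w \<le> k" using sep_count_stab[OF word_ext] sep_count_word by metis
qed

lemma len_stab: "w \<in> EW \<Longrightarrow> \<sigma> \<in> Stab \<Longrightarrow> len \<Phi> \<alpha> (w \<circ> \<sigma>) = len \<Phi> \<alpha> w"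
  and len_stab_zero: "\<sigma> \<in> Stab \<Longrightarrow> len \<Phi> \<alpha> \<sigma> = 0"
  using sep_count_stab[of w \<sigma>] sep_count_stab[OF weyl_ext(1)[OF weyl_id], of \<sigma>] sep_count_id len_eq
    ext_comp_mem[OF _ stab_ext, of w \<sigma>] stab_ext[of \<sigma>] by auto

lemma len_s: assumes "i \<in> {0..DIM('a)}" shows "len \<Phi> \<alpha> (s i) = 1"
proof -
  have "\<exists>b\<in>nonmult. int (sep_count (id \<circ> s i)) = int (sep_count id) - \<bar>strip b id\<bar> + \<bar>strip b id + (if lin id (aroot i) \<in> pos then - 1 else 1)\<bar>"
    using sep_count_crossing[OF weyl_ext(1)[OF weyl_id] assms] by blast
  then obtain b where "b \<in> nonmult" "int (sep_count (s i)) = \<bar>(if lin id (aroot i) \<in> pos then - 1 else 1)\<bar>"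
    using sep_count_id strip_id[OF nonmult_root] nonmult_pos by fastforce
  then show ?thesis using len_eq[OF s_ext(1)[OF assms]] by (simp split: if_splits)
qed

text \<open>
  In the dominant chamber all strip numbers are nonnegative, so a hyperplane is added exactly by the positive crossings.
\<close>

lemma len_dominant_crossing:
  assumes w: "w \<in> EW" and i: "i \<in> {0..DIM('a)}" and dom: "\<And>b. b \<in> pos \<Longrightarrow> 1 \<le> strip b w"
  shows "lin w (aroot i) \<in> pos \<Longrightarrow> len \<Phi> \<alpha> (w \<circ> s i) + 1 = len \<Phi> \<alpha> w"
    and "lin w (aroot i) \<notin> pos \<Longrightarrow> len \<Phi> \<alpha> (w \<circ> s i) = len \<Phi> \<alpha> w + 1"
proof -
  obtain b where b: "b \<in> nonmult"
    and N: "int (sep_count (w \<circ> s i)) = int (sep_count w) - \<bar>strip b w\<bar> + \<bar>strip b w + (if lin w (aroot i) \<in> pos then - 1 else 1)\<bar>"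
    using sep_count_crossing[OF w i] by blast
  have l: "len \<Phi> \<alpha> (w \<circ> s i) = sep_count (w \<circ> s i)" "len \<Phi> \<alpha> w = sep_count w"
    using len_eq ext_comp_mem[OF w s_ext(1)[OF i]] w by blast+
  have "1 \<le> strip b w" using dom nonmult_pos b by blast
  then show "lin w (aroot i) \<in> pos \<Longrightarrow> len \<Phi> \<alpha> (w \<circ> s i) + 1 = len \<Phi> \<alpha> w"
    "lin w (aroot i) \<notin> pos \<Longrightarrow> len \<Phi> \<alpha> (w \<circ> s i) = len \<Phi> \<alpha> w + 1"
    unfolding l using N by simp_all
qed

text \<open>
  The crossing of the inverse \<open>u\<^sup>-\<^sup>1\<close> by \<open>s j\<close> removes the hyperplane through 0 that is orthogonal to \<open>u\<^sup>-\<^sup>1 (\<alpha> j)\<close>.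
\<close>

lemma len_left_descent:
  assumes u: "u \<in> W0" and j: "j \<in> I" and n: "ginv u (\<alpha> j) \<notin> pos"
  shows "len \<Phi> \<alpha> (s j \<circ> u) < len \<Phi> \<alpha> u"
proof -
  have uE: "u \<in> EW" and iu: "ginv u \<in> EW" "lin (ginv u) = ginv u" "wgt (ginv u) = 0"
    using weyl_ext u weyl_inv by blast+
  have j0: "j \<in> {0..DIM('a)}" using j index0_iff by blast
  define c where "c = ginv u (\<alpha> j)"
  have cl: "c = lin (ginv u) (aroot j)" using iu j by (simp add: c_def aroot_simple)
  obtain b where b: "b \<in> nonmult" "b = - c \<or> b = 2 *\<^sub>R - c"
    and N: "int (sep_count (ginv u \<circ> s j)) = int (sep_count (ginv u)) - \<bar>strip b (ginv u)\<bar> + \<bar>strip b (ginv u) + 1\<bar>"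
    using sep_count_crossing[OF iu(1) j0] n unfolding cl[symmetric] by (auto simp: c_def)
  have "ginv (ginv u) b = - \<alpha> j \<or> ginv (ginv u) b = 2 *\<^sub>R - \<alpha> j"
    using b(2) weyl_neg[OF u] weyl_scale[OF u] weyl_inv_apply(1)[OF u] by (auto simp: ginv_ginv[OF u] c_def)
  then have "ginv (ginv u) b \<notin> pos" using simple_pos[OF j] by (auto simp: pos_def)
  then have "strip b (ginv u) = - 1" using strip_formula[OF iu(1) nonmult_root[OF b(1)]] iu by simp
  then have d: "sep_count (ginv u \<circ> s j) < sep_count (ginv u)" using N by simp
  have sj: "s j \<in> EW" "ginv (s j) = s j" using s_ext j0 s_invol inv_unique_comp by blast+
  have "ginv (ginv u \<circ> s j) = s j \<circ> u"
    using o_inv_distrib[of "ginv u" "s j"] ext_bij[OF iu(1)] ext_bij[OF sj(1)] sj(2) ginv_ginv[OF u] by simp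
  then have "sep_count (s j \<circ> u) = sep_count (ginv u \<circ> s j)"
    using sep_count_inverse[OF ext_comp_mem[OF iu(1) sj(1)]] by simp
  then show ?thesis using d sep_count_inverse[OF uE] len_eq[OF uE] len_eq[OF ext_comp_mem[OF sj(1) uE]] by simp
qed


section \<open>Minimal coset representatives\<close>

text \<open>
  Reading the word from the right, the root becomes negative at some letter \<open>k\<close>, which makes only multiples of \<open>\<alpha> k\<close> negative.
\<close>

lemma word_sign_change:
  assumes "set js \<subseteq> I" "b \<in> pos" "wmap js b \<notin> pos"
  shows "\<exists>ks k ls. js = ks @ k # ls \<and> (wmap ls b = \<alpha> k \<or> wmap ls b = 2 *\<^sub>R \<alpha> k)"
  using assms
proof (induction js)
  case (Cons k js)
  show ?case
  proof (cases "wmap js b \<in> pos")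
    case True
    have k: "k \<in> I" using Cons by simp
    have "refl (\<alpha> k) 0 (wmap js b) \<notin> pos" using Cons(4) by (simp add: s_simple[OF k])
    then have "wmap js b = \<alpha> k \<or> wmap js b = 2 *\<^sub>R \<alpha> k" using refl_simple_pos True k by blast
    then show ?thesis by (intro exI[of _ "[]"] exI[of _ k] exI[of _ js]) simp
  next
    case False
    then obtain ks k' ls where "js = ks @ k' # ls" "wmap ls b = \<alpha> k' \<or> wmap ls b = 2 *\<^sub>R \<alpha> k'"
      using Cons by auto
    then show ?thesis by (intro exI[of _ "k # ks"] exI[of _ k'] exI[of _ ls]) simp
  qed
qed simp

lemma weyl_word: "set is \<subseteq> I \<Longrightarrow> wmap is \<in> W0"
  unfolding weyl_I parabolic_def by blast

text \<open>
  In a shortest word for \<open>u\<close> the last letter \<open>j\<close> makes \<open>\<alpha> j\<close> negative, so the rest of the word has to change the sign of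
  \<open>\<alpha> j\<close>. The letter where it does is conjugate to \<open>s j\<close> by the letters between, so both can be deleted.
\<close>

lemma weyl_pos_id:
  assumes u: "u \<in> W0" and p: "\<And>b. b \<in> pos \<Longrightarrow> u b \<in> pos" shows "u = id"
proof -
  let ?Q = "\<lambda>is. set is \<subseteq> I \<and> wmap is = u"
  have "\<exists>is. ?Q is" using u unfolding weyl_I parabolic_def by blast
  then obtain "is" where "is": "?Q is" and min: "\<And>js. ?Q js \<Longrightarrow> length is \<le> length js"
    using ex_has_least_nat[of ?Q _ length] by blast
  show ?thesis
  proof (cases "is" rule: rev_cases)
    case Nil then show ?thesis using "is" by simp
  next
    case (snoc js j)
    have j: "j \<in> I" and js: "set js \<subseteq> I" using "is" snoc by auto
    have ue: "u = wmap js \<circ> s j" using "is" snoc by (simp only: wmap_append wmap_Cons wmap_Nil comp_id)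
    have "u (\<alpha> j) = wmap js (- \<alpha> j)"
      using refl_self[OF simple_root[OF j]] by (simp add: ue s_simple[OF j])
    then have "- wmap js (\<alpha> j) \<in> pos" using p[OF simple_pos[OF j]] weyl_neg[OF weyl_word[OF js]] by simp
    then have "wmap js (\<alpha> j) \<notin> pos" using pos_not_neg by force
    then obtain ks k ls where w: "js = ks @ k # ls" "wmap ls (\<alpha> j) = \<alpha> k \<or> wmap ls (\<alpha> j) = 2 *\<^sub>R \<alpha> k"
      using word_sign_change[OF js simple_pos[OF j]] by blast
    have k: "k \<in> I" and ls: "set ls \<subseteq> I" and ks: "set ks \<subseteq> I" using js w by auto
    have "s k = refl (wmap ls (\<alpha> j)) 0"
      using w(2) refl_scale[of 2 "\<alpha> k"] by (auto simp: s_simple[OF k])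
    then have sk: "s k (wmap ls x) = wmap ls (s j x)" for x
      using weyl_refl_conj[OF weyl_word[OF ls]] by (simp add: s_simple[OF j])
    have ss: "s j (s j x) = x" for x
      using refl_refl[OF simple_root[OF j]] by (simp add: s_simple[OF j])
    have "u x = wmap (ks @ ls) x" for x
      using sk ss by (simp add: ue w(1) wmap_append)
    then have "?Q (ks @ ls)" using ks ls by auto
    then have "length is \<le> length (ks @ ls)" by (rule min)
    then show ?thesis using snoc w by simp
  qed
qed

abbreviation MR :: "nat set \<Rightarrow> ('a \<Rightarrow> 'a) set" where "MR \<equiv> min_reps \<Phi> \<alpha>"
abbreviation theta :: "nat set \<Rightarrow> ('a \<Rightarrow> 'a) \<Rightarrow> 'a \<Rightarrow> 'a" where "theta \<equiv> theta_up_J \<Phi> \<alpha>"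
abbreviation QJ :: "nat set \<Rightarrow> 'a set" where "QJ \<equiv> coroot_lattice_J \<Phi> \<alpha>"

lemma min_rep_weyl: "u \<in> MR J \<Longrightarrow> u \<in> W0"
  by (simp add: min_reps_def)

text \<open>
  Minimality gives this for the simple roots of \<open>J\<close>, and \<open>b\<close> is a nonnegative combination of these.
\<close>

lemma min_rep_pos:
  assumes J: "J \<subseteq> I" and u: "u \<in> MR J" and b: "b \<in> RJ J" "b \<in> pos"
  shows "ginv u b \<in> pos"
proof -
  note uW = min_rep_weyl[OF u]
  have sp: "ginv u (\<alpha> j) \<in> pos" if j: "j \<in> J" for j
  proof (rule ccontr)
    assume "ginv u (\<alpha> j) \<notin> pos"
    then have "len \<Phi> \<alpha> (s j \<circ> u) < len \<Phi> \<alpha> u" using len_left_descent[OF uW] j J by blast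
    moreover have "len \<Phi> \<alpha> u \<le> len \<Phi> \<alpha> (s j \<circ> u)"
      using u parabolic_gen[OF j] unfolding min_reps_def by blast
    ultimately show False by simp
  qed
  have bR: "b \<in> \<Phi>" using b RJ_root by blast
  have gR: "ginv u b \<in> \<Phi>" using weyl_root weyl_inv uW bR by blast
  have "rho \<bullet> ginv u b = b \<bullet> u rho"
    using weyl_adjoint[OF uW, of rho b] by (simp add: inner_commute)
  also have "\<dots> = (\<Sum>i\<in>I. (om i \<bullet> b) * (\<alpha> i \<bullet> u rho))" by (rule dot_expansion)
  also have "0 \<le> \<dots>"
  proof (rule sum_nonneg)
    fix i assume i: "i \<in> I"
    show "0 \<le> (om i \<bullet> b) * (\<alpha> i \<bullet> u rho)"
    proof (cases "i \<in> J")
      case True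
      have "\<alpha> i \<bullet> u rho = rho \<bullet> ginv u (\<alpha> i)" using weyl_adjoint[OF uW, of rho "\<alpha> i"] by (simp add: inner_commute)
      then show ?thesis using sp[OF True] pos_coord[OF b(2) i] by (simp add: pos_def)
    next
      case False then show ?thesis using b(1) i RJ_iff[OF J, of b] by auto
    qed
  qed
  finally show ?thesis using gR root_rho_nz[OF gR] by (simp add: pos_def)
qed

lemma min_rep_exists:
  assumes J: "J \<subseteq> I" and x: "x \<in> W0" shows "\<exists>v\<in>WJ J. \<exists>u\<in>MR J. x = v \<circ> u"
proof -
  let ?Q = "\<lambda>y. \<exists>v\<in>WJ J. y = v \<circ> x"
  have "?Q x" using parabolic_id by (intro bexI[of _ id]) auto
  then obtain u where u: "?Q u" and min: "\<And>y. ?Q y \<Longrightarrow> len \<Phi> \<alpha> u \<le> len \<Phi> \<alpha> y"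
    using ex_has_least_nat[of ?Q x "len \<Phi> \<alpha>"] by blast
  obtain v where v: "v \<in> WJ J" "u = v \<circ> x" using u by blast
  have "u \<in> W0" unfolding v(2) using weyl_comp parabolic_weyl[OF J] v x by blast
  moreover have "len \<Phi> \<alpha> u \<le> len \<Phi> \<alpha> (y \<circ> u)" if "y \<in> WJ J" for y
  proof -
    have "y \<circ> u = (y \<circ> v) \<circ> x" by (simp only: v(2) comp_assoc)
    then have "?Q (y \<circ> u)" using parabolic_comp[OF that v(1)] by blast
    then show ?thesis by (rule min)
  qed
  ultimately have "u \<in> MR J" unfolding min_reps_def by blast
  moreover have "x = ginv v \<circ> u"
    using weyl_inv_apply(2)[OF parabolic_weyl[OF J v(1)]] v(2) by (simp add: fun_eq_iff)
  ultimately show ?thesis using parabolic_inv[OF J v(1)] by blast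
qed

text \<open>
  If \<open>v u\<close> and \<open>u\<close> are both minimal, then \<open>v\<^sup>-\<^sup>1\<close> keeps the positive roots of \<open>\<Phi>\<^sub>J\<close> positive, and it always keeps the other ones
  positive, so it is the identity.
\<close>

lemma min_rep_unique:
  assumes J: "J \<subseteq> I" and u: "u \<in> MR J" "u' \<in> MR J" and v: "v \<in> WJ J" and e: "u' = v \<circ> u"
  shows "u' = u"
proof -
  note vW = parabolic_weyl[OF J v] and uW = min_rep_weyl[OF u(1)]
  have "ginv v b \<in> pos" if b: "b \<in> pos" for b
  proof (cases "b \<in> RJ J")
    case True
    have iv: "ginv v \<in> WJ J" using parabolic_inv[OF J v] by blast
    have r: "ginv v b \<in> RJ J" using parabolic_preserves_RJ[OF J iv True] .
    show ?thesis
    proof (rule ccontr)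
      assume "ginv v b \<notin> pos"
      then have "- ginv v b \<in> pos" using pos_or_neg RJ_root r by blast
      then have "ginv u (- ginv v b) \<in> pos" using min_rep_pos[OF J u(1)] RJ_neg r by blast
      then have "- ginv u (ginv v b) \<in> pos" using weyl_neg[OF weyl_inv[OF uW]] by simp
      moreover have "ginv u' b = ginv u (ginv v b)" using inv_weyl_comp[OF vW uW] e by simp
      moreover have "ginv u' b \<in> pos" using min_rep_pos[OF J u(2) True b] .
      ultimately show False using pos_not_neg by fastforce
    qed
  next
    case False
    then show ?thesis using parabolic_preserves_outside_pos[OF J] parabolic_inv[OF J v] b by blast
  qed
  then have "ginv v = id" using weyl_pos_id weyl_inv vW by blast
  then have "v = id" using weyl_inv_apply(1)[OF vW] by (auto simp: fun_eq_iff)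
  then show ?thesis using e by simp
qed

lemma theta_eq:
  assumes J: "J \<subseteq> I" and u: "u \<in> MR J" and v: "v \<in> WJ J" and e: "lin w = v \<circ> u"
  shows "theta J w = u"
  unfolding theta_up_J_def
proof (rule the_equality)
  show "u \<in> MR J \<and> (\<exists>v\<in>WJ J. lin w = v \<circ> u)" using u v e by blast
  fix u' assume "u' \<in> MR J \<and> (\<exists>v\<in>WJ J. lin w = v \<circ> u')"
  then obtain v' where u': "u' \<in> MR J" "v' \<in> WJ J" "lin w = v' \<circ> u'" by blast
  have v'W: "v' \<in> W0" using parabolic_weyl[OF J u'(2)] .
  have "v' (u' x) = v (u x)" for x using e u'(3) by (auto simp: fun_eq_iff)
  then have "u' x = (ginv v' \<circ> v) (u x)" for x using weyl_inv_apply(2)[OF v'W] by (metis comp_apply)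
  then have "u' = (ginv v' \<circ> v) \<circ> u" by (auto simp: fun_eq_iff)
  moreover have "ginv v' \<circ> v \<in> WJ J" using parabolic_comp parabolic_inv[OF J u'(2)] v by blast
  ultimately show "u' = u" using min_rep_unique[OF J u u'(1)] by blast
qed

lemma theta_decomp:
  assumes J: "J \<subseteq> I" and w: "w \<in> EW"
  shows "\<exists>y\<in>WJ J. lin w = y \<circ> theta J w" "theta J w \<in> MR J"
proof -
  obtain v u where "v \<in> WJ J" "u \<in> MR J" "lin w = v \<circ> u" using min_rep_exists[OF J lin_weyl[OF w]] by blast
  moreover from this have "theta J w = u" using theta_eq[OF J] by blast
  ultimately show "\<exists>y\<in>WJ J. lin w = y \<circ> theta J w" "theta J w \<in> MR J" by blast+
qed

lemma strip_min_rep: "J \<subseteq> I \<Longrightarrow> u \<in> MR J \<Longrightarrow> b \<in> RJ J \<Longrightarrow> b \<in> pos \<Longrightarrow> strip b u = 0"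
  using strip_formula[OF weyl_ext(1)[OF min_rep_weyl] RJ_root] min_rep_pos weyl_ext[OF min_rep_weyl] by simp

subsection \<open>The coroot lattice of a parabolic subsystem\<close>

lemma finite_RJ [simp]: "finite (RJ J)"
  using finite_roots by (simp add: roots_J_def)

lemma QJ_zero: "0 \<in> QJ J"
  unfolding coroot_lattice_J_def mem_Collect_eq by (rule exI[of _ "\<lambda>_. 0"]) simp

lemma QJ_add: assumes "x \<in> QJ J" "y \<in> QJ J" shows "x + y \<in> QJ J"
proof -
  obtain c d where "x = (\<Sum>a\<in>RJ J. of_int (c a) *\<^sub>R coroot a)" "y = (\<Sum>a\<in>RJ J. of_int (d a) *\<^sub>R coroot a)"
    using assms unfolding coroot_lattice_J_def by blast
  then have "x + y = (\<Sum>a\<in>RJ J. of_int (c a + d a) *\<^sub>R coroot a)"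
    by (simp add: sum.distrib scaleR_left_distrib)
  then show ?thesis unfolding coroot_lattice_J_def mem_Collect_eq by (intro exI[of _ "\<lambda>a. c a + d a"]) simp
qed

lemma QJ_scale_coroot: assumes "b \<in> RJ J" shows "of_int k *\<^sub>R coroot b \<in> QJ J"
proof -
  have "(\<Sum>a\<in>RJ J. of_int (if a = b then k else 0) *\<^sub>R coroot a) = (\<Sum>a\<in>RJ J. if a = b then of_int k *\<^sub>R coroot a else 0)"
    by (rule sum.cong) auto
  then have "of_int k *\<^sub>R coroot b = (\<Sum>a\<in>RJ J. of_int (if a = b then k else 0) *\<^sub>R coroot a)"
    using assms by simp
  then show ?thesis unfolding coroot_lattice_J_def mem_Collect_eq
    by (intro exI[of _ "\<lambda>a. if a = b then k else 0"]) simp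
qed

lemma QJ_coroot: "b \<in> RJ J \<Longrightarrow> coroot b \<in> QJ J"
  using QJ_scale_coroot[of b J 1] by simp

lemma QJ_lattice: "x \<in> QJ J \<Longrightarrow> x \<in> P"
proof -
  have "(\<Sum>a\<in>A. of_int (c a) *\<^sub>R coroot a) \<in> P" if "A \<subseteq> RJ J" for c A
  proof -
    have "finite A" using that finite_RJ finite_subset by blast
    then show ?thesis using that
      by (induction A) (auto intro!: lattice_zero lattice_add lattice_scale coroot_lattice RJ_root)
  qed
  then show "x \<in> QJ J \<Longrightarrow> x \<in> P" unfolding coroot_lattice_J_def by blast
qed

text \<open>A reflection moves a coweight by an integral multiple of the coroot.\<close>

lemma parabolic_moves_by_QJ:
  assumes J: "J \<subseteq> I" and x: "x \<in> P" and y: "y \<in> WJ J" shows "y x - x \<in> QJ J"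
  using y
proof (induction rule: parabolic_induct)
  case id then show ?case by (simp add: QJ_zero)
next
  case (gen j u)
  have j: "j \<in> I" using gen J by blast
  define z where "z = u x"
  have zP: "z \<in> P" using lattice_weyl x parabolic_weyl[OF J gen(2)] by (simp add: z_def)
  obtain k where k: "z \<bullet> \<alpha> j = of_int k" using lattice_root_int[OF zP simple_root[OF j]] by (auto elim: Ints_cases)
  have "s j z = z + of_int (- k) *\<^sub>R coroot (\<alpha> j)"
    by (simp add: s_simple[OF j] refl_def k)
  then have "(s j \<circ> u) x - x = (u x - x) + of_int (- k) *\<^sub>R coroot (\<alpha> j)"
    by (simp add: z_def)
  then show ?case using gen QJ_add QJ_scale_coroot[OF RJ_simple[OF J gen(1)]] by metis
qed

text \<open>
  Writing \<open>w\<close> as a translation times \<open>y u\<close> with \<open>y\<close> in \<open>W\<^sub>J\<close> and \<open>u\<close> minimal, only \<open>y\<close> distinguishes \<open>w x\<close> from a translate of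
  \<open>u x\<close>. It does not affect the minimal representative, and it moves the weight within a coset of the coroot lattice.
\<close>

lemma theta_wt_comp:
  assumes J: "J \<subseteq> I" and w: "w \<in> EW" and v: "v \<in> EW"
  shows "theta J (w \<circ> v) = theta J (theta J w \<circ> v)"
    and "\<exists>g\<in>QJ J. wgt (w \<circ> v) = wgt w + wgt (theta J w \<circ> v) + g"
proof -
  define u where "u = theta J w"
  obtain y where y: "y \<in> WJ J" "lin w = y \<circ> u" and u: "u \<in> MR J"
    using theta_decomp[OF J w] unfolding u_def by blast
  have uE: "u \<in> EW" "lin u = u" "wgt u = 0" using weyl_ext min_rep_weyl u by blast+
  obtain y' where y': "y' \<in> WJ J" "lin (u \<circ> v) = y' \<circ> theta J (u \<circ> v)" and t: "theta J (u \<circ> v) \<in> MR J"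
    using theta_decomp[OF J ext_comp_mem[OF uE(1) v]] by blast
  have "lin (w \<circ> v) = y \<circ> lin (u \<circ> v)" by (simp only: lin_comp[OF w v] lin_comp[OF uE(1) v] uE y comp_assoc)
  also have "\<dots> = (y \<circ> y') \<circ> theta J (u \<circ> v)" by (simp only: y'(2) comp_assoc)
  finally have "theta J (w \<circ> v) = theta J (u \<circ> v)" using theta_eq[OF J t] parabolic_comp[OF y(1) y'(1)] by blast
  then show "theta J (w \<circ> v) = theta J (theta J w \<circ> v)" by (simp only: u_def)
  define x where "x = wgt (u \<circ> v)"
  have xe: "x = u (wgt v)" using wt_comp[OF uE(1) v] uE by (simp add: x_def)
  have xP: "x \<in> P" unfolding x_def using wt_lattice[OF ext_comp_mem[OF uE(1) v]] .
  have "wgt (w \<circ> v) = wgt w + x + (y x - x)"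
    using wt_comp[OF w v] y(2) by (simp add: xe)
  then show "\<exists>g\<in>QJ J. wgt (w \<circ> v) = wgt w + wgt (theta J w \<circ> v) + g"
    using parabolic_moves_by_QJ[OF J xP y(1)] unfolding x_def u_def by blast
qed

subsection \<open>Crossings inside and out of the alcove of a parabolic subsystem\<close>

text \<open>
  The factor in \<open>W\<^sub>J\<close> preserves \<open>\<Phi>\<^sub>J\<close> and the positive roots outside it, so crossings outside \<open>\<Phi>\<^sub>J\<close> have the same sign at \<open>w\<close>
  and at its minimal representative.
\<close>

lemma RJ_theta_wall:
  assumes J: "J \<subseteq> I" and w: "w \<in> EW"
  shows "lin w c \<in> RJ J \<longleftrightarrow> theta J w c \<in> RJ J"
    and "c \<in> \<Phi> \<Longrightarrow> lin w c \<notin> RJ J \<Longrightarrow> lin w c \<in> pos \<longleftrightarrow> theta J w c \<in> pos"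
proof -
  obtain y where y: "y \<in> WJ J" "lin w = y \<circ> theta J w" and u: "theta J w \<in> MR J"
    using theta_decomp[OF J w] by blast
  show 1: "lin w c \<in> RJ J \<longleftrightarrow> theta J w c \<in> RJ J" using parabolic_RJ_iff[OF J y(1)] y(2) by simp
  assume "c \<in> \<Phi>" "lin w c \<notin> RJ J"
  then show "lin w c \<in> pos \<longleftrightarrow> theta J w c \<in> pos"
    using 1 parabolic_outside_pos_iff[OF J y(1), of "theta J w c"] y(2) weyl_root[OF min_rep_weyl[OF u]] by simp
qed

lemma crossing_outside_RJ:
  assumes w: "w \<in> EW" and i: "i \<in> {0..DIM('a)}" and c: "lin w (aroot i) \<notin> RJ J" and b: "b \<in> RJ J"
  shows "strip b (w \<circ> s i) = strip b w"
proof -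
  let ?c = "lin w (aroot i)"
  have cR: "?c \<in> \<Phi>" using wall_root w i by blast
  have "?c \<in> RJ J" if "d *\<^sub>R ?c \<in> RJ J" "d \<noteq> 0" for d
    using RJ_scale[OF that(1), of "1 / d"] cR that(2) by simp
  from this[of 1] this[of 2] this[of "- 1"] this[of "- 2"] have "along b ?c = 0 \<and> along (- b) ?c = 0"
    using b c RJ_neg[OF b] by (auto simp: along_def)
  then show ?thesis using crossing[OF w i RJ_root[OF b]] by simp
qed

text \<open>
  All strip numbers of \<open>u\<close> for positive roots of \<open>\<Phi>\<^sub>J\<close> are 0; the crossing keeps this exactly if its direction is outside \<open>\<Phi>\<^sub>J\<close>.
\<close>

lemma ext_weyl_J_iff:
  assumes J: "J \<subseteq> I" and u: "u \<in> MR J" and i: "i \<in> {0..DIM('a)}"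
  shows "u \<circ> s i \<in> ext_weyl_J \<Phi> \<alpha> J \<longleftrightarrow> u (aroot i) \<notin> RJ J"
proof -
  have uE: "u \<in> EW" "lin u = u" using weyl_ext min_rep_weyl u by blast+
  have us: "u \<circ> s i \<in> EW" using ext_comp_mem uE s_ext i by blast
  have cR: "u (aroot i) \<in> \<Phi>" using wall_root[OF uE(1) i] uE by simp
  show ?thesis
  proof
    assume m: "u \<circ> s i \<in> ext_weyl_J \<Phi> \<alpha> J"
    show "u (aroot i) \<notin> RJ J"
    proof
      assume c: "u (aroot i) \<in> RJ J"
      define e where "e = (if u (aroot i) \<in> pos then u (aroot i) else - u (aroot i))"
      have e: "e \<in> RJ J" "e \<in> pos" using c RJ_neg pos_or_neg[OF cR] by (auto simp: e_def)
      then have eR: "e \<in> \<Phi>" using RJ_root by blast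
      have "strip e (u \<circ> s i) = strip e u - along e (u (aroot i)) + along (- e) (u (aroot i))"
        using crossing[OF uE(1) i eR] uE by simp
      moreover have "along e (u (aroot i)) + along (- e) (u (aroot i)) = 1"
        using pos_neq[OF e(2) e(2)] e(2) by (auto simp: e_def along_def pos_def split: if_splits)
      ultimately have "strip e (u \<circ> s i) \<noteq> 0"
        using strip_min_rep[OF J u e] by presburger
      moreover have "0 \<le> (u \<circ> s i) p0 \<bullet> e \<and> (u \<circ> s i) p0 \<bullet> e \<le> 1"
        using m p0_mem_A0 e unfolding ext_weyl_J_def alcove_J_def pos_roots_eq by blast
      ultimately show False using strip_strict[OF us eR] by linarith
    qed
  next
    assume c: "u (aroot i) \<notin> RJ J"
    have "0 \<le> (u \<circ> s i) x \<bullet> b \<and> (u \<circ> s i) x \<bullet> b \<le> 1" if x: "x \<in> A0" and b: "b \<in> RJ J" "b \<in> pos" for x b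
    proof -
      have "strip b (u \<circ> s i) = 0"
        using crossing_outside_RJ[OF uE(1) i _ b(1)] c strip_min_rep[OF J u b] uE by simp
      then show ?thesis using strip_bounds[OF us RJ_root[OF b(1)] x] by simp
    qed
    then show "u \<circ> s i \<in> ext_weyl_J \<Phi> \<alpha> J"
      using us unfolding ext_weyl_J_def alcove_J_def pos_roots_eq by blast
  qed
qed

text \<open>
  The crossing increases some strip number of a positive root, or decreases one, respectively; only the direction of the
  wall determines which of the two can happen.
\<close>

lemma pos_crossing_wall:
  assumes w: "w \<in> EW" and i: "i \<in> {0..DIM('a)}"
  shows "pos_crossing \<Phi> \<alpha> w i \<Longrightarrow> lin w (aroot i) \<notin> pos"
    and "neg_crossing \<Phi> \<alpha> w i \<Longrightarrow> lin w (aroot i) \<in> pos"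
proof -
  have ws: "w \<circ> s i \<in> EW" using ext_comp_mem w s_ext i by blast
  let ?A = "w ` A0" and ?B = "(w \<circ> s i) ` A0"
  have A: "w p0 \<in> ?A" and B: "(w \<circ> s i) p0 \<in> ?B" using p0_mem_A0 by blast+
  {
    assume "pos_crossing \<Phi> \<alpha> w i"
    then obtain a k where a: "a \<in> pos" and sep: "separates a k ?A ?B" and ge: "\<forall>x\<in>?B. of_int k \<le> x \<bullet> a"
      unfolding pos_crossing_def pos_roots_eq Let_def by blast
    have aR: "a \<in> \<Phi>" using a by (simp add: pos_def)
    note st = strip_strict[OF w aR] strip_strict[OF ws aR]
    have 1: "of_int k \<le> (w \<circ> s i) p0 \<bullet> a" using ge B by blast
    have "w p0 \<bullet> a \<le> of_int k \<or> (w \<circ> s i) p0 \<bullet> a \<le> of_int k"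
      using sep A B unfolding separates_def by blast
    then have "strip a w < k \<or> strip a (w \<circ> s i) < k"
      using st(1,3) order_less_le_trans of_int_less_iff by blast
    moreover have "k \<le> strip a (w \<circ> s i)" using 1 by (simp add: strip_def le_floor_iff)
    ultimately have "strip a w < strip a (w \<circ> s i)" by linarith
    then have "- a = lin w (aroot i) \<or> - a = 2 *\<^sub>R lin w (aroot i)"
      using crossing[OF w i aR] by (auto simp: along_def split: if_splits)
    then show "lin w (aroot i) \<notin> pos" using pos_neq[OF a] by metis
  }
  {
    assume "neg_crossing \<Phi> \<alpha> w i"
    then obtain a k where a: "a \<in> pos" and sep: "separates a k ?A ?B" and ge: "\<forall>x\<in>?B. x \<bullet> a \<le> of_int k"
      unfolding neg_crossing_def pos_roots_eq Let_def by blast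
    have aR: "a \<in> \<Phi>" using a by (simp add: pos_def)
    note st = strip_strict[OF w aR] strip_strict[OF ws aR]
    have 1: "(w \<circ> s i) p0 \<bullet> a \<le> of_int k" using ge B by blast
    have "of_int k \<le> w p0 \<bullet> a \<or> of_int k \<le> (w \<circ> s i) p0 \<bullet> a"
      using sep A B unfolding separates_def by blast
    then have "k < strip a w + 1 \<or> k < strip a (w \<circ> s i) + 1"
    proof
      assume "of_int k \<le> w p0 \<bullet> a"
      then have "of_int k < real_of_int (strip a w + 1)" using st(2) by simp
      then show ?thesis by linarith
    next
      assume "of_int k \<le> (w \<circ> s i) p0 \<bullet> a"
      then have "of_int k < real_of_int (strip a (w \<circ> s i) + 1)" using st(4) by simp
      then show ?thesis by linarith
    qed
    moreover have "strip a (w \<circ> s i) < k"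
      using st(3) 1 order_less_le_trans of_int_less_iff by blast
    ultimately have "strip a (w \<circ> s i) < strip a w" by linarith
    then have "a = lin w (aroot i) \<or> a = 2 *\<^sub>R lin w (aroot i)"
      using crossing[OF w i aR] by (auto simp: along_def split: if_splits)
    then show "lin w (aroot i) \<in> pos" using a wall_root[OF w i] by (auto simp: pos_def)
  }
qed

text \<open>
  Here \<open>u s\<^sub>i\<close> is the affine reflection in the wall times \<open>u\<close>, and this reflection belongs to the affine Weyl group of \<open>\<Phi>\<^sub>J\<close>.
\<close>

lemma theta_wall_in_RJ:
  assumes J: "J \<subseteq> I" and u: "u \<in> MR J" and i: "i \<in> {0..DIM('a)}" and c: "u (aroot i) \<in> RJ J"
  shows "theta J (u \<circ> s i) = u" "wgt (u \<circ> s i) \<in> QJ J"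
proof -
  note uW = min_rep_weyl[OF u]
  have uE: "u \<in> EW" "lin u = u" "wgt u = 0" using weyl_ext uW by blast+
  note si = s_ext[OF i]
  have "lin (u \<circ> s i) = refl (u (aroot i)) 0 \<circ> u"
    using lin_comp[OF uE(1) si(1)] uE si weyl_refl_conj[OF uW] by (simp add: fun_eq_iff)
  then show "theta J (u \<circ> s i) = u" using theta_eq[OF J u RJ_refl_parabolic[OF J c]] by blast
  have "wgt (u \<circ> s i) = u (if i = 0 then coroot phi else 0)" using wt_comp[OF uE(1) si(1)] uE si by simp
  moreover have "u (coroot phi) \<in> QJ J" if "i = 0"
  proof -
    have "u (coroot phi) = coroot (u phi)"
      by (simp add: coroot_def weyl_scale[OF uW] weyl_dot[OF uW])
    moreover have "u phi \<in> RJ J" using RJ_neg[OF c] that weyl_neg[OF uW] by (simp add: aroot_zero)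
    ultimately show ?thesis using QJ_coroot by simp
  qed
  ultimately show "wgt (u \<circ> s i) \<in> QJ J" using weyl_zero[OF uW] QJ_zero by simp
qed


section \<open>The coefficient rings\<close>

lemma conj_class_mono:
  assumes g: "g \<in> EW" and e: "g \<circ> s i = s j \<circ> g" shows "conj_class \<Phi> \<alpha> j \<subseteq> conj_class \<Phi> \<alpha> i"
proof
  fix k assume "k \<in> conj_class \<Phi> \<alpha> j"
  then obtain h where k: "k \<in> {0..DIM('a)}" and h: "h \<in> EW" "h \<circ> s j = s k \<circ> h"
    unfolding conj_class_def by blast
  have "(h \<circ> g) \<circ> s i = h \<circ> (s j \<circ> g)" by (simp only: comp_assoc e)
  also have "\<dots> = (h \<circ> s j) \<circ> g" by (simp only: comp_assoc)
  also have "\<dots> = s k \<circ> (h \<circ> g)" by (simp only: h(2) comp_assoc)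
  finally show "k \<in> conj_class \<Phi> \<alpha> i"
    unfolding conj_class_def using k ext_comp_mem[OF h(1) g] by blast
qed

lemma conj_class_eq:
  assumes g: "g \<in> EW" and e: "g \<circ> s i = s j \<circ> g" shows "conj_class \<Phi> \<alpha> i = conj_class \<Phi> \<alpha> j"
proof -
  obtain g' where g': "g' \<in> EW" "g' \<circ> g = id" "g \<circ> g' = id" using ext_inverse[OF g] by blast
  have "g' \<circ> s j = g' \<circ> (s j \<circ> g) \<circ> g'" by (simp only: comp_assoc g'(3) comp_id)
  also have "\<dots> = (g' \<circ> g) \<circ> s i \<circ> g'" by (simp only: e[symmetric] comp_assoc)
  also have "\<dots> = s i \<circ> g'" by (simp only: g'(2) id_comp)
  finally show ?thesis using conj_class_mono[OF g e] conj_class_mono[OF g'(1)] by blast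
qed

abbreviation R :: "qpoly ring" where "R \<equiv> Rq \<Phi> \<alpha>"

interpretation Rq: laurent "conj_class \<Phi> \<alpha> ` {0..DIM('a)}" "UNIV :: int set"
  by unfold_locales auto

lemma R_ops [simp]: "\<one>\<^bsub>R\<^esub> = 1" "\<zero>\<^bsub>R\<^esub> = 0" "x \<oplus>\<^bsub>R\<^esub> y = x + y" "x \<otimes>\<^bsub>R\<^esub> y = x * y"
  unfolding Rq_def by simp_all

lemma R_closed: "1 \<in> carrier R" "0 \<in> carrier R" "x \<in> carrier R \<Longrightarrow> y \<in> carrier R \<Longrightarrow> x * y \<in> carrier R"
  "x \<in> carrier R \<Longrightarrow> y \<in> carrier R \<Longrightarrow> x + y \<in> carrier R" "x \<in> carrier R \<Longrightarrow> - x \<in> carrier R"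
  unfolding Rq_def by (simp_all add: Rq.one_mem Rq.zero_mem Rq.mult_mem Rq.add_mem Rq.uminus_mem)

definition qinv :: "nat \<Rightarrow> qpoly" where
  "qinv i = Poly_Mapping.single (Poly_Mapping.single (conj_class \<Phi> \<alpha> i) (- 1)) 1"

lemma q_closed:
  assumes "i \<in> {0..DIM('a)}" shows "qpar \<Phi> \<alpha> i \<in> carrier R" "qinv i \<in> carrier R"
  unfolding Rq_def qpar_def qinv_def using assms by (auto intro!: Rq.single_mem)

lemma q_inverse: "qpar \<Phi> \<alpha> i * qinv i = 1"
  by (simp add: qpar_def qinv_def mult_single single_add[symmetric])

lemma q_inv: assumes "i \<in> {0..DIM('a)}" shows "inv\<^bsub>R\<^esub> (qpar \<Phi> \<alpha> i) = qinv i"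
  unfolding Rq_def by (rule Rq.L_inv) (use q_closed[OF assms] q_inverse in \<open>simp_all add: Rq_def\<close>)

lemma qdiff_eq: assumes "i \<in> {0..DIM('a)}" shows "qdiff \<Phi> \<alpha> i = qpar \<Phi> \<alpha> i - qinv i"
  unfolding qdiff_def q_inv[OF assms]
  unfolding Rq_def by (rule Rq.L_diff) (use q_closed[OF assms] in \<open>simp_all add: Rq_def\<close>)

lemma qdiff_closed: "i \<in> {0..DIM('a)} \<Longrightarrow> qdiff \<Phi> \<alpha> i \<in> carrier R"
  using R_closed(4)[OF q_closed(1) R_closed(5)[OF q_closed(2)]] by (simp add: qdiff_eq)

lemma qvals_eq: assumes "i \<in> {0..DIM('a)}" shows "qvals \<Phi> \<alpha> i = {qpar \<Phi> \<alpha> i, - qinv i}"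
proof -
  have "\<ominus>\<^bsub>R\<^esub> qinv i = - qinv i"
    unfolding Rq_def by (rule Rq.L_minus) (use q_closed[OF assms] in \<open>simp add: Rq_def\<close>)
  then show ?thesis unfolding qvals_def q_inv[OF assms] by simp
qed

text \<open>
  The quadratic relation, stated without the inverse: both \<open>q\<^sub>i\<close> and \<open>- q\<^sub>i\<^sup>-\<^sup>1\<close> satisfy \<open>x - x\<^sup>-\<^sup>1 = q\<^sub>i - q\<^sub>i\<^sup>-\<^sup>1\<close>.
\<close>

lemma qvals_inverse:
  assumes "i \<in> {0..DIM('a)}" "x \<in> qvals \<Phi> \<alpha> i"
  shows "x * (x - qdiff \<Phi> \<alpha> i) = 1"
  using assms q_inverse[of i] by (auto simp: qvals_eq qdiff_eq algebra_simps)

lemma qvals_cong: "conj_class \<Phi> \<alpha> i = conj_class \<Phi> \<alpha> j \<Longrightarrow> qvals \<Phi> \<alpha> i = qvals \<Phi> \<alpha> j"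
  by (simp add: qvals_def qpar_def)

interpretation Rz: laurent "{1..DIM('a)}" "carrier R"
  by unfold_locales (auto simp: R_closed)

lemma Rz_cring: "cring (Rzeta \<Phi> \<alpha>)" unfolding Rzeta_def by (rule Rz.L_cring)

lemma Rz_ops: "\<one>\<^bsub>Rzeta \<Phi> \<alpha>\<^esub> = 1" "x \<oplus>\<^bsub>Rzeta \<Phi> \<alpha>\<^esub> y = x + y" "x \<otimes>\<^bsub>Rzeta \<Phi> \<alpha>\<^esub> y = x * y"
  unfolding Rzeta_def by (rule Rz.L_simps)+

text \<open>
  The fundamental coweights are dual to the simple roots, so pairing with these reads off the integral coordinates.
\<close>

lemma coords_spec:
  assumes l: "l \<in> P"
  shows coords_keys: "Poly_Mapping.keys (coweight_coords \<alpha> l) \<subseteq> I"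
    and coords_lookup: "i \<in> I \<Longrightarrow> of_int (Poly_Mapping.lookup (coweight_coords \<alpha> l) i) = l \<bullet> \<alpha> i"
proof -
  let ?Q = "\<lambda>\<mu>. Poly_Mapping.keys \<mu> \<subseteq> I \<and>
     l = (\<Sum>i\<in>I. of_int (Poly_Mapping.lookup \<mu> i) *\<^sub>R om i)"
  have lk: "of_int (Poly_Mapping.lookup \<mu> i) = l \<bullet> \<alpha> i" if "?Q \<mu>" "i \<in> I" for \<mu> i
    using coweight_comb_dot[OF that(2), of "\<lambda>i. of_int (Poly_Mapping.lookup \<mu> i)"] that(1) by metis
  define \<nu> where "\<nu> = (\<Sum>i\<in>I. Poly_Mapping.single i \<lfloor>l \<bullet> \<alpha> i\<rfloor>)"
  have \<nu>: "Poly_Mapping.lookup \<nu> k = (if k \<in> I then \<lfloor>l \<bullet> \<alpha> k\<rfloor> else 0)" for k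
  proof -
    have "Poly_Mapping.lookup \<nu> k = (\<Sum>i\<in>I. if i = k then \<lfloor>l \<bullet> \<alpha> i\<rfloor> else 0)"
      unfolding \<nu>_def lookup_sum by (rule sum.cong) (auto simp: lookup_single when_def)
    then show ?thesis by (simp add: sum.delta')
  qed
  have ex: "?Q \<nu>"
  proof
    show "Poly_Mapping.keys \<nu> \<subseteq> I" using \<nu> by (auto simp: in_keys_iff split: if_splits)
    have "(\<Sum>i\<in>I. of_int (Poly_Mapping.lookup \<nu> i) *\<^sub>R om i) = (\<Sum>i\<in>I. (l \<bullet> \<alpha> i) *\<^sub>R om i)"
    proof (rule sum.cong[OF HOL.refl])
      fix i assume i: "i \<in> I"
      show "of_int (Poly_Mapping.lookup \<nu> i) *\<^sub>R om i = (l \<bullet> \<alpha> i) *\<^sub>R om i"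
        by (simp only: \<nu> i if_True lattice_root_floor[OF l simple_root[OF i]])
    qed
    then show "l = (\<Sum>i\<in>I. of_int (Poly_Mapping.lookup \<nu> i) *\<^sub>R om i)" using coweight_expansion[of l] by metis
  qed
  have uniq: "\<mu> = \<nu>" if "?Q \<mu>" for \<mu>
  proof (rule poly_mapping_eqI)
    fix k
    show "Poly_Mapping.lookup \<mu> k = Poly_Mapping.lookup \<nu> k"
    proof (cases "k \<in> I")
      case True
      have "real_of_int (Poly_Mapping.lookup \<mu> k) = real_of_int (Poly_Mapping.lookup \<nu> k)"
        using lk[OF that True] lk[OF ex True] by simp
      then show ?thesis by linarith
    next
      case False
      then have "k \<notin> Poly_Mapping.keys \<mu>" "k \<notin> Poly_Mapping.keys \<nu>" using that ex by blast+
      then show ?thesis by (simp add: in_keys_iff)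
    qed
  qed
  have "coweight_coords \<alpha> l = \<nu>"
    unfolding coweight_coords_def I_eq[symmetric] by (rule the_equality) (use ex uniq in blast)+
  then show "Poly_Mapping.keys (coweight_coords \<alpha> l) \<subseteq> I"
    "i \<in> I \<Longrightarrow> of_int (Poly_Mapping.lookup (coweight_coords \<alpha> l) i) = l \<bullet> \<alpha> i"
    using ex lk by blast+
qed

lemma coords_add:
  assumes "l \<in> P" "l' \<in> P"
  shows "coweight_coords \<alpha> (l + l') = coweight_coords \<alpha> l + coweight_coords \<alpha> l'"
proof (rule poly_mapping_eqI)
  fix k
  note ll = lattice_add[OF assms]
  show "Poly_Mapping.lookup (coweight_coords \<alpha> (l + l')) k = Poly_Mapping.lookup (coweight_coords \<alpha> l + coweight_coords \<alpha> l') k"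
  proof (cases "k \<in> I")
    case True
    have "real_of_int (Poly_Mapping.lookup (coweight_coords \<alpha> (l + l')) k)
        = real_of_int (Poly_Mapping.lookup (coweight_coords \<alpha> l + coweight_coords \<alpha> l') k)"
      using True coords_lookup[OF ll] coords_lookup[OF assms(1)] coords_lookup[OF assms(2)]
      by (simp add: lookup_add inner_add_left)
    then show ?thesis by linarith
  next
    case False
    then have "k \<notin> Poly_Mapping.keys (coweight_coords \<alpha> (l + l'))" "k \<notin> Poly_Mapping.keys (coweight_coords \<alpha> l)"
      "k \<notin> Poly_Mapping.keys (coweight_coords \<alpha> l')" using coords_keys ll assms by blast+
    then show ?thesis by (simp add: in_keys_iff lookup_add)
  qed
qed

lemma zeta_closed: "l \<in> P \<Longrightarrow> zeta \<alpha> l \<in> carrier (Rzeta \<Phi> \<alpha>)"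
  unfolding zeta_def Rzeta_def using coords_keys R_closed(1) by (intro Rz.single_mem) (auto simp: I_eq)

lemma zeta_add: "l \<in> P \<Longrightarrow> l' \<in> P \<Longrightarrow> zeta \<alpha> (l + l') = zeta \<alpha> l * zeta \<alpha> l'"
  by (simp add: zeta_def coords_add mult_single)

lemma zeta_zero: "zeta \<alpha> 0 = 1"
proof -
  have "coweight_coords \<alpha> 0 = 0" using coords_add[OF lattice_zero lattice_zero] by simp
  then show ?thesis by (simp add: zeta_def)
qed

lemma const_ring_hom: "(\<lambda>r. Poly_Mapping.single 0 r) \<in> ring_hom R (Rzeta \<Phi> \<alpha>)"
proof (rule ring_hom_memI)
  show "Poly_Mapping.single 0 x \<in> carrier (Rzeta \<Phi> \<alpha>)" if "x \<in> carrier R" for x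
    unfolding Rzeta_def using that by (intro Rz.single_mem) auto
qed (simp_all add: Rz_ops mult_single single_add)

context
  fixes J :: "nat set"
begin

abbreviation S :: "zpoly set ring" where "S \<equiv> RzetaJ \<Phi> \<alpha> J"
abbreviation sc :: "qpoly \<Rightarrow> zpoly set" where "sc \<equiv> scalJ \<Phi> \<alpha> J"
abbreviation zJ :: "'a \<Rightarrow> zpoly set" where "zJ \<equiv> zetaJ \<Phi> \<alpha> J"

lemma zeta_gens: "{zeta \<alpha> g \<ominus>\<^bsub>Rzeta \<Phi> \<alpha>\<^esub> \<one>\<^bsub>Rzeta \<Phi> \<alpha>\<^esub> | g. g \<in> QJ J} \<subseteq> carrier (Rzeta \<Phi> \<alpha>)"
proof -
  interpret Z: cring "Rzeta \<Phi> \<alpha>" by (rule Rz_cring)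
  show ?thesis using zeta_closed[OF QJ_lattice] Z.minus_closed Z.one_closed by blast
qed

lemma zeta_ideal: "ideal (zeta_ideal \<Phi> \<alpha> J) (Rzeta \<Phi> \<alpha>)"
proof -
  interpret Z: cring "Rzeta \<Phi> \<alpha>" by (rule Rz_cring)
  show ?thesis unfolding zeta_ideal_def by (rule Z.genideal_ideal[OF zeta_gens])
qed

lemma proj_hom: "(+>\<^bsub>Rzeta \<Phi> \<alpha>\<^esub>) (zeta_ideal \<Phi> \<alpha> J) \<in> ring_hom (Rzeta \<Phi> \<alpha>) S"
  unfolding RzetaJ_def by (rule ideal.rcos_ring_hom[OF zeta_ideal])

lemma sc_hom: "sc \<in> ring_hom R S"
proof -
  have "sc = (+>\<^bsub>Rzeta \<Phi> \<alpha>\<^esub>) (zeta_ideal \<Phi> \<alpha> J) \<circ> (\<lambda>r. Poly_Mapping.single 0 r)"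
    by (simp add: fun_eq_iff scalJ_def)
  then show ?thesis using ring_hom_trans[OF const_ring_hom proj_hom] by (simp only:)
qed

lemma sc_closed: "r \<in> carrier R \<Longrightarrow> sc r \<in> carrier S"
  and sc_mult: "r \<in> carrier R \<Longrightarrow> r' \<in> carrier R \<Longrightarrow> sc (r * r') = sc r \<otimes>\<^bsub>S\<^esub> sc r'"
  and sc_add: "r \<in> carrier R \<Longrightarrow> r' \<in> carrier R \<Longrightarrow> sc (r + r') = sc r \<oplus>\<^bsub>S\<^esub> sc r'"
  and sc_one: "sc 1 = \<one>\<^bsub>S\<^esub>"
  using ring_hom_closed[OF sc_hom] ring_hom_mult[OF sc_hom] ring_hom_add[OF sc_hom] ring_hom_one[OF sc_hom]
  by simp_all

lemma zJ_closed: "l \<in> P \<Longrightarrow> zJ l \<in> carrier S"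
  unfolding zetaJ_def by (rule ring_hom_closed[OF proj_hom zeta_closed])

lemma zJ_add: assumes "l \<in> P" "l' \<in> P" shows "zJ (l + l') = zJ l \<otimes>\<^bsub>S\<^esub> zJ l'"
  using ring_hom_mult[OF proj_hom zeta_closed[OF assms(1)] zeta_closed[OF assms(2)]]
  by (simp add: zetaJ_def zeta_add[OF assms] Rz_ops)

lemma zJ_zero: "zJ 0 = \<one>\<^bsub>S\<^esub>"
  using ring_hom_one[OF proj_hom] by (simp add: zetaJ_def zeta_zero Rz_ops)

lemma zJ_QJ: assumes "g \<in> QJ J" shows "zJ g = \<one>\<^bsub>S\<^esub>"
proof -
  interpret Z: cring "Rzeta \<Phi> \<alpha>" by (rule Rz_cring)
  have "zeta \<alpha> g \<ominus>\<^bsub>Rzeta \<Phi> \<alpha>\<^esub> \<one>\<^bsub>Rzeta \<Phi> \<alpha>\<^esub> \<in> zeta_ideal \<Phi> \<alpha> J"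
    unfolding zeta_ideal_def using Z.genideal_self[OF zeta_gens] assms by blast
  then have "zJ g = zeta_ideal \<Phi> \<alpha> J +>\<^bsub>Rzeta \<Phi> \<alpha>\<^esub> \<one>\<^bsub>Rzeta \<Phi> \<alpha>\<^esub>"
    unfolding zetaJ_def
    using Z.quotient_eq_iff_same_a_r_cos[OF zeta_ideal zeta_closed[OF QJ_lattice[OF assms]] Z.one_closed] by blast
  then show ?thesis using ring_hom_one[OF proj_hom] by simp
qed

end

subsection \<open>Parameters of walls\<close>

text \<open>
  In the standard form of type \<open>BC\<^sub>n\<close> the square lengths of the roots are at most 4, while \<open>2 \<alpha>\<^sub>j\<close> has square length 8 for \<open>j < n\<close>.
\<close>

lemma double_simple_index:
  assumes "j \<in> I" "2 *\<^sub>R \<alpha> j \<in> \<Phi>" shows "j = DIM('a)"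
proof (rule ccontr)
  assume n: "j \<noteq> DIM('a)"
  have "\<not> reduced_roots \<Phi>"
  proof
    assume "reduced_roots \<Phi>"
    then have "(2::real) = 1 \<or> (2::real) = - 1" using simple_root[OF assms(1)] assms(2) unfolding reduced_roots_def by blast
    then show False by simp
  qed
  then have "standard_BC \<Phi> \<alpha>" using setting by (simp add: root_setting_def)
  then obtain e :: "nat \<Rightarrow> 'a" where
    e: "\<forall>i\<in>{1..DIM('a)}. \<forall>j\<in>{1..DIM('a)}. e i \<bullet> e j = (if i = j then 1 else 0)"
    and s: "\<forall>j\<in>{1..<DIM('a)}. \<alpha> j = e j - e (j + 1)"
    and P: "let P = {e i - e j | i j. 1 \<le> i \<and> i < j \<and> j \<le> DIM('a)} \<union>
              {e i + e j | i j. 1 \<le> i \<and> i < j \<and> j \<le> DIM('a)} \<union>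
              {e k | k. 1 \<le> k \<and> k \<le> DIM('a)} \<union>
              {2 *\<^sub>R e k | k. 1 \<le> k \<and> k \<le> DIM('a)}
      in \<Phi> = P \<union> uminus ` P"
    unfolding standard_BC_def by blast
  define Q where "Q = {e i - e j | i j. 1 \<le> i \<and> i < j \<and> j \<le> DIM('a)} \<union>
              {e i + e j | i j. 1 \<le> i \<and> i < j \<and> j \<le> DIM('a)} \<union>
              {e k | k. 1 \<le> k \<and> k \<le> DIM('a)} \<union>
              {2 *\<^sub>R e k | k. 1 \<le> k \<and> k \<le> DIM('a)}"
  have PQ: "\<Phi> = Q \<union> uminus ` Q" using P unfolding Let_def Q_def .
  have ee: "e i \<bullet> e k = (if i = k then 1 else 0)" if "1 \<le> i" "i \<le> DIM('a)" "1 \<le> k" "k \<le> DIM('a)" for i k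
    using e that by (meson atLeastAtMost_iff)
  have Q4: "c \<bullet> c \<le> 4" if c: "c \<in> Q" for c
  proof -
    consider i j where "c = e i - e j" "1 \<le> i" "i < j" "j \<le> DIM('a)"
      | i j where "c = e i + e j" "1 \<le> i" "i < j" "j \<le> DIM('a)"
      | k where "c = e k" "1 \<le> k" "k \<le> DIM('a)" | k where "c = 2 *\<^sub>R e k" "1 \<le> k" "k \<le> DIM('a)"
      using c unfolding Q_def by blast
    then show ?thesis
      by cases (simp_all add: inner_diff_left inner_diff_right inner_add_left inner_add_right ee)
  qed
  have len: "b \<bullet> b \<le> 4" if b: "b \<in> \<Phi>" for b
    using b unfolding PQ
  proof
    assume "b \<in> uminus ` Q"
    then obtain c where "c \<in> Q" "b = - c" by blast
    then show ?thesis using Q4 by simp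
  qed (rule Q4)
  have j: "1 \<le> j" "j < DIM('a)" using assms(1) n by (auto simp: I_eq)
  then have "\<alpha> j = e j - e (j + 1)" using s by auto
  then have "(2 *\<^sub>R \<alpha> j) \<bullet> (2 *\<^sub>R \<alpha> j) = 8"
    using j by (simp add: inner_diff_left inner_diff_right ee)
  then show False using len[OF assms(2)] by simp
qed

text \<open>
  An element that takes one root to the other conjugates the linear reflections. For \<open>i = 0\<close> it takes \<open>s 0\<close> to a reflection in
  a parallel hyperplane, which the translation by the fundamental coweight of \<open>j\<close> moves through the origin.
\<close>

lemma conj_of_roots:
  assumes x: "x \<in> W0" and i: "i \<in> {0..DIM('a)}" and j: "j \<in> I" and e: "x (aroot i) = \<alpha> j"
  shows "conj_class \<Phi> \<alpha> i = conj_class \<Phi> \<alpha> j"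
proof -
  consider "i = 0" | "i \<in> I" using i index0_iff by auto
  then show ?thesis
  proof cases
    case 1
    have e': "x phi = - \<alpha> j" using e weyl_neg[OF x, of phi] by (simp add: 1 aroot_zero minus_equation_iff)
    have one: "om j \<bullet> \<alpha> j = 1" using om_dot[OF j j] by simp
    have "coroot (- \<alpha> j) = - coroot (\<alpha> j)" by (simp add: coroot_def)
    then have "om j + x (refl phi 1 y) = refl (\<alpha> j) 0 (om j + x y)" for y
      unfolding weyl_refl_conj[OF x] e'
      by (simp add: refl_def inner_add_left one algebra_simps)
    then have "(transl (om j) \<circ> x) \<circ> s i = s j \<circ> (transl (om j) \<circ> x)"
      by (simp add: fun_eq_iff 1 s_zero s_simple[OF j] transl_def)
    then show ?thesis using conj_class_eq[OF ext_weylI[OF om_lattice[OF j] x]] by blast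
  next
    case 2
    then have "x (\<alpha> i) = \<alpha> j" using e by (simp add: aroot_simple)
    then have "x \<circ> s i = s j \<circ> x"
      using weyl_refl_conj[OF x, of "\<alpha> i"] by (simp add: fun_eq_iff s_simple[OF 2] s_simple[OF j])
    then show ?thesis using conj_class_eq[OF weyl_ext(1)[OF x]] by blast
  qed
qed

end

locale parametrised_roots = based_roots \<Phi> \<alpha> I
  for \<Phi> :: "'a::euclidean_space set" and \<alpha> and I +
  fixes J :: "nat set" and v :: "'a \<Rightarrow> qpoly"
  assumes J: "J \<subseteq> I" and param: "parameter_system \<Phi> \<alpha> J v"
begin

abbreviation S' :: "zpoly set ring" where "S' \<equiv> RzetaJ \<Phi> \<alpha> J"

text \<open>
  The factor by which the formulas act at a wall with direction \<open>b\<close> in \<open>\<Phi>\<^sub>J\<close>.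
\<close>

definition wall_par :: "'a \<Rightarrow> qpoly" where
  "wall_par b = (if b \<in> RJ J then v b else 1) * (if 2 *\<^sub>R b \<in> RJ J then v (2 *\<^sub>R b) else 1)"

lemma v_inverse: assumes "b \<in> RJ J" shows "v b \<in> carrier R" "\<exists>y\<in>carrier R. v b * y = 1"
proof -
  have "v b \<in> Units R" using assms param unfolding parameter_system_def by blast
  then show "v b \<in> carrier R" "\<exists>y\<in>carrier R. v b * y = 1" unfolding Units_def by auto
qed

lemma v_invariant: "b \<in> RJ J \<Longrightarrow> y \<in> WJ J \<Longrightarrow> v (y b) = v b"
  using param unfolding parameter_system_def by blast

lemma wall_par_invariant: assumes "y \<in> WJ J" shows "wall_par (y b) = wall_par b"
  unfolding wall_par_def
  using parabolic_RJ_iff[OF J assms, of b] parabolic_RJ_iff[OF J assms, of "2 *\<^sub>R b"]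
    v_invariant[OF _ assms] weyl_scale[OF parabolic_weyl[OF J assms], symmetric] by simp

text \<open>
  A wall with direction in \<open>\<Phi>\<^sub>J\<close> is conjugate to the wall of a generator of \<open>W\<^sub>J\<close>; in the
  non-reduced case a root that is twice a root belongs to \<open>s 0\<close>, one whose double is a root to \<open>s n\<close>.
\<close>

lemma wall_par_qvals:
  assumes u: "u \<in> W0" and i: "i \<in> {0..DIM('a)}" and b: "u (aroot i) \<in> RJ J"
  shows "wall_par (u (aroot i)) \<in> qvals \<Phi> \<alpha> i"
proof -
  obtain y j c where y: "y \<in> WJ J" "j \<in> J" "c \<in> {1, 2}" "u (aroot i) = y (c *\<^sub>R \<alpha> j)"
    using RJ_conj_simple[OF J b] by blast
  have jI: "j \<in> I" using y J by blast
  have yW: "y \<in> W0" using parabolic_weyl[OF J y(1)] .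
  have aR: "\<alpha> j \<in> \<Phi>" "\<alpha> j \<in> RJ J" using simple_root jI RJ_simple[OF J y(2)] by auto
  define x where "x = ginv y \<circ> u"
  have x: "x \<in> W0" using weyl_comp weyl_inv yW u by (simp add: x_def)
  have xe: "x (aroot i) = c *\<^sub>R \<alpha> j" using y(4) weyl_inv_apply(2)[OF yW] by (simp add: x_def)
  have wall_par: "wall_par (u (aroot i)) = wall_par (c *\<^sub>R \<alpha> j)" using wall_par_invariant[OF y(1)] y(4) by simp
  have dbl: "2 *\<^sub>R \<alpha> j \<in> RJ J \<longleftrightarrow> 2 *\<^sub>R \<alpha> j \<in> \<Phi>" using RJ_scale[OF aR(2)] RJ_root by blast
  have nonred: "j = DIM('a) \<and> \<not> reduced_roots (RJ J)" if "2 *\<^sub>R \<alpha> j \<in> \<Phi>"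
  proof
    show "j = DIM('a)" using double_simple_index[OF jI that] .
    show "\<not> reduced_roots (RJ J)"
    proof
      assume "reduced_roots (RJ J)"
      then have "(2::real) = 1 \<or> (2::real) = - 1" using that dbl aR(2) unfolding reduced_roots_def by blast
      then show False by simp
    qed
  qed
  have case_i: "i = 0 \<or> i \<in> I" using i index0_iff by blast
  show ?thesis
  proof (cases "c = 1")
    case True
    then have "x (aroot i) = \<alpha> j" using xe by simp
    then have q: "qvals \<Phi> \<alpha> i = qvals \<Phi> \<alpha> j" by (rule qvals_cong[OF conj_of_roots[OF x i jI]])
    show ?thesis
    proof (cases "2 *\<^sub>R \<alpha> j \<in> \<Phi>")
      case False
      then have "v (\<alpha> j) \<in> qvals \<Phi> \<alpha> j" using param y(2) dbl unfolding parameter_system_def by blast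
      then show ?thesis using wall_par True False dbl aR q by (simp add: wall_par_def)
    next
      case D: True
      have "v (\<alpha> DIM('a)) * v (2 *\<^sub>R \<alpha> DIM('a)) \<in> qvals \<Phi> \<alpha> DIM('a)"
        using param nonred[OF D] unfolding parameter_system_def by simp
      then show ?thesis using wall_par True D dbl aR q nonred[OF D] by (simp add: wall_par_def)
    qed
  next
    case False
    then have c: "c = 2" using y(3) by simp
    have "2 *\<^sub>R \<alpha> j \<in> \<Phi>" using xe weyl_root[OF x aroot_root[OF i]] c by simp
    then have n: "j = DIM('a)" "\<not> reduced_roots (RJ J)" "2 *\<^sub>R \<alpha> j \<in> RJ J" using nonred dbl by auto
    have "4 *\<^sub>R \<alpha> j \<notin> RJ J" using no_quadruple[OF aR(1)] RJ_root by blast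
    then have nv: "wall_par (2 *\<^sub>R \<alpha> j) = v (2 *\<^sub>R \<alpha> j)" using n by (simp add: wall_par_def)
    have "i = 0"
    proof (rule ccontr)
      assume "i \<noteq> 0"
      then have iI: "i \<in> I" using case_i by blast
      define r where "r = ginv x (\<alpha> j)"
      have rR: "r \<in> \<Phi>" using weyl_root weyl_inv x aR by (simp add: r_def)
      have "\<alpha> i = ginv x (x (\<alpha> i))" using weyl_inv_apply(2)[OF x] by simp
      also have "\<dots> = 2 *\<^sub>R r" using xe c iI weyl_scale[OF weyl_inv[OF x]] by (simp add: aroot_simple r_def)
      finally have "om i \<bullet> \<alpha> i = 2 * (om i \<bullet> r)" by simp
      moreover obtain k where "om i \<bullet> r = of_int k" using root_coord_int[OF rR iI] by (auto elim: Ints_cases)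
      ultimately have "1 = real_of_int (2 * k)" using om_dot[OF iI iI] by simp
      then have "2 * k = 1" by linarith
      then show False by presburger
    qed
    moreover have "v (2 *\<^sub>R \<alpha> DIM('a)) \<in> qvals \<Phi> \<alpha> 0"
      using param n unfolding parameter_system_def by blast
    ultimately show ?thesis using wall_par nv c n by simp
  qed
qed

definition v_inv :: "'a \<Rightarrow> qpoly" where "v_inv b = (SOME y. y \<in> carrier R \<and> v b * y = 1)"

lemma v_inv: assumes "b \<in> RJ J" shows "v_inv b \<in> carrier R" "v b * v_inv b = 1"
proof -
  have "\<exists>y. y \<in> carrier R \<and> v b * y = 1" using v_inverse[OF assms] by blast
  then have "v_inv b \<in> carrier R \<and> v b * v_inv b = 1" unfolding v_inv_def by (rule someI_ex)
  then show "v_inv b \<in> carrier R" "v b * v_inv b = 1" by blast+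
qed

text \<open>
  The integral power \<open>x ^ k\<close> of a unit \<open>x\<close> with inverse \<open>y\<close>.
\<close>

definition ipow :: "qpoly \<Rightarrow> qpoly \<Rightarrow> int \<Rightarrow> qpoly" where "ipow x y k = x ^ nat k * y ^ nat (- k)"

lemma ipow_up: assumes "x * y = 1" shows "ipow x y (k + 1) = ipow x y k * x"
proof (cases "0 \<le> k")
  case True then show ?thesis by (simp add: ipow_def nat_add_distrib mult.commute)
next
  case False
  then obtain m where m: "nat (- k) = Suc m" "nat (- k - 1) = m" "nat k = 0" "nat (k + 1) = 0"
    by (intro that[of "nat (- k - 1)"]) auto
  have "y ^ Suc m * x = y ^ m * (x * y)" by (simp add: algebra_simps)
  then show ?thesis using assms by (simp add: ipow_def m)
qed

lemma power_closed: "x \<in> carrier R \<Longrightarrow> x ^ n \<in> carrier R"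
  by (induction n) (auto intro: R_closed)

lemma prod_closed: "(\<And>b. b \<in> A \<Longrightarrow> f b \<in> carrier R) \<Longrightarrow> prod f A \<in> carrier R"
  by (induction A rule: infinite_finite_induct) (auto intro: R_closed)

text \<open>
  The product of the parameters of all hyperplanes with direction in \<open>\<Phi>\<^sub>J\<close> that separate \<open>A0\<close> from \<open>w A0\<close>, inverted for those
  that are crossed in the negative direction; a hyperplane of both \<open>b\<close> and \<open>2 b\<close> contributes both parameters.
\<close>

definition fold_coeff :: "('a \<Rightarrow> 'a) \<Rightarrow> qpoly" where
  "fold_coeff w = (\<Prod>b\<in>RJ J \<inter> pos. ipow (v b) (v_inv b) (strip b w))"

lemma fold_coeff_closed: "fold_coeff w \<in> carrier R"
  unfolding fold_coeff_def ipow_def by (intro prod_closed R_closed power_closed) (use v_inverse v_inv in auto)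

lemma fold_coeff_unit: "\<exists>y\<in>carrier R. fold_coeff w * y = 1"
proof (rule bexI)
  let ?y = "\<Prod>b\<in>RJ J \<inter> pos. ipow (v_inv b) (v b) (strip b w)"
  show "?y \<in> carrier R" unfolding ipow_def by (intro prod_closed R_closed power_closed) (use v_inverse v_inv in auto)
  have "fold_coeff w * ?y = (\<Prod>b\<in>RJ J \<inter> pos. ipow (v b) (v_inv b) (strip b w) * ipow (v_inv b) (v b) (strip b w))"
    unfolding fold_coeff_def by (rule prod.distrib[symmetric])
  also have "\<dots> = 1"
  proof (rule prod.neutral, rule ballI)
    fix b assume "b \<in> RJ J \<inter> pos"
    then have e: "v b * v_inv b = 1" using v_inv by blast
    have "ipow (v b) (v_inv b) (strip b w) * ipow (v_inv b) (v b) (strip b w)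
        = (v b * v_inv b) ^ nat (strip b w) * (v b * v_inv b) ^ nat (- strip b w)"
      by (simp add: ipow_def power_mult_distrib algebra_simps)
    then show "ipow (v b) (v_inv b) (strip b w) * ipow (v_inv b) (v b) (strip b w) = 1" using e by simp
  qed
  finally show "fold_coeff w * ?y = 1" .
qed

lemma fold_coeff_cong: "(\<And>b. b \<in> RJ J \<Longrightarrow> strip b w = strip b w') \<Longrightarrow> fold_coeff w = fold_coeff w'"
  unfolding fold_coeff_def by (rule prod.cong) auto

lemma prod_one_or_double:
  fixes c :: 'a
  assumes "finite A" "c \<in> A" "c \<noteq> 0"
  shows "(\<Prod>b\<in>A. if b = c \<or> b = 2 *\<^sub>R c then g b else (1 :: qpoly)) = g c * (if 2 *\<^sub>R c \<in> A then g (2 *\<^sub>R c) else 1)"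
proof -
  have ne: "2 *\<^sub>R c \<noteq> c"
  proof
    assume "2 *\<^sub>R c = c"
    then have "c + c = c" by (simp add: scaleR_2)
    then show False using assms(3) by simp
  qed
  have "A \<inter> {b. b = c \<or> b = 2 *\<^sub>R c} = (if 2 *\<^sub>R c \<in> A then {c, 2 *\<^sub>R c} else {c})" using assms(2) by auto
  then show ?thesis using assms(1) ne by (simp add: prod.If_cases split: if_splits)
qed

lemma wall_par_neg: assumes "b \<in> RJ J" shows "wall_par (- b) = wall_par b"
proof -
  have "refl b 0 b = - b" using refl_self RJ_root assms by blast
  then show ?thesis using wall_par_invariant[OF RJ_refl_parabolic[OF J assms], of b] by simp
qed

lemma fold_coeff_crossing_neg:
  assumes w: "w \<in> EW" and i: "i \<in> {0..DIM('a)}" and c: "lin w (aroot i) \<in> RJ J" "lin w (aroot i) \<notin> pos"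
  shows "fold_coeff (w \<circ> s i) = fold_coeff w * wall_par (lin w (aroot i))"
proof -
  define e where "e = - lin w (aroot i)"
  have e: "e \<in> RJ J" "e \<in> pos" using c RJ_neg pos_or_neg[OF RJ_root[OF c(1)]] by (auto simp: e_def)
  have e2: "2 *\<^sub>R e \<in> RJ J \<inter> pos \<longleftrightarrow> 2 *\<^sub>R e \<in> RJ J" using e RJ_root by (auto simp: pos_def)
  have "ipow (v b) (v_inv b) (strip b (w \<circ> s i)) = ipow (v b) (v_inv b) (strip b w) * (if b = e \<or> b = 2 *\<^sub>R e then v b else 1)"
    if b: "b \<in> RJ J \<inter> pos" for b
  proof -
    have "along b (- e) = 0" using pos_neq[of b e] b e by (auto simp: along_def)
    moreover have "along (- b) (- e) = (if b = e \<or> b = 2 *\<^sub>R e then 1 else 0)" by (simp add: along_def)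
    ultimately have "strip b (w \<circ> s i) = strip b w + (if b = e \<or> b = 2 *\<^sub>R e then 1 else 0)"
      using crossing[OF w i, of b] b RJ_root[of b J] by (simp add: e_def)
    then show ?thesis using ipow_up v_inv(2) b by simp
  qed
  then have "fold_coeff (w \<circ> s i) = (\<Prod>b\<in>RJ J \<inter> pos. ipow (v b) (v_inv b) (strip b w) * (if b = e \<or> b = 2 *\<^sub>R e then v b else 1))"
    unfolding fold_coeff_def by (intro prod.cong) auto
  also have "\<dots> = fold_coeff w * (v e * (if 2 *\<^sub>R e \<in> RJ J \<inter> pos then v (2 *\<^sub>R e) else 1))"
    unfolding prod.distrib fold_coeff_def using e by (subst prod_one_or_double) (auto simp: pos_def)
  also have "\<dots> = fold_coeff w * wall_par e" using e e2 by (simp add: wall_par_def)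
  also have "wall_par e = wall_par (lin w (aroot i))" using wall_par_neg[OF e(1)] by (simp add: e_def)
  finally show ?thesis .
qed

text \<open>
  The crossing from \<open>w s\<^sub>i\<close> back to \<open>w\<close> has the opposite, negative direction.
\<close>

lemma fold_coeff_crossing_pos:
  assumes w: "w \<in> EW" and i: "i \<in> {0..DIM('a)}" and c: "lin w (aroot i) \<in> RJ J" "lin w (aroot i) \<in> pos"
  shows "fold_coeff (w \<circ> s i) * wall_par (lin w (aroot i)) = fold_coeff w"
proof -
  have ws: "w \<circ> s i \<in> EW" using ext_comp_mem[OF w s_ext(1)[OF i]] .
  have "w \<circ> s i \<circ> s i = w \<circ> (s i \<circ> s i)" by (simp only: comp_assoc)
  then have ss: "w \<circ> s i \<circ> s i = w" by (simp only: s_invol[OF i] comp_id)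
  have l: "lin (w \<circ> s i) (aroot i) = - lin w (aroot i)"
    using lin_comp[OF w s_ext(1)[OF i]] s_ext(2)[OF i] refl_self[OF aroot_root[OF i]] weyl_neg[OF lin_weyl[OF w]] by simp
  have "fold_coeff (w \<circ> s i \<circ> s i) = fold_coeff (w \<circ> s i) * wall_par (lin (w \<circ> s i) (aroot i))"
    by (rule fold_coeff_crossing_neg[OF ws i]) (use l RJ_neg[OF c(1)] pos_not_neg[OF c(2)] in auto)
  then show ?thesis unfolding ss l wall_par_neg[OF c(1)] by (rule sym)
qed

lemma fold_coeff_crossing_out:
  assumes "w \<in> EW" "i \<in> {0..DIM('a)}" "lin w (aroot i) \<notin> RJ J" shows "fold_coeff (w \<circ> s i) = fold_coeff w"
  by (rule fold_coeff_cong) (rule crossing_outside_RJ[OF assms])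

lemma fold_coeff_stab: "w \<in> EW \<Longrightarrow> \<sigma> \<in> Stab \<Longrightarrow> fold_coeff (w \<circ> \<sigma>) = fold_coeff w"
  by (rule fold_coeff_cong) (rule strip_stab, auto dest: RJ_root)

text \<open>
  Acting by the scalar \<open>\<nu>\<close> agrees with the rule for crossings: for a positive crossing the coefficient of \<open>w s\<^sub>i\<close> is \<open>\<nu>\<close> times
  that of \<open>w\<close>, for a negative one it is \<open>\<nu>\<^sup>-\<^sup>1\<close> times it, and \<open>\<nu> = \<nu>\<^sup>-\<^sup>1 + (q\<^sub>i - q\<^sub>i\<^sup>-\<^sup>1)\<close>.
\<close>

lemma fold_coeff_crossing_in:
  assumes w: "w \<in> EW" and i: "i \<in> {0..DIM('a)}" and c: "lin w (aroot i) \<in> RJ J"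
  shows "fold_coeff w * wall_par (lin w (aroot i)) = fold_coeff (w \<circ> s i) + (if lin w (aroot i) \<in> pos then qdiff \<Phi> \<alpha> i else 0) * fold_coeff w"
proof (cases "lin w (aroot i) \<in> pos")
  case True
  define n where "n = wall_par (lin w (aroot i))"
  have q: "n * (n - qdiff \<Phi> \<alpha> i) = 1"
    using qvals_inverse[OF i wall_par_qvals[OF lin_weyl[OF w] i c]] by (simp add: n_def)
  have a: "fold_coeff (w \<circ> s i) * n = fold_coeff w" using fold_coeff_crossing_pos[OF w i c True] by (simp add: n_def)
  have "fold_coeff w * (n - qdiff \<Phi> \<alpha> i) = fold_coeff (w \<circ> s i) * (n * (n - qdiff \<Phi> \<alpha> i))"
    unfolding a[symmetric] by (simp only: mult.assoc)
  then have "fold_coeff w * (n - qdiff \<Phi> \<alpha> i) = fold_coeff (w \<circ> s i)" using q by simp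
  then show ?thesis using True unfolding n_def[symmetric] by (simp add: algebra_simps)
qed (use fold_coeff_crossing_neg[OF w i c] in simp)

lemma wall_par_closed: assumes "b \<in> \<Phi>" shows "wall_par b \<in> carrier R"
  unfolding wall_par_def by (intro R_closed) (auto simp: v_inverse R_closed)

end

section \<open>The action\<close>

locale hecke_setup = parametrised_roots \<Phi> \<alpha> I J v
  for \<Phi> :: "'a::euclidean_space set" and \<alpha> and I and J and v +
  fixes H :: "(qpoly, 'h) module" and T :: "('a \<Rightarrow> 'a) \<Rightarrow> 'h"
    and M :: "(zpoly set, 'm) module" and m :: "('a \<Rightarrow> 'a) \<Rightarrow> 'm"
  assumes hecke: "ext_hecke_algebra \<Phi> \<alpha> H T"
    and mbasis: "module_basis (RzetaJ \<Phi> \<alpha> J) M (min_reps \<Phi> \<alpha> J) m"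
begin

sublocale Hm: free_module "Rq \<Phi> \<alpha>" H "ext_weyl \<Phi> \<alpha>" T
  using hecke by unfold_locales (simp add: ext_hecke_algebra_def)

sublocale Mm: free_module "RzetaJ \<Phi> \<alpha> J" M "min_reps \<Phi> \<alpha> J" m
  using mbasis by unfold_locales

abbreviation \<iota> :: "qpoly \<Rightarrow> zpoly set" where "\<iota> \<equiv> scalJ \<Phi> \<alpha> J"
abbreviation \<zeta> :: "'a \<Rightarrow> zpoly set" where "\<zeta> \<equiv> zetaJ \<Phi> \<alpha> J"

lemma H_ring: "ring H"
  using hecke by (simp add: ext_hecke_algebra_def assoc_algebra_def)

lemma H_smult_mult:
  assumes "r \<in> carrier R" "x \<in> carrier H" "y \<in> carrier H"
  shows "(r \<odot>\<^bsub>H\<^esub> x) \<otimes>\<^bsub>H\<^esub> y = r \<odot>\<^bsub>H\<^esub> (x \<otimes>\<^bsub>H\<^esub> y)" "x \<otimes>\<^bsub>H\<^esub> (r \<odot>\<^bsub>H\<^esub> y) = r \<odot>\<^bsub>H\<^esub> (x \<otimes>\<^bsub>H\<^esub> y)"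
  using hecke assms by (auto simp: ext_hecke_algebra_def assoc_algebra_def)

lemma T_mult:
  assumes "w \<in> EW" "x \<in> EW" "len \<Phi> \<alpha> (w \<circ> x) = len \<Phi> \<alpha> w + len \<Phi> \<alpha> x"
  shows "T w \<otimes>\<^bsub>H\<^esub> T x = T (w \<circ> x)"
  using hecke assms unfolding ext_hecke_algebra_def by blast

lemma T_mult_down:
  assumes "w \<in> EW" "i \<in> {0..DIM('a)}" "len \<Phi> \<alpha> (w \<circ> s i) + 1 = len \<Phi> \<alpha> w"
  shows "T w \<otimes>\<^bsub>H\<^esub> T (s i) = T (w \<circ> s i) \<oplus>\<^bsub>H\<^esub> qdiff \<Phi> \<alpha> i \<odot>\<^bsub>H\<^esub> T w"
  using hecke assms unfolding ext_hecke_algebra_def by blast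

lemma T_mult_up:
  assumes "w \<in> EW" "i \<in> {0..DIM('a)}" "len \<Phi> \<alpha> (w \<circ> s i) = len \<Phi> \<alpha> w + 1"
  shows "T w \<otimes>\<^bsub>H\<^esub> T (s i) = T (w \<circ> s i)"
  using T_mult[OF assms(1) s_ext(1)[OF assms(2)]] assms(3) len_s[OF assms(2)] by simp

lemma T_mult_stab:
  assumes "w \<in> EW" "\<sigma> \<in> Stab" shows "T w \<otimes>\<^bsub>H\<^esub> T \<sigma> = T (w \<circ> \<sigma>)"
  using T_mult[OF assms(1) stab_ext[OF assms(2)]] len_stab[OF assms] len_stab_zero[OF assms(2)] by simp

subsection \<open>The vectors indexed by the whole group\<close>

definition coeff :: "('a \<Rightarrow> 'a) \<Rightarrow> zpoly set" where "coeff w = \<iota> (fold_coeff w) \<otimes>\<^bsub>S'\<^esub> \<zeta> (wgt w)"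

definition vec :: "('a \<Rightarrow> 'a) \<Rightarrow> 'm" where "vec w = coeff w \<odot>\<^bsub>M\<^esub> m (theta J w)"

lemma coeff_closed: "w \<in> EW \<Longrightarrow> coeff w \<in> carrier S'"
  unfolding coeff_def using sc_closed[OF fold_coeff_closed] zJ_closed[OF wt_lattice] Mm.R.m_closed by blast

lemma vec_closed: "w \<in> EW \<Longrightarrow> vec w \<in> carrier M"
  unfolding vec_def using coeff_closed theta_decomp(2)[OF J] Mm.basis_closed by (intro Mm.smult_closed) blast+

lemma coeff_unit: assumes w: "w \<in> EW" shows "\<exists>c\<in>carrier S'. c \<otimes>\<^bsub>S'\<^esub> coeff w = \<one>\<^bsub>S'\<^esub>"
proof -
  obtain y where y: "y \<in> carrier R" "fold_coeff w * y = 1" using fold_coeff_unit by blast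
  have l: "wgt w \<in> P" "- wgt w \<in> P" using wt_lattice w lattice_neg by blast+
  have 1: "\<iota> (fold_coeff w) \<otimes>\<^bsub>S'\<^esub> \<iota> y = \<one>\<^bsub>S'\<^esub>" using sc_mult[OF fold_coeff_closed y(1)] y(2) sc_one by metis
  have 2: "\<zeta> (wgt w) \<otimes>\<^bsub>S'\<^esub> \<zeta> (- wgt w) = \<one>\<^bsub>S'\<^esub>" using zJ_add[OF l] zJ_zero by simp
  note cl = sc_closed[OF fold_coeff_closed, of J w] sc_closed[OF y(1), of J] zJ_closed[OF l(1), of J] zJ_closed[OF l(2), of J]
  have "(\<iota> y \<otimes>\<^bsub>S'\<^esub> \<zeta> (- wgt w)) \<otimes>\<^bsub>S'\<^esub> coeff w
      = (\<iota> (fold_coeff w) \<otimes>\<^bsub>S'\<^esub> \<iota> y) \<otimes>\<^bsub>S'\<^esub> (\<zeta> (wgt w) \<otimes>\<^bsub>S'\<^esub> \<zeta> (- wgt w))"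
    unfolding coeff_def using cl by (simp add: Mm.R.m_ac)
  then have "(\<iota> y \<otimes>\<^bsub>S'\<^esub> \<zeta> (- wgt w)) \<otimes>\<^bsub>S'\<^esub> coeff w = \<one>\<^bsub>S'\<^esub>" using 1 2 by simp
  then show ?thesis using cl Mm.R.m_closed by blast
qed

text \<open>
  Up to the factor \<open>fold_coeff\<close>, right multiplication by \<open>x\<close> acts on the vectors in a way that commutes with replacing \<open>w\<close> by its
  minimal representative, because weights matter only modulo the coroot lattice of \<open>\<Phi>\<^sub>J\<close>.
\<close>

lemma vec_comp:
  assumes w: "w \<in> EW" and x: "x \<in> EW"
  shows "vec (w \<circ> x) = (\<iota> (fold_coeff (w \<circ> x)) \<otimes>\<^bsub>S'\<^esub> \<zeta> (wgt w)) \<odot>\<^bsub>M\<^esub>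
     (\<zeta> (wgt (theta J w \<circ> x)) \<odot>\<^bsub>M\<^esub> m (theta J (theta J w \<circ> x)))"
proof -
  define u where "u = theta J w"
  have u: "u \<in> EW" using weyl_ext(1)[OF min_rep_weyl] theta_decomp(2)[OF J w] by (simp add: u_def)
  have ux: "u \<circ> x \<in> EW" using ext_comp_mem u x by blast
  obtain g where g: "g \<in> QJ J" "wgt (w \<circ> x) = wgt w + wgt (u \<circ> x) + g"
    using theta_wt_comp(2)[OF J w x] unfolding u_def by blast
  note l = wt_lattice[OF w] wt_lattice[OF ux] QJ_lattice[OF g(1)]
  note cl = zJ_closed[OF l(1), of J] zJ_closed[OF l(2), of J] sc_closed[OF fold_coeff_closed, of J "w \<circ> x"]
  have mc: "m (theta J (u \<circ> x)) \<in> carrier M" using Mm.basis_closed theta_decomp(2)[OF J ux] by blast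
  have "\<zeta> (wgt (w \<circ> x)) = \<zeta> (wgt w) \<otimes>\<^bsub>S'\<^esub> \<zeta> (wgt (u \<circ> x))"
    unfolding g(2) using zJ_add[OF lattice_add[OF l(1,2)] l(3)] zJ_add[OF l(1,2)] zJ_QJ[OF g(1)] cl
    by (simp add: Mm.R.m_closed)
  then have "vec (w \<circ> x) = (\<iota> (fold_coeff (w \<circ> x)) \<otimes>\<^bsub>S'\<^esub> \<zeta> (wgt w) \<otimes>\<^bsub>S'\<^esub> \<zeta> (wgt (u \<circ> x))) \<odot>\<^bsub>M\<^esub> m (theta J (u \<circ> x))"
    unfolding vec_def coeff_def theta_wt_comp(1)[OF J w x] u_def[symmetric] using cl by (simp add: Mm.R.m_assoc)
  also have "\<dots> = (\<iota> (fold_coeff (w \<circ> x)) \<otimes>\<^bsub>S'\<^esub> \<zeta> (wgt w)) \<odot>\<^bsub>M\<^esub> (\<zeta> (wgt (u \<circ> x)) \<odot>\<^bsub>M\<^esub> m (theta J (u \<circ> x)))"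
    using cl mc by (intro Mm.smult_assoc1) auto
  finally show ?thesis unfolding u_def .
qed

abbreviation End :: "('m \<Rightarrow> 'm) \<Rightarrow> bool" where "End \<equiv> linear_along S' (\<lambda>c. c) M M"

lemma End_closed: "End \<tau> \<Longrightarrow> x \<in> carrier M \<Longrightarrow> \<tau> x \<in> carrier M"
  and End_add: "End \<tau> \<Longrightarrow> x \<in> carrier M \<Longrightarrow> y \<in> carrier M \<Longrightarrow> \<tau> (x \<oplus>\<^bsub>M\<^esub> y) = \<tau> x \<oplus>\<^bsub>M\<^esub> \<tau> y"
  and End_smult: "End \<tau> \<Longrightarrow> c \<in> carrier S' \<Longrightarrow> x \<in> carrier M \<Longrightarrow> \<tau> (c \<odot>\<^bsub>M\<^esub> x) = c \<odot>\<^bsub>M\<^esub> \<tau> x"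
  unfolding linear_along_def by blast+

lemma End_exists: assumes "f \<in> MR J \<rightarrow> carrier M" shows "\<exists>\<tau>. End \<tau> \<and> (\<forall>u\<in>MR J. \<tau> (m u) = f u)"
proof -
  have "(\<lambda>c. c) \<in> ring_hom S' S'" by (rule ring_hom_memI) auto
  then show ?thesis using Mm.linear_extension[OF Mm.module_axioms _ assms] by blast
qed

text \<open>
  The values that the theorem prescribes for \<open>T\<^sub>i\<close>, in terms of the direction of the wall: it is in \<open>\<Phi>\<^sub>J\<close> if the alcove leaves
  \<open>\<A>\<^sub>J\<close>, and a crossing outside \<open>\<Phi>\<^sub>J\<close> is negative if its direction is positive.
\<close>

definition gen_value :: "nat \<Rightarrow> ('a \<Rightarrow> 'a) \<Rightarrow> 'm" where
  "gen_value i u = (if u (aroot i) \<in> RJ J then \<iota> (wall_par (u (aroot i))) \<odot>\<^bsub>M\<^esub> m u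
     else (\<zeta> (wgt (u \<circ> s i)) \<odot>\<^bsub>M\<^esub> m (theta J (u \<circ> s i))) \<oplus>\<^bsub>M\<^esub>
       \<iota> (if u (aroot i) \<in> pos then qdiff \<Phi> \<alpha> i else 0) \<odot>\<^bsub>M\<^esub> m u)"

definition stab_value :: "('a \<Rightarrow> 'a) \<Rightarrow> ('a \<Rightarrow> 'a) \<Rightarrow> 'm" where
  "stab_value \<sigma> u = \<zeta> (wgt (u \<circ> \<sigma>)) \<odot>\<^bsub>M\<^esub> m (theta J (u \<circ> \<sigma>))"

lemma translated_basis_closed: assumes "u \<in> MR J" "x \<in> EW"
  shows "\<zeta> (wgt (u \<circ> x)) \<odot>\<^bsub>M\<^esub> m (theta J (u \<circ> x)) \<in> carrier M"
proof -
  have "u \<circ> x \<in> EW" using ext_comp_mem weyl_ext(1)[OF min_rep_weyl] assms by blast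
  then show ?thesis using zJ_closed[OF wt_lattice] Mm.basis_closed theta_decomp(2)[OF J] by blast
qed

lemma sc_if_closed: "i \<in> {0..DIM('a)} \<Longrightarrow> \<iota> (if Q then qdiff \<Phi> \<alpha> i else 0) \<in> carrier S'"
  using sc_closed[OF qdiff_closed] sc_closed[OF R_closed(2)] by simp

lemma sc_zero: "\<iota> 0 = \<zero>\<^bsub>S'\<^esub>"
  using ring_hom_zero[OF sc_hom Hm.R.ring_axioms Mm.R.ring_axioms] by simp

lemma gen_value_closed: assumes i: "i \<in> {0..DIM('a)}" and u: "u \<in> MR J" shows "gen_value i u \<in> carrier M"
proof -
  have "\<iota> (wall_par (u (aroot i))) \<in> carrier S'"
    using sc_closed wall_par_closed weyl_root[OF min_rep_weyl[OF u]] aroot_root[OF i] by blast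
  then show ?thesis unfolding gen_value_def
    using translated_basis_closed[OF u s_ext(1)[OF i]] sc_if_closed[OF i] Mm.basis_closed[OF u]
    by (auto intro!: Mm.smult_closed Mm.M.add.m_closed simp del: if_split)
qed

text \<open>
  Outside \<open>\<Phi>\<^sub>J\<close> the formula for the minimal representative is carried over by \<open>vec_comp\<close>. Inside, \<open>w\<close> and \<open>w s\<^sub>i\<close> have the same
  basis vector, and the coefficients agree by \<open>fold_coeff_crossing_in\<close>.
\<close>

lemma End_gen_vec:
  assumes \<tau>: "End \<tau>" "\<And>u. u \<in> MR J \<Longrightarrow> \<tau> (m u) = gen_value i u" and w: "w \<in> EW" and i: "i \<in> {0..DIM('a)}"
  shows "\<tau> (vec w) = vec (w \<circ> s i) \<oplus>\<^bsub>M\<^esub> \<iota> (if lin w (aroot i) \<in> pos then qdiff \<Phi> \<alpha> i else 0) \<odot>\<^bsub>M\<^esub> vec w"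
proof -
  define u where "u = theta J w"
  define q where "q = (if lin w (aroot i) \<in> pos then qdiff \<Phi> \<alpha> i else 0)"
  have uM: "u \<in> MR J" using theta_decomp(2)[OF J w] by (simp add: u_def)
  have uW: "u \<in> W0" and uE: "u \<in> EW" using min_rep_weyl[OF uM] weyl_ext by blast+
  have si: "s i \<in> EW" using s_ext i by blast
  have ws: "w \<circ> s i \<in> EW" and us: "u \<circ> s i \<in> EW" using ext_comp_mem w uE si by blast+
  have muc: "m u \<in> carrier M" using Mm.basis_closed uM by blast
  have qc: "q \<in> carrier R" using qdiff_closed[OF i] R_closed by (simp add: q_def)
  have sq: "\<iota> q \<in> carrier S'" using sc_closed qc by blast
  have wz: "\<zeta> (wgt w) \<in> carrier S'" using zJ_closed wt_lattice w by blast
  have c1: "\<iota> (fold_coeff w) \<in> carrier S'" "\<iota> (fold_coeff (w \<circ> s i)) \<in> carrier S'" using sc_closed fold_coeff_closed by blast+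
  have tm: "\<tau> (vec w) = coeff w \<odot>\<^bsub>M\<^esub> gen_value i u"
    unfolding vec_def u_def[symmetric] using End_smult[OF \<tau>(1) coeff_closed[OF w] muc] \<tau>(2)[OF uM] by simp
  have RJ: "lin w (aroot i) \<in> RJ J \<longleftrightarrow> u (aroot i) \<in> RJ J" using RJ_theta_wall(1)[OF J w] by (simp add: u_def)
  show ?thesis
  proof (cases "u (aroot i) \<in> RJ J")
    case True
    obtain y where y: "y \<in> WJ J" "lin w = y \<circ> u" using theta_decomp(1)[OF J w] unfolding u_def by blast
    define n where "n = wall_par (u (aroot i))"
    have n: "wall_par (lin w (aroot i)) = n" using wall_par_invariant[OF y(1)] y(2) by (simp add: n_def)
    have nc: "n \<in> carrier R" using wall_par_closed RJ_root True by (simp add: n_def)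
    have key: "fold_coeff w * n = fold_coeff (w \<circ> s i) + q * fold_coeff w"
      using fold_coeff_crossing_in[OF w i] RJ True n by (simp add: q_def)
    have th: "theta J (u \<circ> s i) = u" and tw: "wgt (u \<circ> s i) \<in> QJ J" using theta_wall_in_RJ[OF J uM i True] by blast+
    have mws: "vec (w \<circ> s i) = (\<iota> (fold_coeff (w \<circ> s i)) \<otimes>\<^bsub>S'\<^esub> \<zeta> (wgt w)) \<odot>\<^bsub>M\<^esub> m u"
      using vec_comp[OF w si] zJ_QJ[OF tw] th muc by (simp add: u_def[symmetric])
    have "\<iota> (fold_coeff w) \<otimes>\<^bsub>S'\<^esub> \<iota> n = \<iota> (fold_coeff (w \<circ> s i)) \<oplus>\<^bsub>S'\<^esub> \<iota> q \<otimes>\<^bsub>S'\<^esub> \<iota> (fold_coeff w)"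
      using sc_mult[OF fold_coeff_closed nc, of J w] sc_add[OF fold_coeff_closed R_closed(3)[OF qc fold_coeff_closed], of J "w \<circ> s i" w]
        sc_mult[OF qc fold_coeff_closed, of J w] key by simp
    moreover have "coeff w \<otimes>\<^bsub>S'\<^esub> \<iota> n = (\<iota> (fold_coeff w) \<otimes>\<^bsub>S'\<^esub> \<iota> n) \<otimes>\<^bsub>S'\<^esub> \<zeta> (wgt w)"
      using c1 wz sc_closed[OF nc, of J] by (simp add: coeff_def Mm.R.m_ac)
    ultimately have "coeff w \<otimes>\<^bsub>S'\<^esub> \<iota> n = \<iota> (fold_coeff (w \<circ> s i)) \<otimes>\<^bsub>S'\<^esub> \<zeta> (wgt w) \<oplus>\<^bsub>S'\<^esub> \<iota> q \<otimes>\<^bsub>S'\<^esub> coeff w"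
      using c1 wz sq by (simp add: coeff_def Mm.R.l_distr Mm.R.m_assoc)
    then have "(coeff w \<otimes>\<^bsub>S'\<^esub> \<iota> n) \<odot>\<^bsub>M\<^esub> m u = vec (w \<circ> s i) \<oplus>\<^bsub>M\<^esub> \<iota> q \<odot>\<^bsub>M\<^esub> vec w"
      unfolding mws vec_def[of w] u_def[symmetric] using c1 wz sq coeff_closed[OF w] muc
      by (simp add: Mm.smult_l_distr Mm.smult_assoc1)
    moreover have "\<tau> (vec w) = (coeff w \<otimes>\<^bsub>S'\<^esub> \<iota> n) \<odot>\<^bsub>M\<^esub> m u"
      using tm True coeff_closed[OF w] sc_closed[OF nc, of J] muc by (simp add: gen_value_def n_def Mm.smult_assoc1)
    ultimately show ?thesis unfolding q_def by (simp only:)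
  next
    case False
    have qe: "(if u (aroot i) \<in> pos then qdiff \<Phi> \<alpha> i else 0) = q"
      using RJ_theta_wall(2)[OF J w aroot_root[OF i]] False RJ by (simp add: q_def u_def)
    define z where "z = \<zeta> (wgt (u \<circ> s i)) \<odot>\<^bsub>M\<^esub> m (theta J (u \<circ> s i))"
    have zc: "z \<in> carrier M" using translated_basis_closed[OF uM si] by (simp add: z_def)
    have "fold_coeff (w \<circ> s i) = fold_coeff w" using fold_coeff_crossing_out[OF w i] RJ False by blast
    then have mws: "vec (w \<circ> s i) = coeff w \<odot>\<^bsub>M\<^esub> z"
      using vec_comp[OF w si] by (simp add: z_def coeff_def u_def)
    have "\<tau> (vec w) = coeff w \<odot>\<^bsub>M\<^esub> (z \<oplus>\<^bsub>M\<^esub> \<iota> q \<odot>\<^bsub>M\<^esub> m u)"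
      unfolding tm using False qe by (simp add: gen_value_def z_def)
    also have "\<dots> = vec (w \<circ> s i) \<oplus>\<^bsub>M\<^esub> coeff w \<odot>\<^bsub>M\<^esub> (\<iota> q \<odot>\<^bsub>M\<^esub> m u)"
      unfolding mws using coeff_closed[OF w] zc sq muc by (intro Mm.smult_r_distr) auto
    also have "coeff w \<odot>\<^bsub>M\<^esub> (\<iota> q \<odot>\<^bsub>M\<^esub> m u) = \<iota> q \<odot>\<^bsub>M\<^esub> vec w"
      unfolding vec_def u_def[symmetric] using coeff_closed[OF w] sq muc
      by (simp add: Mm.smult_assoc1[symmetric] Mm.R.m_comm)
    finally show ?thesis unfolding q_def .
  qed
qed

lemma End_stab_vec:
  assumes \<tau>: "End \<tau>" "\<And>u. u \<in> MR J \<Longrightarrow> \<tau> (m u) = stab_value \<sigma> u" and w: "w \<in> EW" and \<sigma>: "\<sigma> \<in> Stab"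
  shows "\<tau> (vec w) = vec (w \<circ> \<sigma>)"
proof -
  have uM: "theta J w \<in> MR J" using theta_decomp(2)[OF J w] .
  have "\<tau> (vec w) = coeff w \<odot>\<^bsub>M\<^esub> stab_value \<sigma> (theta J w)"
    unfolding vec_def using End_smult[OF \<tau>(1) coeff_closed[OF w] Mm.basis_closed[OF uM]] \<tau>(2)[OF uM] by simp
  also have "\<dots> = vec (w \<circ> \<sigma>)"
    unfolding vec_comp[OF w stab_ext[OF \<sigma>]] fold_coeff_stab[OF w \<sigma>] stab_value_def coeff_def by (rule HOL.refl)
  finally show ?thesis .
qed

subsection \<open>From the regular representation to the action\<close>

definition proj :: "'h \<Rightarrow> 'm" where
  "proj = (SOME L. linear_along R \<iota> H M L \<and> (\<forall>w\<in>EW. L (T w) = vec w))"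

lemma proj: "linear_along R \<iota> H M proj" "w \<in> EW \<Longrightarrow> proj (T w) = vec w"
proof -
  have "\<exists>L. linear_along R \<iota> H M L \<and> (\<forall>w\<in>EW. L (T w) = vec w)"
    using vec_closed by (intro Hm.linear_extension[OF Mm.module_axioms sc_hom]) blast
  then have "linear_along R \<iota> H M proj \<and> (\<forall>w\<in>EW. proj (T w) = vec w)"
    unfolding proj_def by (rule someI_ex)
  then show "linear_along R \<iota> H M proj" "w \<in> EW \<Longrightarrow> proj (T w) = vec w" by blast+
qed

lemma proj_closed: "x \<in> carrier H \<Longrightarrow> proj x \<in> carrier M"
  and proj_add: "x \<in> carrier H \<Longrightarrow> y \<in> carrier H \<Longrightarrow> proj (x \<oplus>\<^bsub>H\<^esub> y) = proj x \<oplus>\<^bsub>M\<^esub> proj y"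
  and proj_smult: "r \<in> carrier R \<Longrightarrow> x \<in> carrier H \<Longrightarrow> proj (r \<odot>\<^bsub>H\<^esub> x) = \<iota> r \<odot>\<^bsub>M\<^esub> proj x"
  using proj(1) unfolding linear_along_def by blast+

text \<open>
  The alcoves inside the dominant chamber that are at least \<open>d\<close> strips away from its walls.
\<close>

definition deep :: "nat \<Rightarrow> ('a \<Rightarrow> 'a) set" where
  "deep d = {w \<in> EW. \<forall>b\<in>pos. int d \<le> strip b w}"

lemma deep_ext: "w \<in> deep d \<Longrightarrow> w \<in> EW" and deep_sub: "deep d \<subseteq> EW"
  by (auto simp: deep_def)

lemma deep_mono: "d \<le> d' \<Longrightarrow> deep d' \<subseteq> deep d"
  by (force simp: deep_def)

lemma deep_cross: assumes "w \<in> deep (Suc d)" "i \<in> {0..DIM('a)}" shows "w \<circ> s i \<in> deep d"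
proof -
  have w: "w \<in> EW" using assms(1) by (rule deep_ext)
  have "int d \<le> strip b (w \<circ> s i)" if b: "b \<in> pos" for b
  proof -
    have "int (Suc d) \<le> strip b w" using assms(1) b unfolding deep_def by blast
    then show ?thesis using crossing[OF w assms(2) pos_root[OF b]] by (auto simp: along_def)
  qed
  then show ?thesis using ext_comp_mem[OF w s_ext(1)[OF assms(2)]] unfolding deep_def by blast
qed

lemma deep_stab: "w \<in> deep d \<Longrightarrow> \<sigma> \<in> Stab \<Longrightarrow> w \<circ> \<sigma> \<in> deep d"
  unfolding deep_def using ext_comp_mem[OF _ stab_ext] strip_stab pos_root by simp

text \<open>
  A linear part lowers a strip number by at most 1, which the summand 1 makes up for.
\<close>

lemma deep_translate:
  assumes u: "u \<in> W0" shows "transl (of_int (int d + 1) *\<^sub>R rho) \<circ> u \<in> deep d"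
proof -
  define l where "l = of_int (int d + 1) *\<^sub>R rho"
  have l: "l \<in> P" using lattice_scale rho_lattice by (simp only: l_def)
  have "int d \<le> strip b (transl l \<circ> u)" if b: "b \<in> pos" for b
  proof -
    have bR: "b \<in> \<Phi>" using b by (rule pos_root)
    have "(real d + 1) * 1 \<le> (real d + 1) * (rho \<bullet> b)"
      using rho_pos_ge_1[OF b] by (intro mult_left_mono) auto
    then have "of_int (int d + 1) \<le> l \<bullet> b" by (simp add: l_def)
    then have "int d + 1 \<le> \<lfloor>l \<bullet> b\<rfloor>" by (simp only: le_floor_iff)
    moreover have "- 1 \<le> strip b u" using strip_formula[OF weyl_ext(1)[OF u] bR] weyl_ext[OF u] by simp
    ultimately show ?thesis using strip_transl[OF l bR] by simp
  qed
  then show ?thesis using ext_weylI[OF l u] unfolding deep_def l_def by blast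
qed

definition deep_span :: "nat \<Rightarrow> 'h set" where "deep_span d = rspan R H T (deep d)"

lemma deep_span_closed: "x \<in> deep_span d \<Longrightarrow> x \<in> carrier H"
  unfolding deep_span_def by (rule Hm.rspan_closed[OF deep_sub])

lemma deep_span_add: "x \<in> deep_span d \<Longrightarrow> y \<in> deep_span d \<Longrightarrow> x \<oplus>\<^bsub>H\<^esub> y \<in> deep_span d"
  unfolding deep_span_def by (rule rspan.add)

lemma deep_span_smult: "r \<in> carrier R \<Longrightarrow> x \<in> deep_span d \<Longrightarrow> r \<odot>\<^bsub>H\<^esub> x \<in> deep_span d"
  unfolding deep_span_def by (rule Hm.rspan_smult[OF deep_sub])

lemma deep_span_T: "w \<in> deep d \<Longrightarrow> T w \<in> deep_span d"
  unfolding deep_span_def by (rule Hm.rspan_basis[OF _ deep_sub])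

lemma deep_span_zero: "\<zero>\<^bsub>H\<^esub> \<in> deep_span d"
  unfolding deep_span_def by (rule rspan.zero)

lemma deep_span_mono: assumes "d \<le> d'" "x \<in> deep_span d'" shows "x \<in> deep_span d"
  using assms(2) unfolding deep_span_def
  by induction (use deep_mono[OF assms(1)] in \<open>auto intro: rspan.intros\<close>)

text \<open>
  Right multiplication by \<open>h\<close> lowers the depth by at most \<open>e\<close>, and at depth at least \<open>e\<close> it induces \<open>\<tau>\<close>.
\<close>

definition drift :: "nat \<Rightarrow> 'h \<Rightarrow> ('m \<Rightarrow> 'm) \<Rightarrow> bool" where
  "drift e h \<tau> \<longleftrightarrow> (\<forall>d. \<forall>x\<in>deep_span (d + e). x \<otimes>\<^bsub>H\<^esub> h \<in> deep_span d \<and> proj (x \<otimes>\<^bsub>H\<^esub> h) = \<tau> (proj x))"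

definition compat :: "'h \<Rightarrow> ('m \<Rightarrow> 'm) \<Rightarrow> bool" where
  "compat h \<tau> \<longleftrightarrow> h \<in> carrier H \<and> End \<tau> \<and> (\<exists>e. drift e h \<tau>)"

lemma End_zero: assumes "End \<tau>" shows "\<tau> \<zero>\<^bsub>M\<^esub> = \<zero>\<^bsub>M\<^esub>"
proof -
  have "\<tau> \<zero>\<^bsub>M\<^esub> = \<tau> \<zero>\<^bsub>M\<^esub> \<oplus>\<^bsub>M\<^esub> \<tau> \<zero>\<^bsub>M\<^esub>"
    using End_add[OF assms Mm.M.zero_closed Mm.M.zero_closed] by simp
  then show ?thesis using End_closed[OF assms Mm.M.zero_closed] by (metis Mm.M.add.r_cancel_one')
qed

lemma proj_zero: "proj \<zero>\<^bsub>H\<^esub> = \<zero>\<^bsub>M\<^esub>"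
proof -
  have "proj \<zero>\<^bsub>H\<^esub> = proj \<zero>\<^bsub>H\<^esub> \<oplus>\<^bsub>M\<^esub> proj \<zero>\<^bsub>H\<^esub>"
    using proj_add[OF Hm.M.zero_closed Hm.M.zero_closed] by simp
  then show ?thesis using proj_closed[OF Hm.M.zero_closed] by (metis Mm.M.add.r_cancel_one')
qed

lemma driftI:
  assumes h: "h \<in> carrier H" and \<tau>: "End \<tau>"
    and gen: "\<And>d w. w \<in> deep (d + e) \<Longrightarrow> T w \<otimes>\<^bsub>H\<^esub> h \<in> deep_span d \<and> proj (T w \<otimes>\<^bsub>H\<^esub> h) = \<tau> (vec w)"
  shows "drift e h \<tau>"
  unfolding drift_def
proof (intro allI ballI)
  interpret HR: ring H by (rule H_ring)
  fix d x assume "x \<in> deep_span (d + e)"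
  then show "x \<otimes>\<^bsub>H\<^esub> h \<in> deep_span d \<and> proj (x \<otimes>\<^bsub>H\<^esub> h) = \<tau> (proj x)"
    unfolding deep_span_def[of "d + e"]
  proof induction
    case zero
    then show ?case using h deep_span_zero proj_zero End_zero[OF \<tau>] by simp
  next
    case (add x y)
    have xy: "x \<in> carrier H" "y \<in> carrier H" using add deep_span_closed unfolding deep_span_def by blast+
    have "(x \<oplus>\<^bsub>H\<^esub> y) \<otimes>\<^bsub>H\<^esub> h = x \<otimes>\<^bsub>H\<^esub> h \<oplus>\<^bsub>H\<^esub> y \<otimes>\<^bsub>H\<^esub> h" using xy h by (rule HR.l_distr)
    then show ?case using add deep_span_add xy h proj_add End_add[OF \<tau>] proj_closed by simp
  next
    case (gen r w)
    have w: "w \<in> EW" using gen deep_ext by blast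
    have Tw: "T w \<in> carrier H" using Hm.basis_closed w by blast
    have "(r \<odot>\<^bsub>H\<^esub> T w) \<otimes>\<^bsub>H\<^esub> h = r \<odot>\<^bsub>H\<^esub> (T w \<otimes>\<^bsub>H\<^esub> h)" using H_smult_mult(1) gen Tw h by blast
    moreover have "proj (r \<odot>\<^bsub>H\<^esub> (T w \<otimes>\<^bsub>H\<^esub> h)) = \<iota> r \<odot>\<^bsub>M\<^esub> \<tau> (vec w)"
      using proj_smult[OF gen(1) HR.m_closed[OF Tw h]] assms(3)[OF gen(2)] by simp
    moreover have "\<tau> (proj (r \<odot>\<^bsub>H\<^esub> T w)) = \<iota> r \<odot>\<^bsub>M\<^esub> \<tau> (vec w)"
      using proj_smult[OF gen(1) Tw] proj(2)[OF w] End_smult[OF \<tau> sc_closed[OF gen(1)] vec_closed[OF w]] by simp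
    ultimately show ?case using deep_span_smult[OF gen(1)] assms(3)[OF gen(2)] by simp
  qed
qed

lemma drift_weaken: assumes "drift e h \<tau>" "e \<le> e'" shows "drift e' h \<tau>"
  unfolding drift_def
proof (intro allI ballI)
  fix d x assume "x \<in> deep_span (d + e')"
  then have "x \<in> deep_span (d + e)" using deep_span_mono[of "d + e" "d + e'"] assms(2) by simp
  then show "x \<otimes>\<^bsub>H\<^esub> h \<in> deep_span d \<and> proj (x \<otimes>\<^bsub>H\<^esub> h) = \<tau> (proj x)" using assms(1) unfolding drift_def by blast
qed

text \<open>
  The vector of \<open>t\<^sub>l u\<close>, with \<open>l\<close> a large multiple of \<open>rho\<close>, is a unit times \<open>m u\<close>, and \<open>t\<^sub>l u\<close> is deep enough for both operators.
\<close>

lemma compat_unique: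
  assumes "compat h \<tau>" "compat h \<tau>'" "x \<in> carrier M" shows "\<tau> x = \<tau>' x"
proof (rule Mm.linear_determined[OF Mm.module_axioms _ _ _ assms(3)])
  show E: "End \<tau>" "End \<tau>'" using assms by (auto simp: compat_def)
  obtain e e' where "drift e h \<tau>" "drift e' h \<tau>'" using assms by (auto simp: compat_def)
  then have dr: "drift (e + e') h \<tau>" "drift (e + e') h \<tau>'" using drift_weaken by simp_all
  fix u assume u: "u \<in> MR J"
  have uW: "u \<in> W0" using min_rep_weyl u .
  define l where "l = of_int (int (e + e') + 1) *\<^sub>R rho"
  define w where "w = transl l \<circ> u"
  have l: "l \<in> P" using lattice_scale rho_lattice by (simp only: l_def)
  have wd: "w \<in> deep (0 + (e + e'))" using deep_translate[OF uW, of "e + e'"] unfolding w_def l_def add_0 .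
  then have w: "w \<in> EW" by (rule deep_ext)
  have "proj (T w \<otimes>\<^bsub>H\<^esub> h) = \<tau> (proj (T w))" "proj (T w \<otimes>\<^bsub>H\<^esub> h) = \<tau>' (proj (T w))"
    using dr deep_span_T[OF wd] unfolding drift_def by blast+
  then have "\<tau> (vec w) = \<tau>' (vec w)" by (simp only: proj(2)[OF w])
  moreover have "theta J w = u"
    using theta_eq[OF J u parabolic_id] lin_transl[OF l uW] by (simp add: w_def)
  ultimately have eq: "coeff w \<odot>\<^bsub>M\<^esub> \<tau> (m u) = coeff w \<odot>\<^bsub>M\<^esub> \<tau>' (m u)"
    using End_smult[OF E(1) coeff_closed[OF w] Mm.basis_closed[OF u]]
      End_smult[OF E(2) coeff_closed[OF w] Mm.basis_closed[OF u]] by (simp add: vec_def)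
  obtain c where c: "c \<in> carrier S'" "c \<otimes>\<^bsub>S'\<^esub> coeff w = \<one>\<^bsub>S'\<^esub>" using coeff_unit[OF w] by blast
  have cancel: "c \<odot>\<^bsub>M\<^esub> (coeff w \<odot>\<^bsub>M\<^esub> y) = y" if "y \<in> carrier M" for y
    using Mm.smult_assoc1[OF c(1) coeff_closed[OF w] that] c(2) that by simp
  have "\<tau> (m u) = c \<odot>\<^bsub>M\<^esub> (coeff w \<odot>\<^bsub>M\<^esub> \<tau> (m u))"
    by (rule cancel[OF End_closed[OF E(1) Mm.basis_closed[OF u]], symmetric])
  also have "\<dots> = c \<odot>\<^bsub>M\<^esub> (coeff w \<odot>\<^bsub>M\<^esub> \<tau>' (m u))" by (rule arg_cong[OF eq])
  also have "\<dots> = \<tau>' (m u)" by (rule cancel[OF End_closed[OF E(2) Mm.basis_closed[OF u]]])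
  finally show "\<tau> (m u) = \<tau>' (m u)" .
qed

text \<open>
  Deep in the dominant chamber the multiplication rule of the Hecke algebra is the rule of \<open>End_gen_vec\<close>.
\<close>

lemma compat_gen:
  assumes i: "i \<in> {0..DIM('a)}" and \<tau>: "End \<tau>" "\<And>u. u \<in> MR J \<Longrightarrow> \<tau> (m u) = gen_value i u"
  shows "compat (T (s i)) \<tau>"
  unfolding compat_def
proof (intro conjI exI)
  show c: "T (s i) \<in> carrier H" using Hm.basis_closed s_ext i by blast
  show "End \<tau>" by (rule \<tau>(1))
  show "drift 1 (T (s i)) \<tau>"
  proof (rule driftI[OF c \<tau>(1)])
    fix d w assume "w \<in> deep (d + 1)"
    then have wd: "w \<in> deep (Suc d)" by simp
    then have w: "w \<in> EW" by (rule deep_ext)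
    have dom: "1 \<le> strip b w" if "b \<in> pos" for b using wd that by (force simp: deep_def)
    have w1: "w \<in> deep d" using wd deep_mono[of d "Suc d"] by auto
    have ws: "w \<circ> s i \<in> deep d" using deep_cross[OF wd i] .
    have wsE: "w \<circ> s i \<in> EW" using ws by (rule deep_ext)
    have Tc: "T w \<in> carrier H" "T (w \<circ> s i) \<in> carrier H" using Hm.basis_closed w wsE by blast+
    have mc: "vec (w \<circ> s i) \<in> carrier M" "vec w \<in> carrier M" using vec_closed w wsE by blast+
    note t = End_gen_vec[OF \<tau> w i]
    show "T w \<otimes>\<^bsub>H\<^esub> T (s i) \<in> deep_span d \<and> proj (T w \<otimes>\<^bsub>H\<^esub> T (s i)) = \<tau> (vec w)"
    proof (cases "lin w (aroot i) \<in> pos")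
      case True
      have e: "T w \<otimes>\<^bsub>H\<^esub> T (s i) = T (w \<circ> s i) \<oplus>\<^bsub>H\<^esub> qdiff \<Phi> \<alpha> i \<odot>\<^bsub>H\<^esub> T w"
        using T_mult_down[OF w i] len_dominant_crossing(1)[OF w i dom True] by blast
      have q: "qdiff \<Phi> \<alpha> i \<in> carrier R" using qdiff_closed i .
      have "proj (T w \<otimes>\<^bsub>H\<^esub> T (s i)) = vec (w \<circ> s i) \<oplus>\<^bsub>M\<^esub> \<iota> (qdiff \<Phi> \<alpha> i) \<odot>\<^bsub>M\<^esub> vec w"
        unfolding e using proj_add[OF Tc(2) Hm.smult_closed[OF q Tc(1)]] proj_smult[OF q Tc(1)] proj(2) w wsE by simp
      moreover have "T w \<otimes>\<^bsub>H\<^esub> T (s i) \<in> deep_span d" unfolding e by (intro deep_span_add deep_span_smult deep_span_T ws w1 q)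
      ultimately show ?thesis using t True by simp
    next
      case False
      have e: "T w \<otimes>\<^bsub>H\<^esub> T (s i) = T (w \<circ> s i)"
        using T_mult_up[OF w i] len_dominant_crossing(2)[OF w i dom False] by blast
      have "\<tau> (vec w) = vec (w \<circ> s i)" using t False sc_zero mc by simp
      then show ?thesis unfolding e using deep_span_T[OF ws] proj(2)[OF wsE] by simp
    qed
  qed
qed

lemma compat_stab:
  assumes \<sigma>: "\<sigma> \<in> Stab" and \<tau>: "End \<tau>" "\<And>u. u \<in> MR J \<Longrightarrow> \<tau> (m u) = stab_value \<sigma> u"
  shows "compat (T \<sigma>) \<tau>"
  unfolding compat_def
proof (intro conjI exI)
  show c: "T \<sigma> \<in> carrier H" using Hm.basis_closed stab_ext \<sigma> by blast
  show "End \<tau>" by (rule \<tau>(1))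
  show "drift 0 (T \<sigma>) \<tau>"
  proof (rule driftI[OF c \<tau>(1)])
    fix d w assume "w \<in> deep (d + 0)"
    then have wd: "w \<in> deep d" by simp
    then have w: "w \<in> EW" by (rule deep_ext)
    have ws: "w \<circ> \<sigma> \<in> deep d" using deep_stab wd \<sigma> .
    show "T w \<otimes>\<^bsub>H\<^esub> T \<sigma> \<in> deep_span d \<and> proj (T w \<otimes>\<^bsub>H\<^esub> T \<sigma>) = \<tau> (vec w)"
      using deep_span_T[OF ws] proj(2)[OF deep_ext[OF ws]] End_stab_vec[OF \<tau> w \<sigma>] T_mult_stab[OF w \<sigma>] by (simp only:)
  qed
qed

text \<open>
  The first factor may use up its drift as long as enough depth for the second one remains.
\<close>

lemma compat_mult:
  assumes "compat h \<tau>" "compat k \<tau>'" shows "compat (h \<otimes>\<^bsub>H\<^esub> k) (\<lambda>x. \<tau>' (\<tau> x))"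
proof -
  interpret HR: ring H by (rule H_ring)
  have hk: "h \<in> carrier H" "k \<in> carrier H" and E: "End \<tau>" "End \<tau>'" using assms by (auto simp: compat_def)
  obtain e e' where e: "drift e h \<tau>" and e': "drift e' k \<tau>'" using assms by (auto simp: compat_def)
  have "drift (e' + e) (h \<otimes>\<^bsub>H\<^esub> k) (\<lambda>x. \<tau>' (\<tau> x))"
    unfolding drift_def
  proof (intro allI ballI)
    fix d x assume "x \<in> deep_span (d + (e' + e))"
    then have x: "x \<in> deep_span ((d + e') + e)" by (simp add: add.assoc)
    then have 1: "x \<otimes>\<^bsub>H\<^esub> h \<in> deep_span (d + e')" "proj (x \<otimes>\<^bsub>H\<^esub> h) = \<tau> (proj x)" using e unfolding drift_def by blast+
    then have "(x \<otimes>\<^bsub>H\<^esub> h) \<otimes>\<^bsub>H\<^esub> k \<in> deep_span d" "proj ((x \<otimes>\<^bsub>H\<^esub> h) \<otimes>\<^bsub>H\<^esub> k) = \<tau>' (\<tau> (proj x))"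
      using e' unfolding drift_def by auto
    then show "x \<otimes>\<^bsub>H\<^esub> (h \<otimes>\<^bsub>H\<^esub> k) \<in> deep_span d \<and> proj (x \<otimes>\<^bsub>H\<^esub> (h \<otimes>\<^bsub>H\<^esub> k)) = \<tau>' (\<tau> (proj x))"
      using HR.m_assoc[OF deep_span_closed[OF x] hk] by simp
  qed
  moreover have "End (\<lambda>x. \<tau>' (\<tau> x))"
    unfolding linear_along_def using E End_closed End_add End_smult by auto
  ultimately show ?thesis unfolding compat_def using HR.m_closed hk by blast
qed

lemma compat_add:
  assumes "compat h \<tau>" "compat k \<tau>'" shows "compat (h \<oplus>\<^bsub>H\<^esub> k) (\<lambda>x. \<tau> x \<oplus>\<^bsub>M\<^esub> \<tau>' x)"
proof -
  interpret HR: ring H by (rule H_ring)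
  have hk: "h \<in> carrier H" "k \<in> carrier H" and E: "End \<tau>" "End \<tau>'" using assms by (auto simp: compat_def)
  obtain e e' where e: "drift e h \<tau>" and e': "drift e' k \<tau>'" using assms by (auto simp: compat_def)
  have f: "drift (e + e') h \<tau>" "drift (e + e') k \<tau>'" using drift_weaken[OF e] drift_weaken[OF e'] by simp_all
  have "drift (e + e') (h \<oplus>\<^bsub>H\<^esub> k) (\<lambda>x. \<tau> x \<oplus>\<^bsub>M\<^esub> \<tau>' x)"
    unfolding drift_def
  proof (intro allI ballI)
    fix d x assume x: "x \<in> deep_span (d + (e + e'))"
    have xc: "x \<in> carrier H" using deep_span_closed x .
    have 1: "x \<otimes>\<^bsub>H\<^esub> h \<in> deep_span d" "proj (x \<otimes>\<^bsub>H\<^esub> h) = \<tau> (proj x)" "x \<otimes>\<^bsub>H\<^esub> k \<in> deep_span d" "proj (x \<otimes>\<^bsub>H\<^esub> k) = \<tau>' (proj x)"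
      using f x unfolding drift_def by blast+
    show "x \<otimes>\<^bsub>H\<^esub> (h \<oplus>\<^bsub>H\<^esub> k) \<in> deep_span d \<and> proj (x \<otimes>\<^bsub>H\<^esub> (h \<oplus>\<^bsub>H\<^esub> k)) = \<tau> (proj x) \<oplus>\<^bsub>M\<^esub> \<tau>' (proj x)"
      using HR.r_distr[OF hk xc] deep_span_add[OF 1(1,3)] proj_add[OF HR.m_closed[OF xc hk(1)] HR.m_closed[OF xc hk(2)]] 1(2,4)
      by simp
  qed
  moreover have "End (\<lambda>x. \<tau> x \<oplus>\<^bsub>M\<^esub> \<tau>' x)"
    unfolding linear_along_def
    using End_closed[OF E(1)] End_closed[OF E(2)] End_add[OF E(1)] End_add[OF E(2)] End_smult[OF E(1)] End_smult[OF E(2)]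
    by (auto simp: Mm.M.a_ac Mm.smult_r_distr)
  ultimately show ?thesis unfolding compat_def using Hm.M.add.m_closed hk by blast
qed

lemma compat_smult:
  assumes "compat h \<tau>" "r \<in> carrier R" shows "compat (r \<odot>\<^bsub>H\<^esub> h) (\<lambda>x. \<iota> r \<odot>\<^bsub>M\<^esub> \<tau> x)"
proof -
  interpret HR: ring H by (rule H_ring)
  have h: "h \<in> carrier H" and E: "End \<tau>" using assms by (auto simp: compat_def)
  obtain e where e: "drift e h \<tau>" using assms by (auto simp: compat_def)
  have sr: "\<iota> r \<in> carrier S'" using sc_closed assms by blast
  have "drift e (r \<odot>\<^bsub>H\<^esub> h) (\<lambda>x. \<iota> r \<odot>\<^bsub>M\<^esub> \<tau> x)"
    unfolding drift_def
  proof (intro allI ballI)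
    fix d x assume x: "x \<in> deep_span (d + e)"
    have xc: "x \<in> carrier H" using deep_span_closed x .
    have 1: "x \<otimes>\<^bsub>H\<^esub> h \<in> deep_span d" "proj (x \<otimes>\<^bsub>H\<^esub> h) = \<tau> (proj x)" using e x unfolding drift_def by blast+
    show "x \<otimes>\<^bsub>H\<^esub> (r \<odot>\<^bsub>H\<^esub> h) \<in> deep_span d \<and> proj (x \<otimes>\<^bsub>H\<^esub> (r \<odot>\<^bsub>H\<^esub> h)) = \<iota> r \<odot>\<^bsub>M\<^esub> \<tau> (proj x)"
      using H_smult_mult(2)[OF assms(2) xc h] deep_span_smult[OF assms(2) 1(1)] proj_smult[OF assms(2) HR.m_closed[OF xc h]] 1(2)
      by simp
  qed
  moreover have "End (\<lambda>x. \<iota> r \<odot>\<^bsub>M\<^esub> \<tau> x)"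
  proof -
    have "\<iota> r \<odot>\<^bsub>M\<^esub> (c \<odot>\<^bsub>M\<^esub> y) = c \<odot>\<^bsub>M\<^esub> (\<iota> r \<odot>\<^bsub>M\<^esub> y)" if "c \<in> carrier S'" "y \<in> carrier M" for c y
      using Mm.smult_assoc1[OF sr that] Mm.smult_assoc1[OF that(1) sr that(2)] Mm.R.m_comm[OF sr that(1)] by simp
    then show ?thesis unfolding linear_along_def
      using End_closed[OF E] End_add[OF E] End_smult[OF E] sr by (auto simp: Mm.smult_r_distr)
  qed
  ultimately show ?thesis unfolding compat_def using Hm.smult_closed h assms by blast
qed

lemma compat_one: "compat \<one>\<^bsub>H\<^esub> (\<lambda>x. x)"
proof -
  interpret HR: ring H by (rule H_ring)
  have "drift 0 \<one>\<^bsub>H\<^esub> (\<lambda>x. x)" unfolding drift_def using deep_span_closed by simp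
  moreover have "End (\<lambda>x. x)" by (auto simp: linear_along_def)
  ultimately show ?thesis by (auto simp: compat_def)
qed

lemma compat_zero: "compat \<zero>\<^bsub>H\<^esub> (\<lambda>x. \<zero>\<^bsub>M\<^esub>)"
proof -
  interpret HR: ring H by (rule H_ring)
  have "drift 0 \<zero>\<^bsub>H\<^esub> (\<lambda>x. \<zero>\<^bsub>M\<^esub>)" unfolding drift_def using deep_span_closed deep_span_zero proj_zero by simp
  moreover have "End (\<lambda>x. \<zero>\<^bsub>M\<^esub>)" by (auto simp: linear_along_def)
  ultimately show ?thesis by (auto simp: compat_def)
qed

lemma gen_operator: assumes i: "i \<in> {0..DIM('a)}"
  shows "\<exists>\<tau>. compat (T (s i)) \<tau> \<and> (\<forall>u\<in>MR J. \<tau> (m u) = gen_value i u)"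
proof -
  have "gen_value i \<in> MR J \<rightarrow> carrier M" using gen_value_closed[OF i] by blast
  then obtain \<tau> where "End \<tau>" "\<forall>u\<in>MR J. \<tau> (m u) = gen_value i u" using End_exists by blast
  then show ?thesis using compat_gen[OF i] by blast
qed

lemma stab_operator: assumes \<sigma>: "\<sigma> \<in> Stab"
  shows "\<exists>\<tau>. compat (T \<sigma>) \<tau> \<and> (\<forall>u\<in>MR J. \<tau> (m u) = stab_value \<sigma> u)"
proof -
  have "stab_value \<sigma> \<in> MR J \<rightarrow> carrier M" using translated_basis_closed[OF _ stab_ext[OF \<sigma>]] unfolding stab_value_def by blast
  then obtain \<tau> where "End \<tau>" "\<forall>u\<in>MR J. \<tau> (m u) = stab_value \<sigma> u" using End_exists by blast
  then show ?thesis using compat_stab[OF \<sigma>] by blast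
qed

text \<open>
  Induction on the length, splitting off a last letter.
\<close>

lemma compat_T: "w \<in> EW \<Longrightarrow> \<exists>\<tau>. compat (T w) \<tau>"
proof (induction "sep_count w" arbitrary: w)
  case 0
  then have "w \<in> Stab" using sep_count_zero_stab by simp
  then show ?case using stab_operator by blast
next
  case (Suc n)
  then have "sep_count w \<noteq> 0" by simp
  then obtain i where i: "i \<in> {0..DIM('a)}" "sep_count (w \<circ> s i) + 1 = sep_count w" using sep_count_descent[OF Suc(3)] by blast
  have ws: "w \<circ> s i \<in> EW" using ext_comp_mem[OF Suc(3) s_ext(1)[OF i(1)]] .
  have "w \<circ> s i \<circ> s i = w \<circ> (s i \<circ> s i)" by (simp only: comp_assoc)
  then have e: "w \<circ> s i \<circ> s i = w" by (simp only: s_invol[OF i(1)] comp_id)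
  have "n = sep_count (w \<circ> s i)" using i(2) Suc(2) by simp
  then obtain \<tau> where \<tau>: "compat (T (w \<circ> s i)) \<tau>" using Suc(1) ws by blast
  obtain \<tau>' where "compat (T (s i)) \<tau>'" using gen_operator[OF i(1)] by blast
  then have "compat (T (w \<circ> s i) \<otimes>\<^bsub>H\<^esub> T (s i)) (\<lambda>x. \<tau>' (\<tau> x))" using compat_mult \<tau> by blast
  moreover have "T (w \<circ> s i) \<otimes>\<^bsub>H\<^esub> T (s i) = T w"
    using T_mult_up[OF ws i(1)] len_eq[OF ws] len_eq[OF Suc(3)] i(2) unfolding e by simp
  ultimately show ?case by auto
qed

lemma compat_exists: assumes "h \<in> carrier H" shows "\<exists>\<tau>. compat h \<tau>"
proof -
  have "h \<in> rspan R H T EW" using Hm.rspan_full assms .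
  then show ?thesis
  proof induction
    case zero show ?case using compat_zero by blast
  next
    case (add x y) then show ?case using compat_add by blast
  next
    case (gen r w) then show ?case using compat_T compat_smult by blast
  qed
qed

definition act :: "'m \<Rightarrow> 'h \<Rightarrow> 'm" where "act x h = (SOME \<tau>. compat h \<tau>) x"

lemma act_compat: "h \<in> carrier H \<Longrightarrow> compat h (\<lambda>x. act x h)"
  unfolding act_def using someI_ex[OF compat_exists] by simp

lemma act_eq: "compat h \<tau> \<Longrightarrow> x \<in> carrier M \<Longrightarrow> act x h = \<tau> x"
  using compat_unique[OF act_compat] by (auto simp: compat_def)

lemma right_action: "right_action R S' \<iota> H M act"
proof -
  interpret HR: ring H by (rule H_ring)
  have E: "End (\<lambda>x. act x h)" if "h \<in> carrier H" for h using act_compat[OF that] by (simp add: compat_def)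
  show ?thesis
    unfolding right_action_def
  proof (intro conjI ballI)
    show "act x h \<in> carrier M" if "x \<in> carrier M" "h \<in> carrier H" for x h
      using End_closed[OF E] that by blast
    show "act (x \<oplus>\<^bsub>M\<^esub> y) h = act x h \<oplus>\<^bsub>M\<^esub> act y h" if "x \<in> carrier M" "y \<in> carrier M" "h \<in> carrier H" for x y h
      using End_add[OF E] that by blast
    show "act (c \<odot>\<^bsub>M\<^esub> x) h = c \<odot>\<^bsub>M\<^esub> act x h" if "c \<in> carrier S'" "x \<in> carrier M" "h \<in> carrier H" for c x h
      using End_smult[OF E] that by blast
    show "act x (h \<oplus>\<^bsub>H\<^esub> k) = act x h \<oplus>\<^bsub>M\<^esub> act x k" if "x \<in> carrier M" "h \<in> carrier H" "k \<in> carrier H" for x h k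
      using act_eq[OF compat_add[OF act_compat act_compat]] that by blast
    show "act x (r \<odot>\<^bsub>H\<^esub> h) = \<iota> r \<odot>\<^bsub>M\<^esub> act x h" if "r \<in> carrier R" "x \<in> carrier M" "h \<in> carrier H" for r x h
      using act_eq[OF compat_smult[OF act_compat]] that by blast
    show "act x \<one>\<^bsub>H\<^esub> = x" if "x \<in> carrier M" for x
      using act_eq[OF compat_one] that by blast
    show "act x (h \<otimes>\<^bsub>H\<^esub> k) = act (act x h) k" if "x \<in> carrier M" "h \<in> carrier H" "k \<in> carrier H" for x h k
      using act_eq[OF compat_mult[OF act_compat act_compat]] that by blast
  qed
qed

lemma act_gen: assumes "i \<in> {0..DIM('a)}" "u \<in> MR J" shows "act (m u) (T (s i)) = gen_value i u"
  using gen_operator[OF assms(1)] act_eq[OF _ Mm.basis_closed[OF assms(2)]] assms(2) by metis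

lemma act_stab:
  assumes "\<sigma> \<in> Stab" "u \<in> MR J"
  shows "act (m u) (T \<sigma>) = \<zeta> (wgt (u \<circ> \<sigma>)) \<odot>\<^bsub>M\<^esub> m (theta J (u \<circ> \<sigma>))"
  unfolding stab_value_def[symmetric]
  using stab_operator[OF assms(1)] act_eq[OF _ Mm.basis_closed[OF assms(2)]] assms(2) by metis

lemma folded_wall:
  assumes "u \<in> MR J" "i \<in> {0..DIM('a)}" "u \<circ> s i \<notin> ext_weyl_J \<Phi> \<alpha> J"
  shows "act_aff_root u (simple_aff_root \<Phi> \<alpha> i) \<in> RJ J \<times> UNIV"
  using assms(3) ext_weyl_J_iff[OF J assms(1,2)] by (simp add: act_aff_root_def)

lemma act_positive:
  assumes u: "u \<in> MR J" and i: "i \<in> {0..DIM('a)}"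
    and c: "pos_crossing \<Phi> \<alpha> u i" "u \<circ> s i \<in> ext_weyl_J \<Phi> \<alpha> J"
  shows "act (m u) (T (s i)) = \<zeta> (wgt (u \<circ> s i)) \<odot>\<^bsub>M\<^esub> m (theta J (u \<circ> s i))"
proof -
  have uE: "u \<in> EW" "lin u = u" using weyl_ext min_rep_weyl u by blast+
  have "u (aroot i) \<notin> pos" using pos_crossing_wall(1)[OF uE(1) i c(1)] uE(2) by simp
  then show ?thesis
    using act_gen[OF i u] c ext_weyl_J_iff[OF J u i] sc_zero translated_basis_closed[OF u s_ext(1)[OF i]] Mm.basis_closed[OF u]
    by (simp add: gen_value_def)
qed

lemma act_negative:
  assumes u: "u \<in> MR J" and i: "i \<in> {0..DIM('a)}"
    and c: "neg_crossing \<Phi> \<alpha> u i" "u \<circ> s i \<in> ext_weyl_J \<Phi> \<alpha> J"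
  shows "act (m u) (T (s i)) = \<zeta> (wgt (u \<circ> s i)) \<odot>\<^bsub>M\<^esub> m (theta J (u \<circ> s i))
    \<oplus>\<^bsub>M\<^esub> \<iota> (qdiff \<Phi> \<alpha> i) \<odot>\<^bsub>M\<^esub> m u"
proof -
  have uE: "u \<in> EW" "lin u = u" using weyl_ext min_rep_weyl u by blast+
  have "u (aroot i) \<in> pos" using pos_crossing_wall(2)[OF uE(1) i c(1)] uE(2) by simp
  then show ?thesis using act_gen[OF i u] c ext_weyl_J_iff[OF J u i] by (simp add: gen_value_def)
qed

lemma act_folded:
  assumes u: "u \<in> MR J" and i: "i \<in> {0..DIM('a)}" and c: "u \<circ> s i \<notin> ext_weyl_J \<Phi> \<alpha> J"
  shows "act (m u) (T (s i)) =
    \<iota> (vaff \<Phi> \<alpha> J v (act_aff_root u (simple_aff_root \<Phi> \<alpha> i)) \<otimes>\<^bsub>R\<^esub>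
       vaff \<Phi> \<alpha> J v (double_aff_root (act_aff_root u (simple_aff_root \<Phi> \<alpha> i)))) \<odot>\<^bsub>M\<^esub> m u"
proof -
  have "u (aroot i) \<in> RJ J" using ext_weyl_J_iff[OF J u i] c by blast
  then show ?thesis
    using act_gen[OF i u] by (simp add: gen_value_def vaff_def act_aff_root_def double_aff_root_def wall_par_def)
qed

end

theorem theorem5p1:
  fixes \<Phi> :: "'a::euclidean_space set" and \<alpha> :: "nat \<Rightarrow> 'a" and J :: "nat set"
    and v :: "'a \<Rightarrow> qpoly"
    and H :: "(qpoly, 'h) module" and T :: "('a \<Rightarrow> 'a) \<Rightarrow> 'h"
    and M :: "(zpoly set, 'm) module" and m :: "('a \<Rightarrow> 'a) \<Rightarrow> 'm"
  assumes "root_setting \<Phi> \<alpha>"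
    and "J \<subseteq> {1..DIM('a)}"
    and "parameter_system \<Phi> \<alpha> J v"
    and "ext_hecke_algebra \<Phi> \<alpha> H T"
    and "module_basis (RzetaJ \<Phi> \<alpha> J) M (min_reps \<Phi> \<alpha> J) m"
  shows
    "(\<forall>u\<in>min_reps \<Phi> \<alpha> J. \<forall>i\<in>{0..DIM('a)}. u \<circ> gen_refl \<Phi> \<alpha> i \<notin> ext_weyl_J \<Phi> \<alpha> J \<longrightarrow>
        act_aff_root u (simple_aff_root \<Phi> \<alpha> i) \<in> roots_J \<Phi> \<alpha> J \<times> UNIV) \<and>
     (\<exists>act. right_action (Rq \<Phi> \<alpha>) (RzetaJ \<Phi> \<alpha> J) (scalJ \<Phi> \<alpha> J) H M act \<and>
        (\<forall>u\<in>min_reps \<Phi> \<alpha> J. \<forall>i\<in>{0..DIM('a)}.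
           let s = gen_refl \<Phi> \<alpha> i; b = act_aff_root u (simple_aff_root \<Phi> \<alpha> i) in
           (pos_crossing \<Phi> \<alpha> u i \<and> u \<circ> s \<in> ext_weyl_J \<Phi> \<alpha> J \<longrightarrow>
              act (m u) (T s) =
                zetaJ \<Phi> \<alpha> J (wt \<Phi> \<alpha> (u \<circ> s)) \<odot>\<^bsub>M\<^esub> m (theta_up_J \<Phi> \<alpha> J (u \<circ> s))) \<and>
           (neg_crossing \<Phi> \<alpha> u i \<and> u \<circ> s \<in> ext_weyl_J \<Phi> \<alpha> J \<longrightarrow>
              act (m u) (T s) =
                zetaJ \<Phi> \<alpha> J (wt \<Phi> \<alpha> (u \<circ> s)) \<odot>\<^bsub>M\<^esub> m (theta_up_J \<Phi> \<alpha> J (u \<circ> s))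
                \<oplus>\<^bsub>M\<^esub> scalJ \<Phi> \<alpha> J (qdiff \<Phi> \<alpha> i) \<odot>\<^bsub>M\<^esub> m u) \<and>
           (u \<circ> s \<notin> ext_weyl_J \<Phi> \<alpha> J \<longrightarrow>
              act (m u) (T s) =
                scalJ \<Phi> \<alpha> J (vaff \<Phi> \<alpha> J v b \<otimes>\<^bsub>Rq \<Phi> \<alpha>\<^esub> vaff \<Phi> \<alpha> J v (double_aff_root b))
                \<odot>\<^bsub>M\<^esub> m u)) \<and>
        (\<forall>u\<in>min_reps \<Phi> \<alpha> J. \<forall>\<sigma>\<in>alcove_stab \<Phi> \<alpha>.
           act (m u) (T \<sigma>) =
             zetaJ \<Phi> \<alpha> J (wt \<Phi> \<alpha> (u \<circ> \<sigma>)) \<odot>\<^bsub>M\<^esub> m (theta_up_J \<Phi> \<alpha> J (u \<circ> \<sigma>))))"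
proof -
  interpret hecke_setup \<Phi> \<alpha> "{1..DIM('a)}" J v H T M m
    by unfold_locales (use assms in simp_all)
  show ?thesis
    unfolding Let_def
    using folded_wall right_action act_positive act_negative act_folded act_stab
    by (intro conjI ballI impI exI[of _ act]) (simp_all only:)
qed

end
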